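(* There is a universal constant $C>0$ such that the following holds. Let $n\in\mathbb N$, let $\mathcal N=\mathcal N(\mu,\Sigma)$ be the multivariate Gaussian probability measure on $\mathbb R^n$ with mean $\mu\in\mathbb R^n$ and covariance matrix $\Sigma\in\mathbb R^{n\times n}$, $\Sigma\succ0$, and let $X\sim\mathcal N$. Then for all $f:\mathbb R^n\to[0,\infty)$ for which the entropies involved exist, $$\operatorname{Ent}_{\mathcal N}(f)\le C\,\kappa(\Sigma)\sum_{i=1}^n\mathbb E\left[\operatorname{Ent}_{\mathcal N(\cdot\mid X_{-i})}(f)\right].$$
   Context: $\kappa(\Sigma)=\lambda_{\max}(\Sigma)/\lambda_{\min}(\Sigma)$ is the condition number of $\Sigma$. For a probability measure $\nu$ and $f\ge0$ with $f$ and $f|\log f|$ $\nu$-integrable, $\operatorname{Ent}_\nu(f):=\int f\log f\,d\nu-\left(\int f\,d\nu\right)\log\left(\int f\,d\nu\right)$. $X_{-i}$ denotes all entries of $X$ except the $i$-th, and $\mathcal N(\cdot\mid X_{-i})$ is the conditional law of the $i$-th coordinate given the others; in $\operatorname{Ent}_{\mathcal N(\cdot\mid X_{-i})}(f)$, $f$ is regarded as a function of the $i$-th coordinate with the remaining coordinates fixed to $X_{-i}$. *)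

theory Defs
  imports "HOL-Probability.Probability" "Jordan_Normal_Form.Spectral_Radius"
begin

text \<open>
  The dimension \<open>n\<close> has to be quantified inside the scope of the constant \<open>C\<close>, so it cannot be
  a type. Vectors and matrices are those of Jordan_Normal_Form, while the points of the measure
  space \<open>\<real>\<^sup>n\<close> are the extensional functions \<open>nat \<Rightarrow> real\<close> on \<open>{..<n}\<close>, the carrier of the product
  measure \<^term>\<open>Pi\<^sub>M {..<n} (\<lambda>_. lborel)\<close>, i.e. of Lebesgue measure on \<open>\<real>\<^sup>n\<close>.
\<close>

definition pos_def_mat :: "real mat \<Rightarrow> bool" where
  "pos_def_mat A \<longleftrightarrow> A \<in> carrier_mat (dim_row A) (dim_row A) \<and> transpose_mat A = A \<and>
     (\<forall>v \<in> carrier_vec (dim_row A). v \<noteq> 0\<^sub>v (dim_row A) \<longrightarrow> scalar_prod v (mult_mat_vec A v) > 0)"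

definition condition_number :: "real mat \<Rightarrow> real" where
  "condition_number A = Max (spectrum A) / Min (spectrum A)"

definition gaussian_density :: "nat \<Rightarrow> real vec \<Rightarrow> real mat \<Rightarrow> (nat \<Rightarrow> real) \<Rightarrow> real" where
  "gaussian_density n \<mu> \<Sigma> x =
     (let y = Matrix.vec n x - \<mu> in
      exp (- scalar_prod y (mult_mat_vec (the (mat_inverse \<Sigma>)) y) / 2)
        / sqrt ((2 * pi) ^ n * Determinant.det \<Sigma>))"

definition gaussian_measure :: "nat \<Rightarrow> real vec \<Rightarrow> real mat \<Rightarrow> (nat \<Rightarrow> real) measure" where
  "gaussian_measure n \<mu> \<Sigma> =
     density (Pi\<^sub>M {..<n} (\<lambda>_. lborel)) (\<lambda>x. ennreal (gaussian_density n \<mu> \<Sigma> x))"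

text \<open>
  The conditional law of the \<open>i\<close>-th coordinate given the other coordinates of \<open>x\<close>, given by its
  conditional density: the joint density divided by the marginal density of the other coordinates.
  It does not depend on \<open>x i\<close>.
\<close>

definition gaussian_cond :: "nat \<Rightarrow> real vec \<Rightarrow> real mat \<Rightarrow> nat \<Rightarrow> (nat \<Rightarrow> real) \<Rightarrow> real measure" where
  "gaussian_cond n \<mu> \<Sigma> i x =
     density lborel (\<lambda>t. ennreal (gaussian_density n \<mu> \<Sigma> (x(i := t)) /
       (\<integral>s. gaussian_density n \<mu> \<Sigma> (x(i := s)) \<partial>lborel)))"

text \<open>The convention \<open>0 log 0 = 0\<close> is automatic because of the factor \<open>f x\<close>.\<close>

definition ent :: "'a measure \<Rightarrow> ('a \<Rightarrow> real) \<Rightarrow> real" where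
  "ent \<nu> f = (\<integral>x. f x * ln (f x) \<partial>\<nu>) - (\<integral>x. f x \<partial>\<nu>) * ln (\<integral>x. f x \<partial>\<nu>)"

definition ent_exists :: "'a measure \<Rightarrow> ('a \<Rightarrow> real) \<Rightarrow> bool" where
  "ent_exists \<nu> f \<longleftrightarrow> (\<forall>x \<in> space \<nu>. 0 \<le> f x) \<and> integrable \<nu> f \<and>
     integrable \<nu> (\<lambda>x. f x * \<bar>ln (f x)\<bar>)"

end

theory Submission
  imports Defs
begin

text \<open>
  Entropy is subadditive over independent summands: if \<open>X = x + \<xi>\<^sub>1 + \<dots> + \<xi>\<^sub>N\<close> with independent
  \<open>\<xi>\<^sub>k\<close>, then the entropy of \<open>f(X)\<close> is at most the sum over \<open>k\<close> of the mean entropy of \<open>f(X)\<close> when all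
  summands but \<open>\<xi>\<^sub>k\<close> are held fixed (\<open>entropy_tensorization\<close>). The theorem follows by using this twice,
  for two decompositions of the same Gaussian vector \<open>X\<close>.

  First write \<open>X = \<mu> + \<xi>\<^sub>1 + \<dots> + \<xi>\<^sub>N\<close> with \<open>\<xi>\<^sub>k\<close> independent of law \<open>N(0, \<Sigma>/N)\<close>. The \<open>N\<close> terms of the
  sum agree, because only the law of the sum of the fixed summands matters, so the entropy of \<open>f\<close> is at
  most \<open>N\<close> times the mean entropy of \<open>f(X)\<close> given \<open>X' = X - \<xi>\<^sub>1\<close> (\<open>entropy_gaussian_increment\<close>). If \<open>N\<close>
  exceeds \<open>\<kappa>(\<Sigma>) = \<lambda>\<^sub>m\<^sub>a\<^sub>x / \<lambda>\<^sub>m\<^sub>i\<^sub>n\<close>, there is \<open>\<theta>\<close> strictly between \<open>\<lambda>\<^sub>m\<^sub>a\<^sub>x/N\<close> and \<open>\<lambda>\<^sub>m\<^sub>i\<^sub>n\<close>, and then \<open>\<Sigma>/N < \<theta>I < \<Sigma>\<close> as quadratic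
  forms. Hence \<open>X' = V + W\<close> with independent \<open>V\<close> and \<open>W\<close> of covariances \<open>\<Sigma> - \<theta>I\<close> and \<open>\<theta>I - \<Sigma>/N\<close>, and
  \<open>\<zeta> = W + \<xi>\<^sub>1\<close> has law \<open>N(0, \<theta>I)\<close>. Conditioning on less information does not decrease the mean entropy, so \<open>X'\<close>
  may be replaced by \<open>V\<close>.

  Given \<open>V\<close>, the vector \<open>X = V + \<zeta>\<close> has independent coordinates. The second use of subadditivity splits
  \<open>\<zeta>\<close> into its \<open>n\<close> coordinates and leaves the mean entropies given \<open>V\<close> and \<open>\<zeta>\<^sub>-\<^sub>i\<close>. Since \<open>X\<^sub>-\<^sub>i\<close> is a function of
  these, passing to \<open>X\<^sub>-\<^sub>i\<close> does not decrease the mean entropy either (\<open>entropy_coordinate_le\<close>). Choosing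
  \<open>N = \<lfloor>\<kappa>\<rfloor> + 1 \<le> 2\<kappa>\<close> gives the constant \<open>C = 2\<close> (\<open>gaussian_tensorization_bounded\<close>).

  About Gaussian measures this uses that the given density has total mass one, that covariances add
  under convolution (\<open>conv_gaussian\<close>), and that \<open>N(0, \<theta>I)\<close> is a product of one-dimensional normal laws
  (\<open>convs_axis_normals\<close>). The passage from bounded \<open>f\<close> with a positive lower bound to general \<open>f\<close> is a
  truncation, where Fatou's lemma acts in the favourable direction (\<open>xlnx_cexp_clamp\<close>).
\<close>

section \<open>Entropy of a function of two independent variables\<close>

definition xlnx :: "real \<Rightarrow> real" where "xlnx x = x * ln x"

lemma xlnx_measurable [measurable]: "xlnx \<in> borel_measurable borel"
  unfolding xlnx_def by measurable

text \<open>
  The tangent to \<open>x ln x\<close> at \<open>b\<close> lies below the graph. The entropy inequalities below come from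
  integrating this for a well chosen \<open>b\<close> that varies with the point.
\<close>

lemma xlnx_tangent:
  assumes "0 \<le> a" "0 < b"
  shows "a * ln b + a - b \<le> xlnx a"
proof (cases "a = 0")
  case True
  then show ?thesis using assms by (simp add: xlnx_def)
next
  case False
  then have a: "a > 0" using assms by simp
  have "ln (b / a) \<le> b / a - 1" using a assms by (intro ln_le_minus_one) simp
  then have "a * (ln b - ln a) \<le> a * (b / a - 1)"
    using a assms by (intro mult_left_mono) (simp_all add: ln_div)
  then show ?thesis using a by (simp add: xlnx_def algebra_simps)
qed

lemma ln_bounded:
  fixes e :: real
  assumes "0 < e" "e \<le> a" "a \<le> K"
  shows "\<bar>ln a\<bar> \<le> \<bar>ln e\<bar> + \<bar>ln K\<bar>"
proof -
  have "ln e \<le> ln a" "ln a \<le> ln K" using assms by auto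
  then show ?thesis by linarith
qed

lemma xlnx_bounded:
  assumes "0 < e" "e \<le> a" "a \<le> K"
  shows "\<bar>xlnx a\<bar> \<le> K * (\<bar>ln e\<bar> + \<bar>ln K\<bar>)"
  using ln_bounded[OF assms] assms by (auto simp: xlnx_def abs_mult intro!: mult_mono)

lemma (in prob_space) expectation_between:
  fixes f :: "'a \<Rightarrow> real"
  assumes f: "f \<in> borel_measurable M" and b: "\<And>x. x \<in> space M \<Longrightarrow> a \<le> f x \<and> f x \<le> b"
  shows "a \<le> expectation f" "expectation f \<le> b" "integrable M f"
proof -
  show i: "integrable M f"
    using b by (intro integrable_const_bound[of _ "\<bar>a\<bar> + \<bar>b\<bar>"] AE_I2 f) force
  show "a \<le> expectation f" "expectation f \<le> b"
    using integral_ge_const[OF i] integral_le_const[OF i] b by auto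
qed

text \<open>
  Let \<open>q\<close> and \<open>r\<close> be the two partial means of \<open>p\<close> and \<open>m\<close> its total mean. The tangent inequality at
  \<open>q(u) r(v) / m\<close> integrates to the claim: the linear terms cancel because \<open>q(u) r(v) / m\<close> and \<open>p\<close> have
  the same mean \<open>m\<close>, and \<open>p ln q\<close>, \<open>p ln r\<close> integrate to \<open>q ln q\<close>, \<open>r ln r\<close>. In terms of entropy,
  averaging \<open>p\<close> over \<open>v\<close> does not increase its mean entropy in the variable \<open>u\<close>.
\<close>

lemma entropy_submodular:
  fixes p :: "'a \<times> 'b \<Rightarrow> real"
  assumes U: "prob_space U" and V: "prob_space V"
    and p[measurable]: "p \<in> borel_measurable (U \<Otimes>\<^sub>M V)"
    and e: "0 < e"
    and b: "\<And>u v. u \<in> space U \<Longrightarrow> v \<in> space V \<Longrightarrow> e \<le> p (u, v) \<and> p (u, v) \<le> K"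
  shows "(\<integral>u. xlnx (\<integral>v. p (u, v) \<partial>V) \<partial>U) + (\<integral>v. xlnx (\<integral>u. p (u, v) \<partial>U) \<partial>V)
    \<le> (\<integral>u. (\<integral>v. xlnx (p (u, v)) \<partial>V) \<partial>U) + xlnx (\<integral>u. (\<integral>v. p (u, v) \<partial>V) \<partial>U)"
proof -
  interpret U: prob_space U by fact
  interpret V: prob_space V by fact
  interpret P: pair_prob_space U V ..
  define q where "q = (\<lambda>u. \<integral>v. p (u, v) \<partial>V)"
  define r where "r = (\<lambda>v. \<integral>u. p (u, v) \<partial>U)"
  define m where "m = (\<integral>u. q u \<partial>U)"
  have qm[measurable]: "q \<in> borel_measurable U" unfolding q_def by measurable
  have rm[measurable]: "r \<in> borel_measurable V" unfolding r_def by measurable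
  have qb: "e \<le> q u \<and> q u \<le> K" if u: "u \<in> space U" for u
    unfolding q_def using V.expectation_between(1,2)[of "\<lambda>v. p (u,v)" e K] b[OF u] u by auto
  have rb: "e \<le> r v \<and> r v \<le> K" if v: "v \<in> space V" for v
    unfolding r_def using U.expectation_between(1,2)[of "\<lambda>u. p (u,v)" e K] b v by auto
  have mb: "e \<le> m" "m \<le> K"
    unfolding m_def using U.expectation_between(1,2)[of q e K] qb by auto
  have m0: "m > 0" using mb e by linarith
  define L where "L = \<bar>ln e\<bar> + \<bar>ln K\<bar>"
  have K0: "K > 0" using mb e by linarith
  have int: "integrable (U \<Otimes>\<^sub>M V) f"
    if [measurable]: "f \<in> borel_measurable (U \<Otimes>\<^sub>M V)"
      and "\<And>u v. u \<in> space U \<Longrightarrow> v \<in> space V \<Longrightarrow> \<bar>f (u, v)\<bar> \<le> B" for f :: "'a \<times> 'b \<Rightarrow> real" and B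
    using that(2) by (intro P.P.integrable_const_bound[of _ B] AE_I2) (auto simp: space_pair_measure)
  have lnq: "\<bar>ln (q u)\<bar> \<le> L" if "u \<in> space U" for u
    using ln_bounded[of e "q u" K] qb[OF that] e by (simp add: L_def)
  have lnr: "\<bar>ln (r v)\<bar> \<le> L" if "v \<in> space V" for v
    using ln_bounded[of e "r v" K] rb[OF that] e by (simp add: L_def)
  have ip: "integrable (U \<Otimes>\<^sub>M V) p"
  proof (rule int[of _ K])
    fix u v assume uv: "u \<in> space U" "v \<in> space V"
    show "\<bar>p (u, v)\<bar> \<le> K" using b[OF uv] e by linarith
  qed simp
  have i1: "integrable (U \<Otimes>\<^sub>M V) (\<lambda>z. xlnx (p z))"
  proof (rule int[of _ "K * L"])
    fix u v assume uv: "u \<in> space U" "v \<in> space V"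
    show "\<bar>xlnx (p (u, v))\<bar> \<le> K * L"
      unfolding L_def using b[OF uv] e by (intro xlnx_bounded) auto
  qed simp
  have i2: "integrable (U \<Otimes>\<^sub>M V) (\<lambda>z. p z * ln (q (fst z)))"
  proof (rule int[of _ "K * L"])
    fix u v assume uv: "u \<in> space U" "v \<in> space V"
    show "\<bar>p (u, v) * ln (q (fst (u, v)))\<bar> \<le> K * L"
      using b[OF uv] e lnq[OF uv(1)] K0 by (auto simp: abs_mult intro!: mult_mono)
  qed simp
  have i3: "integrable (U \<Otimes>\<^sub>M V) (\<lambda>z. p z * ln (r (snd z)))"
  proof (rule int[of _ "K * L"])
    fix u v assume uv: "u \<in> space U" "v \<in> space V"
    show "\<bar>p (u, v) * ln (r (snd (u, v)))\<bar> \<le> K * L"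
      using b[OF uv] e lnr[OF uv(2)] K0 by (auto simp: abs_mult intro!: mult_mono)
  qed simp
  have i4: "integrable (U \<Otimes>\<^sub>M V) (\<lambda>z. q (fst z) * r (snd z) / m)"
  proof (rule int[of _ "K * K / m"])
    fix u v assume uv: "u \<in> space U" "v \<in> space V"
    show "\<bar>q (fst (u, v)) * r (snd (u, v)) / m\<bar> \<le> K * K / m"
      using qb[OF uv(1)] rb[OF uv(2)] e K0 m0
      by (auto simp: abs_mult intro!: divide_right_mono mult_mono)
  qed simp
  have Ep: "(\<integral>z. p z \<partial>(U \<Otimes>\<^sub>M V)) = m"
    using P.integral_fst'[OF ip] by (simp add: m_def q_def)
  have Er: "(\<integral>v. r v \<partial>V) = m"
    using P.integral_snd[of "\<lambda>u v. p (u, v)"] ip Ep by (simp add: r_def)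
  have E2: "(\<integral>z. p z * ln (q (fst z)) \<partial>(U \<Otimes>\<^sub>M V)) = (\<integral>u. xlnx (q u) \<partial>U)"
    using P.integral_fst'[OF i2] by (simp add: q_def xlnx_def)
  have E3: "(\<integral>z. p z * ln (r (snd z)) \<partial>(U \<Otimes>\<^sub>M V)) = (\<integral>v. xlnx (r v) \<partial>V)"
    using P.integral_snd[of "\<lambda>u v. p (u, v) * ln (r v)"] i3 by (simp add: r_def xlnx_def split_beta')
  have E4: "(\<integral>z. q (fst z) * r (snd z) \<partial>(U \<Otimes>\<^sub>M V)) / m = m"
    using P.integral_fst'[OF i4] m0 by (simp add: Er flip: m_def)
  have "(\<integral>z. p z * ln (q (fst z)) + p z * ln (r (snd z)) - p z * ln m + p z
           - q (fst z) * r (snd z) / m \<partial>(U \<Otimes>\<^sub>M V))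
        \<le> (\<integral>z. xlnx (p z) \<partial>(U \<Otimes>\<^sub>M V))"
  proof (rule integral_mono)
    fix z assume "z \<in> space (U \<Otimes>\<^sub>M V)"
    then obtain u v where z: "z = (u, v)" and uv: "u \<in> space U" "v \<in> space V"
      by (auto simp: space_pair_measure)
    have pos: "0 < q u" "0 < r v" "0 < p (u, v)"
      using qb[OF uv(1)] rb[OF uv(2)] b[OF uv] e by auto
    have "ln (q u * r v / m) = ln (q u) + ln (r v) - ln m"
      using pos m0 by (simp add: ln_mult ln_div)
    then show "p z * ln (q (fst z)) + p z * ln (r (snd z)) - p z * ln m + p z
           - q (fst z) * r (snd z) / m \<le> xlnx (p z)"
      using xlnx_tangent[of "p (u, v)" "q u * r v / m"] pos m0 z by (simp add: ring_distribs)
  qed (use ip i1 i2 i3 i4 in auto)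
  then have "(\<integral>u. xlnx (q u) \<partial>U) + (\<integral>v. xlnx (r v) \<partial>V) - m * ln m + m - m
        \<le> (\<integral>z. xlnx (p z) \<partial>(U \<Otimes>\<^sub>M V))"
    using ip i1 i2 i3 i4 by (simp add: Ep E2 E3 E4)
  then have "(\<integral>u. xlnx (q u) \<partial>U) + (\<integral>v. xlnx (r v) \<partial>V)
      \<le> (\<integral>u. (\<integral>v. xlnx (p (u, v)) \<partial>V) \<partial>U) + xlnx m"
    using P.integral_fst'[OF i1] by (simp add: xlnx_def[of m])
  then show ?thesis unfolding m_def q_def r_def .
qed

section \<open>Averages over independent increments\<close>

abbreviation Rn :: "nat \<Rightarrow> (nat \<Rightarrow> real) measure" where
  "Rn n \<equiv> Pi\<^sub>M {..<n} (\<lambda>_. borel)"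

text \<open>
  Points are extensional functions on \<open>{..<n}\<close>, so their sum has to be restricted to that set.
\<close>

definition vadd :: "nat \<Rightarrow> (nat \<Rightarrow> real) \<Rightarrow> (nat \<Rightarrow> real) \<Rightarrow> nat \<Rightarrow> real" where
  "vadd n x z = (\<lambda>i\<in>{..<n}. x i + z i)"

lemma measurable_vadd [measurable (raw)]:
  assumes [measurable]: "f \<in> M \<rightarrow>\<^sub>M Rn n" "g \<in> M \<rightarrow>\<^sub>M Rn n"
  shows "(\<lambda>x. vadd n (f x) (g x)) \<in> M \<rightarrow>\<^sub>M Rn n"
proof -
  have "(\<lambda>x. f x i) \<in> borel_measurable M" "(\<lambda>x. g x i) \<in> borel_measurable M" if "i < n" for i
    using that by (auto intro!: measurable_compose[OF _ measurable_component_singleton] assms)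
  then show ?thesis unfolding vadd_def by (intro measurable_restrict borel_measurable_add) auto
qed

lemma vadd_space [simp]: "vadd n x z \<in> space (Rn n)"
  by (auto simp: vadd_def space_PiM)

lemma vadd_assoc: "vadd n (vadd n x y) z = vadd n x (vadd n y z)"
  by (auto simp: vadd_def)

lemma vadd_commute: "vadd n x y = vadd n y x"
  by (auto simp: vadd_def)

definition law :: "nat \<Rightarrow> (nat \<Rightarrow> real) measure \<Rightarrow> bool" where
  "law n \<nu> \<longleftrightarrow> prob_space \<nu> \<and> sets \<nu> = sets (Rn n)"

text \<open>
  The mean of \<open>f(x + Z)\<close> for \<open>Z\<close> of law \<open>\<nu>\<close>. If \<open>X = Y + Z\<close> with \<open>Z\<close> independent of \<open>Y\<close>, this is the
  conditional expectation of \<open>f(X)\<close> given \<open>Y = x\<close>, and the composition of averages corresponds to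
  conditioning in stages.
\<close>

definition avg :: "nat \<Rightarrow> (nat \<Rightarrow> real) measure \<Rightarrow> ((nat \<Rightarrow> real) \<Rightarrow> real) \<Rightarrow> (nat \<Rightarrow> real) \<Rightarrow> real" where
  "avg n \<nu> f x = (\<integral>z. f (vadd n x z) \<partial>\<nu>)"

definition bmeas :: "nat \<Rightarrow> ((nat \<Rightarrow> real) \<Rightarrow> real) \<Rightarrow> bool" where
  "bmeas n f \<longleftrightarrow> f \<in> borel_measurable (Rn n) \<and> (\<exists>K. \<forall>x \<in> space (Rn n). \<bar>f x\<bar> \<le> K)"

text \<open>
  On functions with values in a compact subset of \<open>(0,\<infinity>)\<close> the logarithm is bounded, so that all integrals
  met in the entropy argument are integrals of bounded functions.
\<close>

definition bpos :: "nat \<Rightarrow> ((nat \<Rightarrow> real) \<Rightarrow> real) \<Rightarrow> bool" where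
  "bpos n f \<longleftrightarrow> f \<in> borel_measurable (Rn n) \<and>
     (\<exists>e>0. \<exists>K. \<forall>x \<in> space (Rn n). e \<le> f x \<and> f x \<le> K)"

lemma bmeasI: "f \<in> borel_measurable (Rn n) \<Longrightarrow> (\<And>x. x \<in> space (Rn n) \<Longrightarrow> \<bar>f x\<bar> \<le> K) \<Longrightarrow> bmeas n f"
  by (auto simp: bmeas_def)

lemma bmeasE:
  assumes "bmeas n f"
  obtains K where "f \<in> borel_measurable (Rn n)" "\<And>x. x \<in> space (Rn n) \<Longrightarrow> \<bar>f x\<bar> \<le> K"
  using assms by (auto simp: bmeas_def)

lemma bpos_bmeas:
  assumes "bpos n f" shows "bmeas n f"
proof -
  obtain e K where "f \<in> borel_measurable (Rn n)" "0 < e" "\<forall>x \<in> space (Rn n). e \<le> f x \<and> f x \<le> K"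
    using assms by (auto simp: bpos_def)
  then show ?thesis by (intro bmeasI[of _ _ K]) force+
qed

lemma bmeas_xlnx:
  assumes "bpos n f" shows "bmeas n (\<lambda>x. xlnx (f x))"
proof -
  obtain e K where [measurable]: "f \<in> borel_measurable (Rn n)"
    and "0 < e" "\<forall>x \<in> space (Rn n). e \<le> f x \<and> f x \<le> K"
    using assms by (auto simp: bpos_def)
  then show ?thesis by (intro bmeasI[OF _ xlnx_bounded]) auto
qed

lemma bmeas_ln:
  assumes "bpos n f" shows "bmeas n (\<lambda>x. ln (f x))"
proof -
  obtain e K where [measurable]: "f \<in> borel_measurable (Rn n)"
    and "0 < e" "\<forall>x \<in> space (Rn n). e \<le> f x \<and> f x \<le> K"
    using assms by (auto simp: bpos_def)
  then show ?thesis by (intro bmeasI[OF _ ln_bounded]) auto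
qed

lemma bmeas_diff:
  assumes "bmeas n f" "bmeas n g" shows "bmeas n (\<lambda>x. f x - g x)"
  using assms
proof (elim bmeasE)
  fix K K' assume K: "\<And>x. x \<in> space (Rn n) \<Longrightarrow> \<bar>f x\<bar> \<le> K" "\<And>x. x \<in> space (Rn n) \<Longrightarrow> \<bar>g x\<bar> \<le> K'"
    and [measurable]: "f \<in> borel_measurable (Rn n)" "g \<in> borel_measurable (Rn n)"
  have "\<bar>f x - g x\<bar> \<le> K + K'" if "x \<in> space (Rn n)" for x
    using K[OF that] by linarith
  then show ?thesis by (intro bmeasI) measurable
qed

lemma bmeas_mult:
  assumes "bmeas n f" "bmeas n g" shows "bmeas n (\<lambda>x. f x * g x)"
  using assms
proof (elim bmeasE)
  fix K K' assume K: "\<And>x. x \<in> space (Rn n) \<Longrightarrow> \<bar>f x\<bar> \<le> K" "\<And>x. x \<in> space (Rn n) \<Longrightarrow> \<bar>g x\<bar> \<le> K'"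
    and [measurable]: "f \<in> borel_measurable (Rn n)" "g \<in> borel_measurable (Rn n)"
  have "\<bar>f x * g x\<bar> \<le> K * K'" if "x \<in> space (Rn n)" for x
    unfolding abs_mult using K[OF that] by (intro mult_mono) auto
  then show ?thesis by (intro bmeasI) measurable
qed

lemma bmeas_sum: "(\<And>i. i < k \<Longrightarrow> bmeas n (f i)) \<Longrightarrow> bmeas n (\<lambda>x. \<Sum>i<(k::nat). f i x)"
proof (induction k)
  case (Suc k)
  then have "bmeas n (\<lambda>x. f k x - (0 - (\<Sum>i<k. f i x)))"
    by (intro bmeas_diff) (auto simp: bmeas_def)
  then show ?case by (simp add: add.commute)
qed (auto simp: bmeas_def)

lemma sets_law [measurable_cong]: "law n \<nu> \<Longrightarrow> sets \<nu> = sets (Rn n)"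
  by (simp add: law_def)

lemma space_law: "law n \<nu> \<Longrightarrow> space \<nu> = space (Rn n)"
  by (metis law_def sets_eq_imp_space_eq)

lemma measurable_vadd_const [measurable]:
  "x \<in> space (Rn n) \<Longrightarrow> vadd n x \<in> Rn n \<rightarrow>\<^sub>M Rn n"
  by (rule measurable_vadd[OF measurable_const measurable_ident_sets[OF refl]])

lemma measurable_shift_law:
  assumes "law n \<nu>" "f \<in> borel_measurable (Rn n)" "x \<in> space (Rn n)"
  shows "(\<lambda>z. f (vadd n x z)) \<in> borel_measurable \<nu>"
  using measurable_compose[OF measurable_vadd_const[OF assms(3)] assms(2)]
    measurable_cong_sets[OF sets_law[OF assms(1)] refl] by blast

lemma measurable_vadd_pair:
  "(\<lambda>z. vadd n (fst z) (snd z)) \<in> Rn n \<Otimes>\<^sub>M Rn n \<rightarrow>\<^sub>M Rn n"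
  by (intro measurable_vadd measurable_fst measurable_snd)

lemma measurable_vadd_laws:
  assumes "sets \<nu> = sets (Rn n)" "sets \<kappa> = sets (Rn n)"
  shows "(\<lambda>z. vadd n (fst z) (snd z)) \<in> \<nu> \<Otimes>\<^sub>M \<kappa> \<rightarrow>\<^sub>M Rn n"
  using measurable_vadd_pair[of n]
    measurable_cong_sets[OF sets_pair_measure_cong[OF assms] refl] by blast

lemma bmeas_integrable:
  assumes "law n \<nu>" "bmeas n f" and x: "x \<in> space (Rn n)"
  shows "integrable \<nu> (\<lambda>z. f (vadd n x z))"
proof -
  interpret prob_space \<nu> using assms by (simp add: law_def)
  obtain K where K: "\<forall>x \<in> space (Rn n). \<bar>f x\<bar> \<le> K" and [measurable]: "f \<in> borel_measurable (Rn n)"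
    using assms by (auto simp: bmeas_def)
  show ?thesis
    by (rule integrable_const_bound[of _ K])
      (use K x measurable_shift_law[OF assms(1) _ x, of f] in auto)
qed

lemma measurable_avg:
  assumes "law n \<nu>" and [measurable]: "f \<in> borel_measurable (Rn n)"
  shows "avg n \<nu> f \<in> borel_measurable (Rn n)"
proof -
  interpret prob_space \<nu> using assms by (simp add: law_def)
  have "(\<lambda>(x, z). f (vadd n x z)) \<in> borel_measurable (Rn n \<Otimes>\<^sub>M \<nu>)"
    using measurable_compose[OF measurable_vadd_laws[of "Rn n" n \<nu>] assms(2)] assms(1)
    by (simp add: law_def split_beta')
  then show ?thesis unfolding avg_def[abs_def] by (rule borel_measurable_lebesgue_integral)
qed

lemma avg_between:
  assumes "law n \<nu>" and [measurable]: "f \<in> borel_measurable (Rn n)"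
    and b: "\<And>x. x \<in> space (Rn n) \<Longrightarrow> a \<le> f x \<and> f x \<le> b" and x: "x \<in> space (Rn n)"
  shows "a \<le> avg n \<nu> f x \<and> avg n \<nu> f x \<le> b"
proof -
  interpret prob_space \<nu> using assms by (simp add: law_def)
  show ?thesis unfolding avg_def
    using expectation_between(1,2)[OF measurable_shift_law[OF assms(1,2) x], of a b] b by auto
qed

lemma bmeas_avg:
  assumes "law n \<nu>" "bmeas n f"
  shows "bmeas n (avg n \<nu> f)"
proof -
  obtain K where K: "\<forall>x \<in> space (Rn n). \<bar>f x\<bar> \<le> K" and f: "f \<in> borel_measurable (Rn n)"
    using assms by (auto simp: bmeas_def)
  have "\<forall>x \<in> space (Rn n). \<bar>avg n \<nu> f x\<bar> \<le> K"
    using avg_between[OF assms(1) f, of "-K" K] K by (force simp: abs_le_iff)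
  then show ?thesis using measurable_avg[OF assms(1) f] by (auto simp: bmeas_def)
qed

lemma bpos_avg:
  assumes "law n \<nu>" "bpos n f"
  shows "bpos n (avg n \<nu> f)"
proof -
  obtain e K where K: "e > 0" "\<forall>x \<in> space (Rn n). e \<le> f x \<and> f x \<le> K"
      and f: "f \<in> borel_measurable (Rn n)"
    using assms by (auto simp: bpos_def)
  have "\<forall>x \<in> space (Rn n). e \<le> avg n \<nu> f x \<and> avg n \<nu> f x \<le> K"
    using avg_between[OF assms(1) f, of e K] K by auto
  then show ?thesis using K(1) measurable_avg[OF assms(1) f] by (auto simp: bpos_def)
qed

lemma bmeas_avg_xlnx:
  assumes "law n \<nu>" "bpos n f"
  shows "bmeas n (\<lambda>x. xlnx (avg n \<nu> f x))"
  by (intro bmeas_xlnx bpos_avg assms)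

lemma avg_mono:
  assumes "law n \<nu>" "bmeas n f" "bmeas n g" "x \<in> space (Rn n)"
    and "\<And>x. x \<in> space (Rn n) \<Longrightarrow> f x \<le> g x"
  shows "avg n \<nu> f x \<le> avg n \<nu> g x"
  unfolding avg_def using assms bmeas_integrable by (intro integral_mono) auto

lemma avg_cong:
  assumes "\<And>x. x \<in> space (Rn n) \<Longrightarrow> f x = g x"
  shows "avg n \<nu> f x = avg n \<nu> g x"
  unfolding avg_def using assms by (intro Bochner_Integration.integral_cong) auto

lemma avg_diff:
  assumes "law n \<nu>" "bmeas n f" "bmeas n g" "x \<in> space (Rn n)"
  shows "avg n \<nu> (\<lambda>x. f x - g x) x = avg n \<nu> f x - avg n \<nu> g x"
  unfolding avg_def using assms bmeas_integrable by (intro Bochner_Integration.integral_diff) auto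

lemma avg_sum:
  assumes "law n \<nu>" "\<And>i. i \<in> I \<Longrightarrow> bmeas n (f i)" "x \<in> space (Rn n)"
  shows "avg n \<nu> (\<lambda>x. \<Sum>i\<in>I. f i x) x = (\<Sum>i\<in>I. avg n \<nu> (f i) x)"
  unfolding avg_def using assms bmeas_integrable by (intro Bochner_Integration.integral_sum) auto

section \<open>Tensorization of entropy over independent increments\<close>

definition conv :: "nat \<Rightarrow> (nat \<Rightarrow> real) measure \<Rightarrow> (nat \<Rightarrow> real) measure \<Rightarrow> (nat \<Rightarrow> real) measure" where
  "conv n \<nu> \<kappa> = distr (\<nu> \<Otimes>\<^sub>M \<kappa>) (Rn n) (\<lambda>z. vadd n (fst z) (snd z))"

lemma law_pair: "law n \<nu> \<Longrightarrow> law n \<kappa> \<Longrightarrow> pair_prob_space \<nu> \<kappa>"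
  by (simp add: law_def pair_prob_space_def pair_sigma_finite_def prob_space_imp_sigma_finite)

lemma law_conv:
  assumes "law n \<nu>" "law n \<kappa>" shows "law n (conv n \<nu> \<kappa>)"
proof -
  interpret P: pair_prob_space \<nu> \<kappa> by (rule law_pair[OF assms(1,2)])
  note [measurable] = measurable_vadd_laws[OF sets_law[OF assms(1)] sets_law[OF assms(2)]]
  show ?thesis unfolding law_def conv_def by (auto intro!: P.P.prob_space_distr)
qed

lemma integrable_avg_pair:
  assumes "law n \<nu>" "law n \<kappa>" "bmeas n f" "x \<in> space (Rn n)"
  shows "integrable (\<nu> \<Otimes>\<^sub>M \<kappa>) (\<lambda>z. f (vadd n x (vadd n (fst z) (snd z))))"
proof -
  interpret P: pair_prob_space \<nu> \<kappa> by (rule law_pair[OF assms(1,2)])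
  note [measurable] = measurable_vadd_laws[OF sets_law[OF assms(1)] sets_law[OF assms(2)]]
  obtain K where K: "\<forall>x \<in> space (Rn n). \<bar>f x\<bar> \<le> K" and [measurable]: "f \<in> borel_measurable (Rn n)"
    using assms by (auto simp: bmeas_def)
  show ?thesis
    by (rule P.P.integrable_const_bound[of _ K]) (use K assms(4) in auto)
qed

lemma avg_conv:
  assumes "law n \<nu>" "law n \<kappa>" "bmeas n f" "x \<in> space (Rn n)"
  shows "avg n (conv n \<nu> \<kappa>) f x = avg n \<nu> (avg n \<kappa> f) x"
proof -
  interpret P: pair_prob_space \<nu> \<kappa> by (rule law_pair[OF assms(1,2)])
  note [measurable] = measurable_vadd_laws[OF sets_law[OF assms(1)] sets_law[OF assms(2)]]
  have [measurable]: "f \<in> borel_measurable (Rn n)"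
    using assms by (auto simp: bmeas_def)
  have "avg n (conv n \<nu> \<kappa>) f x = (\<integral>z. f (vadd n x (vadd n (fst z) (snd z))) \<partial>(\<nu> \<Otimes>\<^sub>M \<kappa>))"
    unfolding avg_def conv_def using assms(4) by (subst integral_distr) auto
  also have "\<dots> = (\<integral>u. (\<integral>v. f (vadd n x (vadd n u v)) \<partial>\<kappa>) \<partial>\<nu>)"
    using P.integral_fst'[OF integrable_avg_pair[OF assms]] by simp
  finally show ?thesis unfolding avg_def by (simp add: vadd_assoc)
qed

lemma avg_commute:
  assumes "law n \<nu>" "law n \<kappa>" "bmeas n f" "x \<in> space (Rn n)"
  shows "avg n \<nu> (avg n \<kappa> f) x = avg n \<kappa> (avg n \<nu> f) x"
proof -
  interpret P: pair_prob_space \<nu> \<kappa> by (rule law_pair[OF assms(1,2)])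
  have i: "integrable (\<nu> \<Otimes>\<^sub>M \<kappa>) (\<lambda>z. f (vadd n x (vadd n (fst z) (snd z))))"
    by (rule integrable_avg_pair[OF assms])
  have "avg n \<nu> (avg n \<kappa> f) x = (\<integral>u. (\<integral>v. f (vadd n x (vadd n u v)) \<partial>\<kappa>) \<partial>\<nu>)"
    unfolding avg_def by (simp add: vadd_assoc)
  also have "\<dots> = (\<integral>v. (\<integral>u. f (vadd n x (vadd n u v)) \<partial>\<nu>) \<partial>\<kappa>)"
    using P.Fubini_integral[of "\<lambda>u v. f (vadd n x (vadd n u v))"] i by (simp add: split_beta')
  also have "\<dots> = avg n \<kappa> (avg n \<nu> f) x"
    unfolding avg_def vadd_assoc
    by (intro Bochner_Integration.integral_cong refl arg_cong[where f = f] arg_cong[where f = "vadd n x"]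
      vadd_commute)
  finally show ?thesis .
qed

lemma xlnx_avg_submodular:
  assumes "law n \<nu>" "law n \<kappa>" "bpos n h" "x \<in> space (Rn n)"
  shows "avg n \<nu> (\<lambda>y. xlnx (avg n \<kappa> h y)) x + avg n \<kappa> (\<lambda>y. xlnx (avg n \<nu> h y)) x
    \<le> avg n \<nu> (avg n \<kappa> (\<lambda>y. xlnx (h y))) x + xlnx (avg n \<nu> (avg n \<kappa> h) x)"
proof -
  note [measurable] = measurable_vadd_laws[OF sets_law[OF assms(1)] sets_law[OF assms(2)]]
  obtain e K where K: "e > 0" "\<forall>x \<in> space (Rn n). e \<le> h x \<and> h x \<le> K"
      and [measurable]: "h \<in> borel_measurable (Rn n)"
    using assms by (auto simp: bpos_def)
  have "(\<integral>u. xlnx (\<integral>v. h (vadd n x (vadd n (fst (u, v)) (snd (u, v)))) \<partial>\<kappa>) \<partial>\<nu>)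
      + (\<integral>v. xlnx (\<integral>u. h (vadd n x (vadd n (fst (u, v)) (snd (u, v)))) \<partial>\<nu>) \<partial>\<kappa>)
    \<le> (\<integral>u. (\<integral>v. xlnx (h (vadd n x (vadd n (fst (u, v)) (snd (u, v))))) \<partial>\<kappa>) \<partial>\<nu>)
      + xlnx (\<integral>u. (\<integral>v. h (vadd n x (vadd n (fst (u, v)) (snd (u, v)))) \<partial>\<kappa>) \<partial>\<nu>)"
    by (rule entropy_submodular[where e = e and K = K]) (use assms K in \<open>auto simp: law_def\<close>)
  moreover have "vadd n (vadd n x v) u = vadd n x (vadd n u v)" for u v
    by (metis vadd_assoc vadd_commute)
  ultimately show ?thesis unfolding avg_def by (simp add: vadd_assoc)
qed

text \<open>
  Jensen's inequality for \<open>x ln x\<close>, from the tangent at the mean.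
\<close>

lemma xlnx_avg_le:
  assumes "law n \<nu>" "bpos n f" "x \<in> space (Rn n)"
  shows "xlnx (avg n \<nu> f x) \<le> avg n \<nu> (\<lambda>y. xlnx (f y)) x"
proof -
  interpret prob_space \<nu> using assms by (simp add: law_def)
  obtain e K where K: "e > 0" "\<forall>x \<in> space (Rn n). e \<le> f x \<and> f x \<le> K"
    using assms by (auto simp: bpos_def)
  obtain e' K' where K': "e' > 0" "\<forall>x \<in> space (Rn n). e' \<le> avg n \<nu> f x \<and> avg n \<nu> f x \<le> K'"
    using bpos_avg[OF assms(1,2)] by (auto simp: bpos_def)
  define m where "m = avg n \<nu> f x"
  have m: "m > 0" using K' assms(3) by (force simp: m_def)
  have if': "integrable \<nu> (\<lambda>z. f (vadd n x z))"
    using assms bpos_bmeas bmeas_integrable by blast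
  have "(\<integral>z. f (vadd n x z) * ln m + f (vadd n x z) - m \<partial>\<nu>) \<le> avg n \<nu> (\<lambda>y. xlnx (f y)) x"
    unfolding avg_def
  proof (rule integral_mono)
    show "integrable \<nu> (\<lambda>z. xlnx (f (vadd n x z)))"
      using assms bmeas_xlnx bmeas_integrable[of n \<nu> "\<lambda>x. xlnx (f x)"] by blast
    fix z
    show "f (vadd n x z) * ln m + f (vadd n x z) - m \<le> xlnx (f (vadd n x z))"
      using m K by (intro xlnx_tangent) (auto intro: order_trans[of 0 e])
  qed (use if' in auto)
  moreover have "(\<integral>z. f (vadd n x z) * ln m + f (vadd n x z) - m \<partial>\<nu>) = m * ln m + m - m"
    using if' by (simp add: m_def avg_def prob_space)
  ultimately show ?thesis by (simp add: xlnx_def m_def)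
qed

primrec convs :: "nat \<Rightarrow> (nat \<Rightarrow> real) measure list \<Rightarrow> (nat \<Rightarrow> real) measure" where
  "convs n [] = return (Rn n) (\<lambda>i\<in>{..<n}. 0)"
| "convs n (\<nu> # xs) = conv n \<nu> (convs n xs)"

lemma law_convs: "(\<And>\<nu>. \<nu> \<in> set xs \<Longrightarrow> law n \<nu>) \<Longrightarrow> law n (convs n xs)"
proof (induction xs)
  case Nil
  show ?case by (auto simp: law_def space_PiM intro!: prob_space_return)
qed (auto intro: law_conv)

lemma avg_convs_Nil:
  assumes "x \<in> space (Rn n)" "f \<in> borel_measurable (Rn n)"
  shows "avg n (convs n []) f x = f x"
proof -
  note [measurable] = assms(2)
  have "vadd n x (\<lambda>i\<in>{..<n}. 0) = x"
    using assms by (auto simp: vadd_def space_PiM fun_eq_iff PiE_def extensional_def)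
  then show ?thesis using assms unfolding avg_def convs.simps
    by (subst integral_return) (auto simp: space_PiM)
qed

lemma avg_convs_Cons:
  assumes "law n \<nu>" "\<And>\<nu>. \<nu> \<in> set xs \<Longrightarrow> law n \<nu>" "bmeas n f" "x \<in> space (Rn n)"
  shows "avg n (convs n (\<nu> # xs)) f x = avg n \<nu> (avg n (convs n xs) f) x"
  unfolding convs.simps by (rule avg_conv[OF assms(1) law_convs[OF assms(2)] assms(3,4)])

definition remove_nth :: "nat \<Rightarrow> 'a list \<Rightarrow> 'a list" where
  "remove_nth i xs = take i xs @ drop (Suc i) xs"

lemma remove_nth_Cons [simp]:
  "remove_nth 0 (x # xs) = xs" "remove_nth (Suc i) (x # xs) = x # remove_nth i xs"
  by (simp_all add: remove_nth_def)

lemma set_remove_nth: "set (remove_nth i xs) \<subseteq> set xs"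
  by (auto simp: remove_nth_def dest: in_set_takeD in_set_dropD)

text \<open>
  Independent summands may be added in any order.
\<close>

lemma avg_convs_remove:
  assumes "\<And>\<nu>. \<nu> \<in> set xs \<Longrightarrow> law n \<nu>" "bmeas n f" "x \<in> space (Rn n)" "i < length xs"
  shows "avg n (convs n (remove_nth i xs)) (avg n (xs ! i) f) x = avg n (convs n xs) f x"
  using assms
proof (induction xs arbitrary: i x)
  case (Cons \<nu> xs)
  then have l: "law n \<nu>" "\<And>\<nu>. \<nu> \<in> set xs \<Longrightarrow> law n \<nu>" by auto
  show ?case
  proof (cases i)
    case 0
    then show ?thesis using l Cons.prems
      by (simp add: avg_conv law_convs avg_commute[of n "convs n xs"])
  next
    case (Suc j)
    then have j: "j < length xs" using Cons.prems by simp
    have lr: "\<And>\<nu>. \<nu> \<in> set (remove_nth j xs) \<Longrightarrow> law n \<nu>"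
      using l(2) set_remove_nth[of j xs] by (auto dest: subsetD)
    have "avg n (convs n (\<nu> # remove_nth j xs)) (avg n (xs ! j) f) x
        = avg n \<nu> (avg n (convs n (remove_nth j xs)) (avg n (xs ! j) f)) x"
      using Cons.prems l lr j by (intro avg_convs_Cons bmeas_avg) auto
    also have "\<dots> = avg n \<nu> (avg n (convs n xs) f) x"
      using Cons.IH[OF l(2) Cons.prems(2) _ j] by (intro avg_cong) auto
    also have "\<dots> = avg n (convs n (\<nu> # xs)) f x"
      using Cons.prems l by (intro avg_convs_Cons[symmetric]) auto
    finally show ?thesis using Suc by simp
  qed
qed simp

text \<open>
  Induction over the summands. With \<open>S\<close> the average over the first summand and \<open>T\<close> the average over the
  others, the left-hand side for \<open>S T\<close> splits into \<open>S\<close> applied to the left-hand side for \<open>T\<close>, which the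
  induction hypothesis bounds, and the entropy of \<open>T f\<close> under \<open>S\<close>. By submodularity the latter is at most
  the term of the first summand.
\<close>

theorem entropy_tensorization:
  assumes "\<And>\<nu>. \<nu> \<in> set xs \<Longrightarrow> law n \<nu>" "bpos n f" "x \<in> space (Rn n)"
  shows "avg n (convs n xs) (\<lambda>y. xlnx (f y)) x - xlnx (avg n (convs n xs) f x)
    \<le> (\<Sum>i<length xs. avg n (convs n xs) (\<lambda>y. xlnx (f y)) x
         - avg n (convs n (remove_nth i xs)) (\<lambda>y. xlnx (avg n (xs ! i) f y)) x)"
  using assms
proof (induction xs arbitrary: x)
  case Nil
  have [measurable]: "f \<in> borel_measurable (Rn n)" using Nil(2) by (simp add: bpos_def)
  have "avg n (convs n []) (\<lambda>y. xlnx (f y)) x = xlnx (f x)"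
    "avg n (convs n []) f x = f x"
    by (intro avg_convs_Nil Nil(3); measurable)+
  then show ?case by simp
next
  case (Cons \<nu> xs)
  then have l: "law n \<nu>" "\<And>\<nu>. \<nu> \<in> set xs \<Longrightarrow> law n \<nu>" by auto
  have lx: "law n (convs n xs)" using l by (intro law_convs)
  note bx = bmeas_xlnx[OF Cons.prems(2)]
  note bf = bpos_bmeas[OF Cons.prems(2)]
  have lr: "law n (convs n (remove_nth i xs))" for i
    using l(2) set_remove_nth[of i xs] by (intro law_convs) (auto dest: subsetD)
  let ?T = "avg n (convs n xs)" and ?S = "avg n \<nu>"
  let ?F = "\<lambda>y. xlnx (f y)"
  let ?R = "\<lambda>i y. avg n (convs n (remove_nth i xs)) (\<lambda>y. xlnx (avg n (xs ! i) f y)) y"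
  have bR: "bmeas n (?R i)" if "i < length xs" for i
    using that l Cons.prems(2) by (intro bmeas_avg bmeas_xlnx bpos_avg lr) auto
  note b1 = bmeas_avg[OF lx bx] and b2 = bmeas_avg_xlnx[OF lx Cons.prems(2)]
  have c: "avg n (convs n (\<nu> # xs)) g x = ?S (?T g) x" if "bmeas n g" for g
    using l Cons.prems(3) that by (intro avg_convs_Cons)
  have cr: "avg n (convs n (\<nu> # remove_nth i xs)) g x
      = ?S (avg n (convs n (remove_nth i xs)) g) x" if "bmeas n g" for g i
    using l Cons.prems(3) that set_remove_nth[of i xs] by (intro avg_convs_Cons) auto
  have IH: "?S (\<lambda>y. ?T ?F y - xlnx (?T f y)) x \<le> ?S (\<lambda>y. \<Sum>i<length xs. ?T ?F y - ?R i y) x"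
  proof (rule avg_mono[OF l(1)])
    show "bmeas n (\<lambda>y. \<Sum>i<length xs. ?T ?F y - ?R i y)"
      using bR by (intro bmeas_sum bmeas_diff b1)
  qed (use Cons.IH[OF l(2) Cons.prems(2)] Cons.prems(3) in \<open>auto intro!: bmeas_diff b1 b2\<close>)
  have IH': "?S (?T ?F) x - ?S (\<lambda>y. xlnx (?T f y)) x
      \<le> (\<Sum>i<length xs. ?S (?T ?F) x - ?S (?R i) x)"
  proof -
    have "?S (\<lambda>y. \<Sum>i<length xs. ?T ?F y - ?R i y) x
        = (\<Sum>i<length xs. ?S (\<lambda>y. ?T ?F y - ?R i y) x)"
      using bR by (intro avg_sum[OF l(1) _ Cons.prems(3)] bmeas_diff b1) auto
    also have "\<dots> = (\<Sum>i<length xs. ?S (?T ?F) x - ?S (?R i) x)"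
      using bR by (intro sum.cong refl avg_diff[OF l(1) b1 _ Cons.prems(3)]) auto
    finally show ?thesis
      using IH avg_diff[OF l(1) b1 b2 Cons.prems(3)] by linarith
  qed
  have sub: "?S (\<lambda>y. xlnx (?T f y)) x + ?T (\<lambda>y. xlnx (?S f y)) x
      \<le> ?S (?T ?F) x + xlnx (?S (?T f) x)"
    by (rule xlnx_avg_submodular[OF l(1) lx Cons.prems(2,3)])
  have e0: "avg n (convs n (remove_nth 0 (\<nu> # xs))) (\<lambda>y. xlnx (avg n ((\<nu> # xs) ! 0) f y)) x
      = ?T (\<lambda>y. xlnx (?S f y)) x" by simp
  have eS: "avg n (convs n (remove_nth (Suc i) (\<nu> # xs))) (\<lambda>y. xlnx (avg n ((\<nu> # xs) ! Suc i) f y)) x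
      = ?S (?R i) x" if "i < length xs" for i
    using cr[OF bmeas_avg_xlnx[OF l(2) Cons.prems(2)], of "xs ! i" i] that
    by (simp del: convs.simps)
  have "(\<Sum>i<length (\<nu> # xs). avg n (convs n (\<nu> # xs)) ?F x
         - avg n (convs n (remove_nth i (\<nu> # xs))) (\<lambda>y. xlnx (avg n ((\<nu> # xs) ! i) f y)) x)
      = (?S (?T ?F) x - ?T (\<lambda>y. xlnx (?S f y)) x)
        + (\<Sum>i<length xs. ?S (?T ?F) x - ?S (?R i) x)"
    unfolding length_Cons sum.lessThan_Suc_shift e0 c[OF bx] using eS by simp
  then show ?case
    unfolding c[OF bx] c[OF bf] using IH' sub by linarith
qed

section \<open>Quadratic forms and the spectrum of a symmetric matrix\<close>

definition bform :: "real mat \<Rightarrow> real vec \<Rightarrow> real vec \<Rightarrow> real" where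
  "bform A x y = scalar_prod x (mult_mat_vec A y)"

definition sym_mat :: "nat \<Rightarrow> real mat \<Rightarrow> bool" where
  "sym_mat n A \<longleftrightarrow> A \<in> carrier_mat n n \<and> transpose_mat A = A"

lemma sym_matD: "sym_mat n A \<Longrightarrow> A \<in> carrier_mat n n"
  by (simp add: sym_mat_def)

lemma bform_add_left:
  assumes "A \<in> carrier_mat n n" "x \<in> carrier_vec n" "y \<in> carrier_vec n" "z \<in> carrier_vec n"
  shows "bform A (x + y) z = bform A x z + bform A y z"
  unfolding bform_def using assms by (intro add_scalar_prod_distrib) auto

lemma bform_add_right:
  assumes "A \<in> carrier_mat n n" "x \<in> carrier_vec n" "y \<in> carrier_vec n" "z \<in> carrier_vec n"
  shows "bform A x (y + z) = bform A x y + bform A x z"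
  unfolding bform_def using assms
  by (simp add: mult_add_distrib_mat_vec[of _ n n] scalar_prod_add_distrib[of _ n])

lemma bform_smult_left:
  assumes "A \<in> carrier_mat n n" "x \<in> carrier_vec n" "y \<in> carrier_vec n"
  shows "bform A (c \<cdot>\<^sub>v x) y = c * bform A x y"
  unfolding bform_def using assms by (intro smult_scalar_prod_distrib) auto

lemma bform_smult_right:
  assumes "A \<in> carrier_mat n n" "x \<in> carrier_vec n" "y \<in> carrier_vec n"
  shows "bform A x (c \<cdot>\<^sub>v y) = c * bform A x y"
  unfolding bform_def using assms by (simp add: mult_mat_vec)

lemma bform_sym:
  assumes "sym_mat n A" "x \<in> carrier_vec n" "y \<in> carrier_vec n"
  shows "bform A x y = bform A y x"
proof -
  have "bform A x y = scalar_prod (mult_mat_vec A x) y"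
    using transpose_vec_mult_scalar[of A n n y x] assms by (simp add: bform_def sym_mat_def)
  also have "\<dots> = bform A y x"
    unfolding bform_def using assms sym_matD[OF assms(1)] by (intro comm_scalar_prod[of _ n]) auto
  finally show ?thesis .
qed

lemma bform_mat_add:
  assumes "A \<in> carrier_mat n n" "B \<in> carrier_mat n n" "x \<in> carrier_vec n" "y \<in> carrier_vec n"
  shows "bform (A + B) x y = bform A x y + bform B x y"
  unfolding bform_def using assms
  by (simp add: add_mult_distrib_mat_vec[of _ n n] scalar_prod_add_distrib[of _ n])

lemma smult_mat_vec:
  assumes "A \<in> carrier_mat n n" "x \<in> carrier_vec n"
  shows "(c \<cdot>\<^sub>m A) *\<^sub>v x = (c::real) \<cdot>\<^sub>v (A *\<^sub>v x)"
  using assms by (intro eq_vecI) auto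

lemma bform_mat_smult:
  assumes "A \<in> carrier_mat n n" "x \<in> carrier_vec n" "y \<in> carrier_vec n"
  shows "bform (c \<cdot>\<^sub>m A) x y = c * bform A x y"
  unfolding bform_def using assms by (simp add: smult_mat_vec)

lemma bform_one:
  assumes "x \<in> carrier_vec n" "y \<in> carrier_vec n"
  shows "bform (1\<^sub>m n) x y = scalar_prod x y"
  unfolding bform_def using assms by simp

lemma scalar_prod_self_nonneg: "0 \<le> scalar_prod (x :: real vec) x"
  by (auto simp: scalar_prod_def intro: sum_nonneg)

lemma scalar_prod_self_pos:
  assumes "x \<in> carrier_vec n" "x \<noteq> 0\<^sub>v n"
  shows "0 < scalar_prod (x :: real vec) x"
proof -
  obtain i where "i < n" "x $ i \<noteq> 0"
    using assms by (metis carrier_vecD eq_vecI index_zero_vec)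
  then show ?thesis
    unfolding scalar_prod_def using assms by (intro sum_pos2[of _ i]) auto
qed

lemma bform_bounded:
  assumes "A \<in> carrier_mat n n"
  shows "\<exists>C>0. \<forall>x \<in> carrier_vec n. \<bar>bform A x x\<bar> \<le> C * scalar_prod x x"
proof -
  let ?S = "\<Sum>i\<in>{0..<n}. \<Sum>j\<in>{0..<n}. \<bar>A $$ (i, j)\<bar>"
  have "\<bar>bform A x x\<bar> \<le> (?S + 1) * scalar_prod x x" if x: "x \<in> carrier_vec n" for x
  proof -
    have comp: "(x $ i)\<^sup>2 \<le> scalar_prod x x" if "i < n" for i
    proof -
      have "(x $ i)\<^sup>2 = (\<Sum>k\<in>{i}. x $ k * x $ k)" by (simp add: power2_eq_square)
      also have "\<dots> \<le> scalar_prod x x"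
        unfolding scalar_prod_def using that x by (intro sum_mono2) auto
      finally show ?thesis .
    qed
    have "\<bar>x $ i * x $ j\<bar> \<le> scalar_prod x x" if "i < n" "j < n" for i j
    proof -
      have "0 \<le> (\<bar>x $ i\<bar> - \<bar>x $ j\<bar>)\<^sup>2" by simp
      then have "2 * \<bar>x $ i * x $ j\<bar> \<le> (x $ i)\<^sup>2 + (x $ j)\<^sup>2"
        by (simp add: power2_diff abs_mult)
      then show ?thesis using comp[OF that(1)] comp[OF that(2)] by linarith
    qed
    then have le: "\<bar>x $ i * (A $$ (i, j) * x $ j)\<bar> \<le> \<bar>A $$ (i, j)\<bar> * scalar_prod x x"
      if "i < n" "j < n" for i j
      using mult_left_mono[of "\<bar>x $ i * x $ j\<bar>" "scalar_prod x x" "\<bar>A $$ (i, j)\<bar>"] that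
      by (simp add: abs_mult mult.left_commute)
    have "bform A x x = (\<Sum>i\<in>{0..<n}. \<Sum>j\<in>{0..<n}. x $ i * (A $$ (i, j) * x $ j))"
      using x assms by (simp add: bform_def scalar_prod_def sum_distrib_left)
    also have "\<bar>\<dots>\<bar> \<le> (\<Sum>i\<in>{0..<n}. \<bar>\<Sum>j\<in>{0..<n}. x $ i * (A $$ (i, j) * x $ j)\<bar>)"
      by (rule sum_abs)
    also have "\<dots> \<le> (\<Sum>i\<in>{0..<n}. \<Sum>j\<in>{0..<n}. \<bar>x $ i * (A $$ (i, j) * x $ j)\<bar>)"
      by (intro sum_mono sum_abs)
    also have "\<dots> \<le> (\<Sum>i\<in>{0..<n}. \<Sum>j\<in>{0..<n}. \<bar>A $$ (i, j)\<bar> * scalar_prod x x)"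
      by (intro sum_mono le) auto
    also have "\<dots> = ?S * scalar_prod x x" by (simp add: sum_distrib_right)
    finally show ?thesis using scalar_prod_self_nonneg[of x] by (simp add: algebra_simps)
  qed
  moreover have "?S + 1 > 0" by (intro add_nonneg_pos sum_nonneg) auto
  ultimately show ?thesis by blast
qed

lemma psd_cauchy_schwarz:
  assumes A: "sym_mat n A" and psd: "\<And>v. v \<in> carrier_vec n \<Longrightarrow> 0 \<le> bform A v v"
    and x: "x \<in> carrier_vec n" and y: "y \<in> carrier_vec n"
  shows "(bform A x y)\<^sup>2 \<le> bform A x x * bform A y y"
proof -
  let ?a = "bform A y y" and ?b = "bform A x y" and ?c = "bform A x x"
  have q: "0 \<le> ?c + 2 * s * ?b + s\<^sup>2 * ?a" for s
  proof -
    have "0 \<le> bform A (x + s \<cdot>\<^sub>v y) (x + s \<cdot>\<^sub>v y)" using x y by (intro psd) auto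
    also have "\<dots> = ?c + 2 * s * ?b + s\<^sup>2 * ?a"
      using x y sym_matD[OF A] bform_sym[OF A y x]
      by (simp add: bform_add_left[of _ n] bform_add_right[of _ n] bform_smult_left[of _ n]
          bform_smult_right[of _ n] power2_eq_square algebra_simps)
    finally show ?thesis .
  qed
  have a: "0 \<le> ?a" by (rule psd[OF y])
  show ?thesis
  proof (cases "?a = 0")
    case True
    have "?b = 0"
    proof (rule ccontr)
      assume "?b \<noteq> 0"
      then show False using q[of "- (?c + 1) / (2 * ?b)"] True by (simp add: field_simps)
    qed
    then show ?thesis using True by simp
  next
    case False
    then have "0 \<le> ?a * (?c + 2 * (- ?b / ?a) * ?b + (- ?b / ?a)\<^sup>2 * ?a)"
      using a q[of "- ?b / ?a"] by simp
    also have "\<dots> = ?c * ?a - ?b\<^sup>2" using False by (simp add: field_simps power2_eq_square)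
    finally show ?thesis by simp
  qed
qed

text \<open>
  This replaces a compactness argument on the sphere. With \<open>y = B v\<close>, so \<open>A y = v\<close>, Cauchy--Schwarz for the
  form of \<open>A\<close> reads \<open>(v \<bullet> v)\<^sup>2 \<le> (v \<bullet> A v) (v \<bullet> B v)\<close>, and \<open>v \<bullet> B v\<close> is at most a multiple of \<open>v \<bullet> v\<close>.
\<close>

lemma psd_invertible_coercive:
  assumes A: "sym_mat n A" and psd: "\<And>v. v \<in> carrier_vec n \<Longrightarrow> 0 \<le> bform A v v"
    and B: "B \<in> carrier_mat n n" "A * B = 1\<^sub>m n"
  shows "\<exists>d>0. \<forall>v \<in> carrier_vec n. d * scalar_prod v v \<le> bform A v v"
proof -
  obtain C where C: "C > 0" "\<forall>x \<in> carrier_vec n. \<bar>bform B x x\<bar> \<le> C * scalar_prod x x"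
    using bform_bounded[OF B(1)] by blast
  have "inverse C * scalar_prod v v \<le> bform A v v" if v: "v \<in> carrier_vec n" for v
  proof (cases "scalar_prod v v = 0")
    case True
    then show ?thesis using psd[OF v] by simp
  next
    case False
    then have pos: "0 < scalar_prod v v" using scalar_prod_self_nonneg[of v] by simp
    define y where "y = B *\<^sub>v v"
    have y: "y \<in> carrier_vec n" using B v by (simp add: y_def)
    have Ay: "A *\<^sub>v y = v"
      using sym_matD[OF A] B v assoc_mult_mat_vec[of A n n B n v] by (simp add: y_def)
    have "(scalar_prod v v)\<^sup>2 = (bform A v y)\<^sup>2" by (simp add: bform_def Ay)
    also have "\<dots> \<le> bform A v v * bform A y y" by (rule psd_cauchy_schwarz[OF A psd v y])
    also have "bform A y y = bform B v v"
      unfolding bform_def Ay using y v B by (simp add: y_def comm_scalar_prod[of _ n])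
    also have "bform A v v * \<dots> \<le> bform A v v * (C * scalar_prod v v)"
      using C v psd[OF v] by (intro mult_left_mono) (auto simp: abs_le_iff)
    finally have "scalar_prod v v * scalar_prod v v \<le> (bform A v v * C) * scalar_prod v v"
      by (simp add: power2_eq_square mult.assoc)
    then have "scalar_prod v v \<le> bform A v v * C" using pos by simp
    then show ?thesis using C(1) by (simp add: field_simps)
  qed
  then show ?thesis using C(1) by (intro exI[of _ "inverse C"]) auto
qed

lemma nonsingular_inverse:
  assumes "A \<in> carrier_mat n n" "Determinant.det A \<noteq> (0::real)"
  obtains B where "B \<in> carrier_mat n n" "A * B = 1\<^sub>m n" "B * A = 1\<^sub>m n"
proof -
  have "A \<in> Units (ring_mat TYPE(real) n ())" by (rule det_non_zero_imp_unit[OF assms])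
  then show ?thesis using that unfolding Units_def by (auto simp: ring_mat_def)
qed

lemma sym_mat_shift:
  assumes "sym_mat n A" shows "sym_mat n (A + c \<cdot>\<^sub>m 1\<^sub>m n)"
  using assms unfolding sym_mat_def
  by (auto simp: transpose_add[of _ n n] intro!: arg_cong2[where f = "(+)"] eq_matI)

text \<open>
  Let \<open>t\<close> be the largest number for which \<open>A - t I\<close> is positive semidefinite. If \<open>t\<close> were not an
  eigenvalue, \<open>A - t I\<close> would be invertible, hence coercive, and \<open>t\<close> could be increased.
\<close>

lemma symmetric_bottom_eigenvalue:
  assumes A: "sym_mat n A" and n: "0 < n"
  shows "\<exists>t \<in> spectrum A. \<forall>v \<in> carrier_vec n. t * scalar_prod v v \<le> bform A v v"
proof -
  note Ac = sym_matD[OF A]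
  define T where "T = {t. \<forall>v \<in> carrier_vec n. t * scalar_prod v v \<le> bform A v v}"
  obtain C where C: "\<forall>x \<in> carrier_vec n. \<bar>bform A x x\<bar> \<le> C * scalar_prod x x"
    using bform_bounded[OF Ac] by blast
  have "- C \<in> T" using C by (auto simp: T_def abs_le_iff)
  then have ne: "T \<noteq> {}" by blast
  have e0: "unit_vec n 0 \<in> carrier_vec n" "scalar_prod (unit_vec n 0) (unit_vec n 0) = (1::real)"
    using n by auto
  have bdd: "bdd_above T"
  proof (rule bdd_aboveI)
    fix t assume "t \<in> T"
    then have "t * scalar_prod (unit_vec n 0) (unit_vec n 0) \<le> bform A (unit_vec n 0) (unit_vec n 0)"
      using e0(1) by (simp add: T_def)
    then show "t \<le> bform A (unit_vec n 0) (unit_vec n 0)" by (simp only: e0(2) mult_1_right)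
  qed
  define t where "t = Sup T"
  have tT: "t \<in> T" unfolding T_def
  proof (intro CollectI ballI)
    fix v :: "real vec" assume v: "v \<in> carrier_vec n"
    show "t * scalar_prod v v \<le> bform A v v"
    proof (cases "scalar_prod v v = 0")
      case True
      then show ?thesis using C v by (auto dest!: bspec)
    next
      case False
      then have pos: "0 < scalar_prod v v" using scalar_prod_self_nonneg[of v] by simp
      have "t \<le> bform A v v / scalar_prod v v"
        unfolding t_def using v pos by (intro cSup_least[OF ne]) (auto simp: T_def field_simps)
      then show ?thesis using pos by (simp add: field_simps)
    qed
  qed
  have "t \<in> spectrum A"
  proof (rule ccontr)
    assume "t \<notin> spectrum A"
    then have d: "Determinant.det (char_matrix A t) \<noteq> 0"
      by (simp add: spectrum_def eigenvalue_det[OF Ac])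
    have cm: "char_matrix A t = A + (- t) \<cdot>\<^sub>m 1\<^sub>m n" using Ac by (simp add: char_matrix_def)
    have S: "sym_mat n (char_matrix A t)" unfolding cm by (rule sym_mat_shift[OF A])
    have form: "bform (char_matrix A t) v v = bform A v v - t * scalar_prod v v"
      if "v \<in> carrier_vec n" for v
      unfolding cm using that Ac
      by (subst bform_mat_add[of _ n]) (auto simp: bform_mat_smult[of _ n] bform_one)
    obtain B where B: "B \<in> carrier_mat n n" "char_matrix A t * B = 1\<^sub>m n"
      using nonsingular_inverse[OF sym_matD[OF S] d] by blast
    obtain \<delta> where \<delta>: "\<delta> > 0"
      "\<forall>v \<in> carrier_vec n. \<delta> * scalar_prod v v \<le> bform (char_matrix A t) v v"
      using psd_invertible_coercive[OF S _ B] tT form by (force simp: T_def)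
    have "t + \<delta> \<in> T" using \<delta>(2) form by (auto simp: T_def algebra_simps)
    then have "t + \<delta> \<le> t" unfolding t_def by (intro cSup_upper bdd)
    then show False using \<delta>(1) by simp
  qed
  then show ?thesis using tT by (auto simp: T_def)
qed

lemma pos_def_matD:
  assumes "pos_def_mat A" "A \<in> carrier_mat n n"
  shows "sym_mat n A" "v \<in> carrier_vec n \<Longrightarrow> v \<noteq> 0\<^sub>v n \<Longrightarrow> 0 < bform A v v"
  using assms by (auto simp: pos_def_mat_def sym_mat_def bform_def)

lemma pos_def_matI:
  assumes "sym_mat n A" "\<And>v. v \<in> carrier_vec n \<Longrightarrow> v \<noteq> 0\<^sub>v n \<Longrightarrow> 0 < bform A v v"
  shows "pos_def_mat A"
  using assms by (auto simp: pos_def_mat_def sym_mat_def bform_def)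

lemma eigenvalue_form:
  assumes "A \<in> carrier_mat n n" "k \<in> spectrum A"
  obtains v where "v \<in> carrier_vec n" "v \<noteq> 0\<^sub>v n" "bform A v v = k * scalar_prod v v"
  using assms by (auto simp: spectrum_def eigenvalue_def eigenvector_def bform_def)

lemma spectrum_uminus:
  fixes A :: "real mat"
  assumes "A \<in> carrier_mat n n" "k \<in> spectrum (- A)"
  shows "- k \<in> spectrum A"
proof -
  obtain v where v: "v \<in> carrier_vec n" "v \<noteq> 0\<^sub>v n" "(- A) *\<^sub>v v = k \<cdot>\<^sub>v v"
    using assms by (auto simp: spectrum_def eigenvalue_def eigenvector_def)
  have "- (A *\<^sub>v v) = k \<cdot>\<^sub>v v" using v assms by simp
  then have "A *\<^sub>v v = (- k) \<cdot>\<^sub>v v"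
    using v(1) assms(1) by (auto simp: vec_eq_iff)
  then show ?thesis using v(1,2) assms by (auto simp: spectrum_def eigenvalue_def eigenvector_def)
qed

text \<open>
  The lower bound comes from the bottom eigenvalue of \<open>A\<close>, the upper bound from that of \<open>- A\<close>.
\<close>

lemma spectrum_bounds:
  assumes A: "pos_def_mat A" "A \<in> carrier_mat n n" and n: "0 < n"
  shows "0 < Min (spectrum A)" "Min (spectrum A) \<le> Max (spectrum A)"
    "v \<in> carrier_vec n \<Longrightarrow> Min (spectrum A) * scalar_prod v v \<le> bform A v v"
    "v \<in> carrier_vec n \<Longrightarrow> bform A v v \<le> Max (spectrum A) * scalar_prod v v"
proof -
  note S = pos_def_matD[OF A]
  have fin: "finite (spectrum A)" by (rule card_finite_spectrum(1)[OF A(2)])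
  obtain t where t: "t \<in> spectrum A" "\<forall>v \<in> carrier_vec n. t * scalar_prod v v \<le> bform A v v"
    using symmetric_bottom_eigenvalue[OF S(1) n] by blast
  have ne: "spectrum A \<noteq> {}" using t by blast
  show "Min (spectrum A) \<le> Max (spectrum A)" using fin ne by simp
  have "Min (spectrum A) \<in> spectrum A" using fin ne by simp
  then obtain w where w: "w \<in> carrier_vec n" "w \<noteq> 0\<^sub>v n"
    "bform A w w = Min (spectrum A) * scalar_prod w w"
    using eigenvalue_form[OF A(2)] by blast
  show "0 < Min (spectrum A)"
    using S(2)[OF w(1,2)] scalar_prod_self_pos[OF w(1,2)] w(3) by (simp add: zero_less_mult_iff)
  have m: "sym_mat n (- A)"
    using S(1) by (auto simp: sym_mat_def transpose_uminus)
  obtain s where s: "s \<in> spectrum (- A)"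
    "\<forall>v \<in> carrier_vec n. s * scalar_prod v v \<le> bform (- A) v v"
    using symmetric_bottom_eigenvalue[OF m n] by blast
  have s': "- s \<le> Max (spectrum A)" using fin spectrum_uminus[OF A(2) s(1)] by simp
  show "Min (spectrum A) * scalar_prod v v \<le> bform A v v" if v: "v \<in> carrier_vec n"
  proof -
    have "Min (spectrum A) * scalar_prod v v \<le> t * scalar_prod v v"
      using fin t(1) scalar_prod_self_nonneg by (intro mult_right_mono) auto
    then show ?thesis using t(2) v by fastforce
  qed
  show "bform A v v \<le> Max (spectrum A) * scalar_prod v v" if v: "v \<in> carrier_vec n"
  proof -
    have "bform (- A) v v = - bform A v v" using v A(2) by (simp add: bform_def)
    then have "bform A v v \<le> (- s) * scalar_prod v v" using s(2) v by fastforce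
    also have "\<dots> \<le> Max (spectrum A) * scalar_prod v v"
      using s' scalar_prod_self_nonneg by (intro mult_right_mono) auto
    finally show ?thesis .
  qed
qed

section \<open>The Gaussian integral\<close>

abbreviation Ln :: "nat \<Rightarrow> (nat \<Rightarrow> real) measure" where
  "Ln n \<equiv> Pi\<^sub>M {..<n} (\<lambda>_. lborel)"

lemma sets_PiM_lborel: "sets (Pi\<^sub>M I (\<lambda>_. lborel)) = sets (Pi\<^sub>M I (\<lambda>_. borel :: real measure))"
  by (intro sets_PiM_cong) auto

lemma borel_PiM_lborel:
  "borel_measurable (Pi\<^sub>M I (\<lambda>_. lborel)) = borel_measurable (Pi\<^sub>M I (\<lambda>_. borel :: real measure))"
  by (intro measurable_cong_sets sets_PiM_lborel refl)

interpretation lborels: product_sigma_finite "\<lambda>_ :: nat. lborel :: real measure" ..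

lemma borel_measurable_pair_lborel:
  "f \<in> borel_measurable (M \<Otimes>\<^sub>M lborel) \<longleftrightarrow> f \<in> borel_measurable (M \<Otimes>\<^sub>M borel)"
  using measurable_cong_sets[OF sets_pair_measure_cong[OF refl sets_lborel] refl] by blast

lemma law_eqI:
  assumes l: "law n \<nu>" "law n \<kappa>"
    and eq: "\<And>f :: _ \<Rightarrow> ennreal. f \<in> borel_measurable (Rn n) \<Longrightarrow> integral\<^sup>N \<nu> f = integral\<^sup>N \<kappa> f"
  shows "\<nu> = \<kappa>"
proof (rule measure_eqI)
  show "sets \<nu> = sets \<kappa>" using l by (simp add: law_def)
  fix X assume "X \<in> sets \<nu>"
  then have "X \<in> sets (Rn n)" using l by (simp add: law_def)
  then show "emeasure \<nu> X = emeasure \<kappa> X"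
    using eq[of "indicator X"] l by (simp add: law_def)
qed

lemma sigma_finite_Ln: "sigma_finite_measure (Ln n)"
  by (rule lborels.sigma_finite) simp

lemma nn_integral_Ln_Suc:
  assumes "f \<in> borel_measurable (Rn (Suc n))"
  shows "(\<integral>\<^sup>+x. f x \<partial>Ln (Suc n)) = (\<integral>\<^sup>+x. (\<integral>\<^sup>+y. f (x(n := y)) \<partial>lborel) \<partial>Ln n)"
  using lborels.product_nn_integral_insert[of "{..<n}" n f] assms
  by (simp add: lessThan_Suc borel_PiM_lborel)

lemma measurable_fun_upd_Rn:
  assumes "f \<in> borel_measurable (Rn (Suc n))"
  shows "(\<lambda>(x, y). f (x(n := y))) \<in> borel_measurable (Rn n \<Otimes>\<^sub>M borel)"
proof -
  have "(\<lambda>(x, y). x(n := y)) \<in> (Rn n \<Otimes>\<^sub>M borel) \<rightarrow>\<^sub>M Rn (Suc n)"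
    using measurable_add_dim[of n "{..<n}" "\<lambda>_. borel :: real measure"] by (simp add: lessThan_Suc)
  from measurable_compose[OF this assms] show ?thesis by (simp add: split_beta')
qed

lemma nn_integral_Ln_translate:
  assumes "f \<in> borel_measurable (Rn n)"
  shows "(\<integral>\<^sup>+x. f (vadd n x c) \<partial>Ln n) = (\<integral>\<^sup>+x. f x \<partial>Ln n)"
  using assms
proof (induction n arbitrary: f)
  case 0
  have "vadd 0 x c = x" if "x \<in> space (Ln 0)" for x
    using that by (auto simp: vadd_def space_PiM restrict_def)
  then show ?case by (intro nn_integral_cong) simp
next
  case (Suc n)
  note m = measurable_fun_upd_Rn[OF Suc.prems]
  have "(\<lambda>x. vadd (Suc n) x c) \<in> Rn (Suc n) \<rightarrow>\<^sub>M Rn (Suc n)"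
    unfolding vadd_def by (rule measurable_restrict) (auto simp del: lessThan_Suc)
  then have "(\<integral>\<^sup>+x. f (vadd (Suc n) x c) \<partial>Ln (Suc n))
      = (\<integral>\<^sup>+x. (\<integral>\<^sup>+y. f (vadd (Suc n) (x(n := y)) c) \<partial>lborel) \<partial>Ln n)"
    by (intro nn_integral_Ln_Suc measurable_compose[OF _ Suc.prems])
  also have "\<dots> = (\<integral>\<^sup>+x. (\<integral>\<^sup>+y. f ((vadd n x c)(n := y)) \<partial>lborel) \<partial>Ln n)"
  proof (rule nn_integral_cong)
    fix x
    have "vadd (Suc n) (x(n := y)) c = (vadd n x c)(n := c n + 1 * y)" for y
      by (auto simp: vadd_def)
    moreover have "(\<lambda>y. f ((vadd n x c)(n := y))) \<in> borel_measurable borel"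
      using measurable_Pair2[OF m, of "vadd n x c"] by (simp add: fun_upd_def)
    ultimately show "(\<integral>\<^sup>+y. f (vadd (Suc n) (x(n := y)) c) \<partial>lborel)
        = (\<integral>\<^sup>+y. f ((vadd n x c)(n := y)) \<partial>lborel)"
      using nn_integral_real_affine[of "\<lambda>y. f ((vadd n x c)(n := y))" 1 "c n"] by simp
  qed
  also have "\<dots> = (\<integral>\<^sup>+x. (\<integral>\<^sup>+y. f (x(n := y)) \<partial>lborel) \<partial>Ln n)"
  proof (rule Suc.IH)
    have "(\<lambda>(x, y). f (x(n := y))) \<in> borel_measurable (Rn n \<Otimes>\<^sub>M lborel)"
      using m borel_measurable_pair_lborel by blast
    then show "(\<lambda>x. \<integral>\<^sup>+y. f (x(n := y)) \<partial>lborel) \<in> borel_measurable (Rn n)"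
      by (rule lborel.borel_measurable_nn_integral)
  qed
  also have "\<dots> = (\<integral>\<^sup>+x. f x \<partial>Ln (Suc n))"
    by (rule nn_integral_Ln_Suc[OF Suc.prems, symmetric])
  finally show ?case .
qed

lemma nn_integral_gaussian_1d:
  assumes "0 < d"
  shows "(\<integral>\<^sup>+y. ennreal (exp (- (d * (y + b)\<^sup>2) / 2)) \<partial>lborel) = ennreal (sqrt (2 * pi / d))"
proof -
  have "exp (- (d * (y + b)\<^sup>2) / 2) = sqrt (2 * pi / d) * normal_density (- b) (1 / sqrt d) y" for y
    using assms by (simp add: normal_density_def real_sqrt_divide real_sqrt_mult field_simps)
  then have "(\<integral>\<^sup>+y. ennreal (exp (- (d * (y + b)\<^sup>2) / 2)) \<partial>lborel)
      = ennreal (sqrt (2 * pi / d)) * (\<integral>\<^sup>+y. ennreal (normal_density (- b) (1 / sqrt d) y) \<partial>lborel)"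
    using assms by (simp add: ennreal_mult nn_integral_cmult)
  also have "(\<integral>\<^sup>+y. ennreal (normal_density (- b) (1 / sqrt d) y) \<partial>lborel) = 1"
    using assms by (subst nn_integral_eq_integral) auto
  finally show ?thesis by simp
qed

definition quad_form :: "nat \<Rightarrow> real mat \<Rightarrow> (nat \<Rightarrow> real) \<Rightarrow> real" where
  "quad_form n A x = bform A (Matrix.vec n x) (Matrix.vec n x)"

lemma quad_form_sum:
  assumes "A \<in> carrier_mat n n"
  shows "quad_form n A x = (\<Sum>i<n. \<Sum>j<n. x i * (A $$ (i, j) * x j))"
  using assms by (simp add: quad_form_def bform_def scalar_prod_def sum_distrib_left atLeast0LessThan)

lemma quad_form_measurable [measurable]:
  assumes "A \<in> carrier_mat n n"
  shows "quad_form n A \<in> borel_measurable (Rn n)"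
proof -
  have "(\<lambda>x. \<Sum>i<n. \<Sum>j<n. x i * (A $$ (i, j) * x j)) \<in> borel_measurable (Rn n)"
    by measurable
  then show ?thesis using quad_form_sum[OF assms] by (simp cong: measurable_cong)
qed

lemma vec_nonzero_component:
  assumes "v \<in> carrier_vec n" "v \<noteq> 0\<^sub>v n"
  obtains x where "v = Matrix.vec n x" "\<exists>i<n. x i \<noteq> (0::real)"
proof -
  have "v = Matrix.vec n (\<lambda>i. v $ i)" using assms by auto
  moreover have "\<exists>i<n. v $ i \<noteq> 0" using assms by (metis carrier_vecD eq_vecI index_zero_vec)
  ultimately show ?thesis using that by blast
qed

text \<open>
  The matrix of the quadratic form that is left after minimising the form of \<open>P\<close> over the last of its
  \<open>n + 1\<close> variables.
\<close>

definition schur_complement :: "nat \<Rightarrow> real mat \<Rightarrow> real mat" where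
  "schur_complement n P = Matrix.mat n n (\<lambda>(i, j). P $$ (i, j) - P $$ (i, n) * P $$ (n, j) / P $$ (n, n))"

lemma schur_carrier [simp]: "schur_complement n P \<in> carrier_mat n n"
  by (simp add: schur_complement_def)

lemma sym_mat_index: "sym_mat n A \<Longrightarrow> i < n \<Longrightarrow> j < n \<Longrightarrow> A $$ (i, j) = A $$ (j, i)"
  unfolding sym_mat_def by (metis carrier_matD index_transpose_mat(1))

lemma quad_form_schur:
  assumes P: "sym_mat (Suc n) P" and d: "P $$ (n, n) \<noteq> 0"
  shows "quad_form (Suc n) P (x(n := y)) = P $$ (n, n) * (y + (\<Sum>i<n. P $$ (i, n) * x i) / P $$ (n, n))\<^sup>2
    + quad_form n (schur_complement n P) x"
proof -
  let ?d = "P $$ (n, n)" and ?b = "\<Sum>i<n. P $$ (i, n) * x i"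
  have s: "P $$ (n, j) = P $$ (j, n)" if "j < n" for j using sym_mat_index[OF P, of n j] that by simp
  have "quad_form (Suc n) P (x(n := y)) = (\<Sum>i<n. \<Sum>j<n. x i * (P $$ (i, j) * x j)) + 2 * y * ?b + y\<^sup>2 * ?d"
    unfolding quad_form_sum[OF sym_matD[OF P]]
    by (simp add: s sum.distrib sum_distrib_left sum_distrib_right power2_eq_square algebra_simps)
  moreover have "quad_form n (schur_complement n P) x
      = (\<Sum>i<n. \<Sum>j<n. x i * (P $$ (i, j) * x j)) - ?b * ?b / ?d"
  proof -
    have "quad_form n (schur_complement n P) x = (\<Sum>i<n. \<Sum>j<n. x i * (P $$ (i, j) * x j)
        - (P $$ (i, n) * x i) * (P $$ (j, n) * x j) / ?d)"
      unfolding quad_form_sum[OF schur_carrier]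
      by (intro sum.cong refl) (simp add: schur_complement_def s algebra_simps)
    then show ?thesis by (simp add: sum_subtractf sum_product sum_divide_distrib)
  qed
  moreover have "?d * (y + ?b / ?d)\<^sup>2 = y\<^sup>2 * ?d + 2 * y * ?b + ?b * ?b / ?d"
    using d by (simp add: power2_eq_square field_simps)
  ultimately show ?thesis by linarith
qed

text \<open>
  One step of block elimination: multiplying \<open>P\<close> by a unipotent matrix clears the last row up to its
  diagonal entry.
\<close>

lemma det_schur:
  assumes P: "P \<in> carrier_mat (Suc n) (Suc n)" and d: "P $$ (n, n) \<noteq> 0"
  shows "Determinant.det P = Determinant.det (schur_complement n P) * P $$ (n, n)"
proof -
  define A where "A = Matrix.mat n n (\<lambda>ij. P $$ ij)"
  define b where "b = Matrix.mat n 1 (\<lambda>(i, j). P $$ (i, n))"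
  define c where "c = Matrix.mat 1 n (\<lambda>(i, j). P $$ (n, j))"
  define D where "D = Matrix.mat 1 1 (\<lambda>_. P $$ (n, n))"
  define u where "u = Matrix.mat 1 n (\<lambda>(i, j). - P $$ (n, j) / P $$ (n, n))"
  have car: "A \<in> carrier_mat n n" "b \<in> carrier_mat n 1" "c \<in> carrier_mat 1 n" "D \<in> carrier_mat 1 1"
    "u \<in> carrier_mat 1 n"
    by (auto simp: A_def b_def c_def D_def u_def)
  let ?U = "four_block_mat (1\<^sub>m n) (0\<^sub>m n 1) u (1\<^sub>m 1)"
  have PB: "P = four_block_mat A b c D"
    using P by (intro eq_matI) (auto simp: A_def b_def c_def D_def less_Suc_eq not_less)
  have "P * ?U = four_block_mat (A * 1\<^sub>m n + b * u) (A * 0\<^sub>m n 1 + b * 1\<^sub>m 1)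
      (c * 1\<^sub>m n + D * u) (c * 0\<^sub>m n 1 + D * 1\<^sub>m 1)"
    unfolding PB using car by (intro mult_four_block_mat) auto
  also have "A * 1\<^sub>m n + b * u = schur_complement n P"
    using car by (intro eq_matI)
      (auto simp: A_def b_def u_def schur_complement_def scalar_prod_def)
  also have "A * 0\<^sub>m n 1 + b * 1\<^sub>m 1 = b" using car by auto
  also have "c * 1\<^sub>m n + D * u = 0\<^sub>m 1 n"
    using car d by (intro eq_matI) (auto simp: c_def D_def u_def scalar_prod_def)
  also have "c * 0\<^sub>m n 1 + D * 1\<^sub>m 1 = D" using car by auto
  finally have "Determinant.det (P * ?U) = Determinant.det (schur_complement n P) * Determinant.det D"
    using car by (simp add: det_four_block_mat_lower_left_zero[of _ n _ 1])
  moreover have "Determinant.det ?U = 1"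
    using car by (subst det_four_block_mat_upper_right_zero[of _ n _ 1]) auto
  moreover have "Determinant.det D = P $$ (n, n)"
    using det_single[OF car(4)] by (simp add: D_def)
  moreover have "?U \<in> carrier_mat (Suc n) (Suc n)" using car by (auto simp: four_block_mat_def)
  ultimately show ?thesis using det_mult[OF P, of ?U] by simp
qed

text \<open>
  Integrating out the last variable, after completing the square in it, gives a factor
  \<open>sqrt (2 * pi / d)\<close> with \<open>d\<close> the last diagonal entry and leaves the Gaussian integral of the Schur complement.
  The determinant loses the same factor \<open>d\<close>, and the Schur complement is again positive definite.
\<close>

lemma gaussian_integral:
  assumes "pos_def_mat P" "P \<in> carrier_mat n n"
  shows "0 < Determinant.det P \<and>
    (\<integral>\<^sup>+x. ennreal (exp (- quad_form n P x / 2)) \<partial>Ln n) = ennreal (sqrt ((2 * pi) ^ n / Determinant.det P))"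
  using assms
proof (induction n arbitrary: P)
  case 0
  then have "quad_form 0 P x = 0" for x using quad_form_sum[of P 0] by simp
  moreover have "Determinant.det P = 1" using 0 by (simp add: det_dim_zero)
  ultimately show ?case by (simp add: nn_integral_count_space_finite PiM_empty)
next
  case (Suc n)
  note P = pos_def_matD[OF Suc.prems]
  define d where "d = P $$ (n, n)"
  define S where "S = schur_complement n P"
  have "0 < bform P (unit_vec (Suc n) n) (unit_vec (Suc n) n)"
    by (rule P(2)) (auto simp: unit_vec_def vec_eq_iff)
  also have "\<dots> = d"
    using Suc.prems(2) by (simp add: bform_def d_def mult_mat_vec_def)
  finally have d: "0 < d" .
  have sch: "quad_form (Suc n) P (x(n := y)) = d * (y + (\<Sum>i<n. P $$ (i, n) * x i) / d)\<^sup>2 + quad_form n S x" for x y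
    using quad_form_schur[OF P(1)] d by (simp add: d_def S_def)
  have "pos_def_mat S"
  proof (rule pos_def_matI)
    show "sym_mat n S"
      unfolding sym_mat_def S_def
      by (auto simp: schur_complement_def intro!: eq_matI simp: sym_mat_index[OF P(1)])
    fix v :: "real vec" assume "v \<in> carrier_vec n" "v \<noteq> 0\<^sub>v n"
    then obtain x where x: "v = Matrix.vec n x" "\<exists>i<n. x i \<noteq> 0" using vec_nonzero_component by blast
    \<comment> \<open>The last coordinate that minimises the form of \<open>P\<close>.\<close>
    let ?x = "x(n := - (\<Sum>i<n. P $$ (i, n) * x i) / d)"
    have "bform S v v = quad_form (Suc n) P ?x" unfolding sch by (simp add: x(1) quad_form_def)
    also have "\<dots> > 0"
      unfolding quad_form_def using x(2) by (intro P(2)) (auto simp: vec_eq_iff less_Suc_eq)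
    finally show "0 < bform S v v" .
  qed
  then have IH: "0 < Determinant.det S"
    "(\<integral>\<^sup>+x. ennreal (exp (- quad_form n S x / 2)) \<partial>Ln n) = ennreal (sqrt ((2 * pi) ^ n / Determinant.det S))"
    using Suc.IH[of S] by (simp_all add: S_def)
  have det: "Determinant.det P = Determinant.det S * d"
    using det_schur[OF Suc.prems(2)] d by (simp add: d_def S_def)
  have [measurable]: "quad_form (Suc n) P \<in> borel_measurable (Rn (Suc n))" by (rule quad_form_measurable[OF Suc.prems(2)])
  have [measurable]: "quad_form n S \<in> borel_measurable (Rn n)" by (rule quad_form_measurable) (simp add: S_def)
  have "(\<integral>\<^sup>+x. ennreal (exp (- quad_form (Suc n) P x / 2)) \<partial>Ln (Suc n))
      = (\<integral>\<^sup>+x. (\<integral>\<^sup>+y. ennreal (exp (- quad_form (Suc n) P (x(n := y)) / 2)) \<partial>lborel) \<partial>Ln n)"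
    by (rule nn_integral_Ln_Suc) measurable
  also have "\<dots> = (\<integral>\<^sup>+x. ennreal (sqrt (2 * pi / d)) * ennreal (exp (- quad_form n S x / 2)) \<partial>Ln n)"
  proof (rule nn_integral_cong)
    fix x
    let ?b = "(\<Sum>i<n. P $$ (i, n) * x i) / d"
    have "exp (- quad_form (Suc n) P (x(n := y)) / 2) = exp (- (d * (y + ?b)\<^sup>2) / 2) * exp (- quad_form n S x / 2)" for y
      unfolding sch by (simp add: add_divide_distrib diff_divide_distrib flip: exp_add)
    then have "(\<integral>\<^sup>+y. ennreal (exp (- quad_form (Suc n) P (x(n := y)) / 2)) \<partial>lborel)
        = (\<integral>\<^sup>+y. ennreal (exp (- (d * (y + ?b)\<^sup>2) / 2)) \<partial>lborel) * ennreal (exp (- quad_form n S x / 2))"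
      by (simp add: ennreal_mult nn_integral_multc)
    then show "(\<integral>\<^sup>+y. ennreal (exp (- quad_form (Suc n) P (x(n := y)) / 2)) \<partial>lborel)
        = ennreal (sqrt (2 * pi / d)) * ennreal (exp (- quad_form n S x / 2))"
      unfolding nn_integral_gaussian_1d[OF d] .
  qed
  also have "\<dots> = ennreal (sqrt (2 * pi / d)) * ennreal (sqrt ((2 * pi) ^ n / Determinant.det S))"
    unfolding IH(2)[symmetric] by (rule nn_integral_cmult) (simp add: borel_PiM_lborel)
  also have "\<dots> = ennreal (sqrt ((2 * pi) ^ Suc n / Determinant.det P))"
    using d IH(1) by (simp add: det ennreal_mult[symmetric] real_sqrt_mult[symmetric] mult.commute)
  finally show ?case using det d IH(1) by simp
qed

section \<open>Gaussian measures\<close>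

lemma pos_def_inverse:
  assumes A: "pos_def_mat A" "A \<in> carrier_mat n n"
  defines "Q \<equiv> the (mat_inverse A)"
  shows "Q \<in> carrier_mat n n" "A * Q = 1\<^sub>m n" "Q * A = 1\<^sub>m n" "pos_def_mat Q"
    "0 < Determinant.det A" "Determinant.det Q = 1 / Determinant.det A"
proof -
  note P = pos_def_matD[OF A]
  show d: "0 < Determinant.det A" using gaussian_integral[OF A] by simp
  have "A \<in> Units (ring_mat TYPE(real) n ())" using d by (intro det_non_zero_imp_unit[OF A(2)]) simp
  then obtain B where "mat_inverse A = Some B" using mat_inverse(1)[OF A(2)] by fastforce
  then show Q: "Q \<in> carrier_mat n n" "A * Q = 1\<^sub>m n" "Q * A = 1\<^sub>m n"
    using mat_inverse(2)[OF A(2)] by (auto simp: Q_def)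
  show "Determinant.det Q = 1 / Determinant.det A"
    using det_mult[OF A(2) Q(1)] d by (simp add: Q(2) field_simps)
  have "transpose_mat Q = transpose_mat Q * (A * Q)" using Q by simp
  also have "\<dots> = transpose_mat (A * Q) * Q"
    using Q(1) A(2) P(1) by (simp add: transpose_mult[of _ n n] sym_mat_def assoc_mult_mat[of _ n n _ n _ n])
  also have "\<dots> = Q" using Q by simp
  finally have S: "sym_mat n Q" using Q(1) by (simp add: sym_mat_def)
  show "pos_def_mat Q"
  proof (rule pos_def_matI[OF S])
    fix v :: "real vec" assume v: "v \<in> carrier_vec n" "v \<noteq> 0\<^sub>v n"
    have AQv: "A *\<^sub>v (Q *\<^sub>v v) = v"
      using assoc_mult_mat_vec[OF A(2) Q(1) v(1)] v(1) by (simp add: Q(2))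
    have "A *\<^sub>v 0\<^sub>v n = 0\<^sub>v n" using A(2) by (intro eq_vecI) auto
    then have "Q *\<^sub>v v \<noteq> 0\<^sub>v n" using AQv v by auto
    then have "0 < bform A (Q *\<^sub>v v) (Q *\<^sub>v v)" using Q(1) v by (intro P(2)) auto
    also have "\<dots> = bform Q v v"
      unfolding bform_def AQv using Q(1) v by (intro comm_scalar_prod[of _ n]) auto
    finally show "0 < bform Q v v" .
  qed
qed

abbreviation (input) cov_inv :: "real mat \<Rightarrow> real mat" where
  "cov_inv A \<equiv> the (mat_inverse A)"

abbreviation cdens :: "nat \<Rightarrow> real mat \<Rightarrow> (nat \<Rightarrow> real) \<Rightarrow> real" where
  "cdens n A \<equiv> gaussian_density n (0\<^sub>v n) A"

abbreviation cgauss :: "nat \<Rightarrow> real mat \<Rightarrow> (nat \<Rightarrow> real) measure" where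
  "cgauss n A \<equiv> gaussian_measure n (0\<^sub>v n) A"

lemma gaussian_density_quad_form:
  assumes "A \<in> carrier_mat n n"
  shows "cdens n A x
    = exp (- quad_form n (cov_inv A) x / 2) / sqrt ((2 * pi) ^ n * Determinant.det A)"
proof -
  have "Matrix.vec n x - 0\<^sub>v n = Matrix.vec n x" by auto
  then show ?thesis by (simp add: gaussian_density_def quad_form_def bform_def Let_def)
qed

lemma gaussian_density_shift:
  assumes "\<mu> \<in> carrier_vec n"
  shows "gaussian_density n \<mu> A x = cdens n A (vadd n x (\<lambda>i. - \<mu> $ i))"
proof -
  have "Matrix.vec n x - \<mu> = Matrix.vec n (vadd n x (\<lambda>i. - \<mu> $ i)) - 0\<^sub>v n"
    using assms by (auto simp: vadd_def)
  then show ?thesis by (simp add: gaussian_density_def)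
qed

lemma measurable_vadd_any: "(\<lambda>x. vadd n x c) \<in> Rn n \<rightarrow>\<^sub>M Rn n"
  unfolding vadd_def by (rule measurable_restrict) auto

lemma gaussian_density_measurable:
  assumes A: "pos_def_mat A" "A \<in> carrier_mat n n" and \<mu>: "\<mu> \<in> carrier_vec n"
  shows "gaussian_density n \<mu> A \<in> borel_measurable (Rn n)"
proof -
  have [measurable]: "quad_form n (cov_inv A) \<in> borel_measurable (Rn n)"
    by (rule quad_form_measurable[OF pos_def_inverse(1)[OF A]])
  have "cdens n A \<in> borel_measurable (Rn n)"
    unfolding gaussian_density_quad_form[OF A(2), abs_def] by measurable
  from measurable_compose[OF measurable_vadd_any this] show ?thesis
    using gaussian_density_shift[OF \<mu>] by (simp cong: measurable_cong)
qed

lemma gaussian_density_pos: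
  assumes A: "pos_def_mat A" "A \<in> carrier_mat n n" and \<mu>: "\<mu> \<in> carrier_vec n"
  shows "0 < gaussian_density n \<mu> A x"
  unfolding gaussian_density_shift[OF \<mu>] gaussian_density_quad_form[OF A(2)]
  using pos_def_inverse(5)[OF A] by simp

lemma gaussian_density_total:
  assumes A: "pos_def_mat A" "A \<in> carrier_mat n n" and \<mu>: "\<mu> \<in> carrier_vec n"
  shows "(\<integral>\<^sup>+x. ennreal (gaussian_density n \<mu> A x) \<partial>Ln n) = 1"
proof -
  let ?c = "sqrt ((2 * pi) ^ n * Determinant.det A)"
  have d: "0 < Determinant.det A" by (rule pos_def_inverse(5)[OF A])
  then have c: "0 < ?c" by simp
  have m: "cdens n A \<in> borel_measurable (Rn n)"
    by (rule gaussian_density_measurable[OF A]) simp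
  have mq: "quad_form n (cov_inv A) \<in> borel_measurable (Rn n)"
    by (rule quad_form_measurable[OF pos_def_inverse(1)[OF A]])
  have "(\<integral>\<^sup>+x. ennreal (gaussian_density n \<mu> A x) \<partial>Ln n)
      = (\<integral>\<^sup>+x. ennreal (cdens n A (vadd n x (\<lambda>i. - \<mu> $ i))) \<partial>Ln n)"
    by (simp add: gaussian_density_shift[OF \<mu>])
  also have "\<dots> = (\<integral>\<^sup>+x. ennreal (cdens n A x) \<partial>Ln n)"
    by (rule nn_integral_Ln_translate) (use m in measurable)
  also have "\<dots> = (\<integral>\<^sup>+x. ennreal (exp (- quad_form n (cov_inv A) x / 2)) * ennreal (1 / ?c) \<partial>Ln n)"
    unfolding gaussian_density_quad_form[OF A(2)]
    using c by (intro nn_integral_cong) (simp add: ennreal_mult[symmetric])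
  also have "\<dots> = ennreal (sqrt ((2 * pi) ^ n / (1 / Determinant.det A))) * ennreal (1 / ?c)"
    using mq gaussian_integral[OF pos_def_inverse(4,1)[OF A]] pos_def_inverse(6)[OF A]
    by (subst nn_integral_multc) (auto simp: borel_PiM_lborel)
  also have "\<dots> = 1" using c d by (simp add: ennreal_mult[symmetric] del: real_sqrt_mult)
  finally show ?thesis .
qed

lemma law_gaussian:
  assumes A: "pos_def_mat A" "A \<in> carrier_mat n n" and \<mu>: "\<mu> \<in> carrier_vec n"
  shows "law n (gaussian_measure n \<mu> A)"
  unfolding law_def
proof
  show "prob_space (gaussian_measure n \<mu> A)"
    unfolding gaussian_measure_def
    using gaussian_density_measurable[OF assms] gaussian_density_total[OF assms]
    by (intro prob_spaceI) (simp add: emeasure_density borel_PiM_lborel cong: nn_integral_cong)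
qed (simp add: gaussian_measure_def sets_PiM_lborel)

lemma law_cgauss: "pos_def_mat A \<Longrightarrow> A \<in> carrier_mat n n \<Longrightarrow> law n (cgauss n A)"
  by (rule law_gaussian) auto

lemma nn_integral_gaussian:
  assumes A: "pos_def_mat A" "A \<in> carrier_mat n n" and \<mu>: "\<mu> \<in> carrier_vec n"
    and f: "f \<in> borel_measurable (Rn n)"
  shows "(\<integral>\<^sup>+x. f x \<partial>gaussian_measure n \<mu> A) = (\<integral>\<^sup>+x. ennreal (gaussian_density n \<mu> A x) * f x \<partial>Ln n)"
  unfolding gaussian_measure_def
  using gaussian_density_measurable[OF A \<mu>] f
  by (intro nn_integral_density) (simp_all add: borel_PiM_lborel)

lemma integral_gaussian:
  fixes f :: "(nat \<Rightarrow> real) \<Rightarrow> real"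
  assumes A: "pos_def_mat A" "A \<in> carrier_mat n n" and \<mu>: "\<mu> \<in> carrier_vec n"
    and f: "f \<in> borel_measurable (Rn n)"
  shows "(\<integral>x. f x \<partial>gaussian_measure n \<mu> A) = avg n (cgauss n A) f (\<lambda>i\<in>{..<n}. \<mu> $ i)"
proof -
  let ?m = "\<lambda>i\<in>{..<n}. \<mu> $ i"
  let ?G = "cgauss n A"
  have z: "0\<^sub>v n \<in> carrier_vec n" by simp
  have ms: "vadd n ?m \<in> Rn n \<rightarrow>\<^sub>M Rn n"
    using measurable_vadd_const[of ?m n] by (simp add: space_PiM)
  then have mG: "vadd n ?m \<in> ?G \<rightarrow>\<^sub>M Rn n"
    using measurable_cong_sets[OF sets_law[OF law_gaussian[OF A z]] refl] by blast
  have "gaussian_measure n \<mu> A = distr ?G (Rn n) (vadd n ?m)"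
  proof (rule law_eqI[OF law_gaussian[OF A \<mu>]])
    show "law n (distr ?G (Rn n) (vadd n ?m))"
      using law_cgauss[OF A] prob_space.prob_space_distr[OF _ mG] by (simp add: law_def)
    fix f :: "_ \<Rightarrow> ennreal" assume f: "f \<in> borel_measurable (Rn n)"
    have "(\<integral>\<^sup>+x. f x \<partial>gaussian_measure n \<mu> A) = (\<integral>\<^sup>+x. ennreal (gaussian_density n \<mu> A x) * f x \<partial>Ln n)"
      by (rule nn_integral_gaussian[OF A \<mu> f])
    also have "\<dots> = (\<integral>\<^sup>+x. ennreal (gaussian_density n \<mu> A (vadd n x ?m)) * f (vadd n x ?m) \<partial>Ln n)"
      using gaussian_density_measurable[OF A \<mu>] f
      by (intro nn_integral_Ln_translate[symmetric]) measurable
    also have "\<dots> = (\<integral>\<^sup>+x. ennreal (cdens n A x) * f (vadd n ?m x) \<partial>Ln n)"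
    proof (rule nn_integral_cong)
      fix x
      have "Matrix.vec n (vadd n x ?m) - \<mu> = Matrix.vec n x - 0\<^sub>v n" using \<mu> by (auto simp: vadd_def)
      then have "gaussian_density n \<mu> A (vadd n x ?m) = cdens n A x"
        by (simp add: gaussian_density_def)
      then show "ennreal (gaussian_density n \<mu> A (vadd n x ?m)) * f (vadd n x ?m)
          = ennreal (cdens n A x) * f (vadd n ?m x)"
        by (simp add: vadd_commute[of n x ?m])
    qed
    also have "\<dots> = (\<integral>\<^sup>+x. f (vadd n ?m x) \<partial>?G)"
      by (rule nn_integral_gaussian[OF A z measurable_compose[OF ms f], symmetric])
    also have "\<dots> = (\<integral>\<^sup>+x. f x \<partial>distr ?G (Rn n) (vadd n ?m))"
      by (rule nn_integral_distr[OF mG, symmetric]) (use f in simp)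
    finally show "integral\<^sup>N (gaussian_measure n \<mu> A) f = integral\<^sup>N (distr ?G (Rn n) (vadd n ?m)) f" .
  qed
  then show ?thesis using integral_distr[OF mG, of f] f by (simp add: avg_def)
qed

lemma pos_def_mat_add:
  assumes "pos_def_mat A" "A \<in> carrier_mat n n" "pos_def_mat B" "B \<in> carrier_mat n n"
  shows "pos_def_mat (A + B)"
proof (rule pos_def_matI)
  note P = pos_def_matD[OF assms(1,2)] and Q = pos_def_matD[OF assms(3,4)]
  show "sym_mat n (A + B)"
    using P(1) Q(1) by (auto simp: sym_mat_def transpose_add[of _ n n])
  fix v :: "real vec" assume v: "v \<in> carrier_vec n" "v \<noteq> 0\<^sub>v n"
  then show "0 < bform (A + B) v v"
    using P(2)[OF v] Q(2)[OF v] bform_mat_add[OF assms(2,4) v(1) v(1)] by simp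
qed

text \<open>
  Here \<open>Q\<close> is the inverse of \<open>A\<close>, so that the linear term in \<open>u\<close> does not involve \<open>Q\<close>. This makes the
  linear terms of two such forms with opposite \<open>u\<close> cancel.
\<close>

lemma complete_square:
  assumes A: "pos_def_mat A" "A \<in> carrier_mat n n" and Q: "Q \<in> carrier_mat n n" "A * Q = 1\<^sub>m n" "Q * A = 1\<^sub>m n"
    "sym_mat n Q"
    and w: "w \<in> carrier_vec n" and u: "u \<in> carrier_vec n"
  shows "bform Q (A *\<^sub>v w + u) (A *\<^sub>v w + u) = bform A w w + 2 * scalar_prod w u + bform Q u u"
proof -
  have Aw: "A *\<^sub>v w \<in> carrier_vec n" using A w by simp
  have QAw: "Q *\<^sub>v (A *\<^sub>v w) = w" using assoc_mult_mat_vec[OF Q(1) A(2) w] w by (simp add: Q(3))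
  have "bform Q (A *\<^sub>v w) (A *\<^sub>v w) = bform A w w"
    unfolding bform_def QAw using Aw w by (intro comm_scalar_prod)
  moreover have "bform Q u (A *\<^sub>v w) = scalar_prod w u"
    unfolding bform_def QAw using u w by (intro comm_scalar_prod)
  moreover have "bform Q (A *\<^sub>v w) u = bform Q u (A *\<^sub>v w)" by (rule bform_sym[OF Q(4) Aw u])
  ultimately show ?thesis
    using Aw u Q(1) by (simp add: bform_add_left[of _ n] bform_add_right[of _ n])
qed

section \<open>Convolution of Gaussian measures\<close>

lemma measurable_minus_pair:
  "(\<lambda>p. vadd n (snd p) (\<lambda>i. - fst p i)) \<in> Rn n \<Otimes>\<^sub>M Rn n \<rightarrow>\<^sub>M Rn n"
  unfolding vadd_def by (rule measurable_restrict) measurable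

text \<open>
  If \<open>Z\<close> and \<open>Z'\<close> are independent with covariances \<open>A\<close> and \<open>B\<close>, the conditional mean of \<open>Z\<close> given \<open>Z + Z' = y\<close> is
  \<open>s y = A (A + B)\<^sup>-\<^sup>1 y\<close>. In terms of the deviation \<open>u\<close> of \<open>Z\<close> from it, the joint density splits into a factor
  depending on \<open>y\<close> and one depending on \<open>u\<close>.
\<close>

lemma gaussian_density_product:
  assumes A: "pos_def_mat A" "A \<in> carrier_mat n n" and B: "pos_def_mat B" "B \<in> carrier_mat n n"
  defines "k \<equiv> \<lambda>u. cdens n A u * cdens n B u
      * sqrt ((2 * pi) ^ n * Determinant.det (A + B))"
    and "s \<equiv> \<lambda>y i. (A *\<^sub>v (cov_inv (A + B) *\<^sub>v Matrix.vec n y)) $ i"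
  shows "cdens n A (vadd n u (s y))
      * cdens n B (vadd n y (\<lambda>i. - vadd n u (s y) i))
    = cdens n (A + B) y * k u"
proof -
  note AB = pos_def_mat_add[OF A B]
  have ABc: "A + B \<in> carrier_mat n n" using A B by simp
  note QA = pos_def_inverse[OF A] and QB = pos_def_inverse[OF B] and QS = pos_def_inverse[OF AB ABc]
  note SA = pos_def_matD(1)[OF QA(4,1)] and SB = pos_def_matD(1)[OF QB(4,1)]
  let ?y = "Matrix.vec n y" and ?u = "Matrix.vec n u"
  define w where "w = cov_inv (A + B) *\<^sub>v ?y"
  have w: "w \<in> carrier_vec n" using QS(1) by (simp add: w_def)
  have y: "?y = A *\<^sub>v w + B *\<^sub>v w"
    using assoc_mult_mat_vec[OF ABc QS(1), of ?y] A B w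
    by (simp add: QS(2) w_def add_mult_distrib_mat_vec[of A n n B])
  have v1: "Matrix.vec n (vadd n u (s y)) = A *\<^sub>v w + ?u"
    using A by (intro eq_vecI) (auto simp: vadd_def s_def w_def)
  have v2: "Matrix.vec n (vadd n y (\<lambda>i. - vadd n u (s y) i)) = B *\<^sub>v w + (- ?u)"
  proof (rule eq_vecI)
    fix i assume "i < dim_vec (B *\<^sub>v w + (- ?u))"
    then have i: "i < n" by simp
    have "y i = (A *\<^sub>v w) $ i + (B *\<^sub>v w) $ i"
      using arg_cong[OF y, of "\<lambda>v. v $ i"] A B i by simp
    then show "Matrix.vec n (vadd n y (\<lambda>i. - vadd n u (s y) i)) $ i = (B *\<^sub>v w + (- ?u)) $ i"
      using i A B by (simp add: vadd_def s_def w_def)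
  qed (use B in simp)
  have e1: "quad_form n (cov_inv A) (vadd n u (s y)) = bform A w w + 2 * scalar_prod w ?u + quad_form n (cov_inv A) u"
    unfolding quad_form_def v1 by (rule complete_square[OF A QA(1,2,3) SA w]) simp
  have e2: "quad_form n (cov_inv B) (vadd n y (\<lambda>i. - vadd n u (s y) i))
      = bform B w w - 2 * scalar_prod w ?u + quad_form n (cov_inv B) u"
  proof -
    have "bform (cov_inv B) (- ?u) (- ?u) = bform (cov_inv B) ?u ?u"
      using bform_smult_left[OF QB(1), of ?u "- ?u" "-1"] bform_smult_right[OF QB(1), of ?u ?u "-1"]
      by (simp add: vec_eq_iff uminus_vec_def smult_vec_def flip: vec_eq_iff)
    moreover have "scalar_prod w (- ?u) = - scalar_prod w ?u"
      using w by (intro scalar_prod_uminus_right) simp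
    ultimately show ?thesis
      unfolding quad_form_def v2 by (subst complete_square[OF B QB(1,2,3) SB w]) simp_all
  qed
  have e3: "quad_form n (cov_inv (A + B)) y = bform A w w + bform B w w"
  proof -
    have "quad_form n (cov_inv (A + B)) y = scalar_prod ?y w" by (simp add: quad_form_def bform_def w_def)
    also have "\<dots> = scalar_prod w ?y" using w by (intro comm_scalar_prod[of _ n]) auto
    also have "\<dots> = bform A w w + bform B w w"
      unfolding y bform_def using A B w by (intro scalar_prod_add_distrib) auto
    finally show ?thesis .
  qed
  have pos: "0 < (2 * pi) ^ n * Determinant.det (A + B)" using QS(5) by simp
  have "exp (- quad_form n (cov_inv A) (vadd n u (s y)) / 2)
      * exp (- quad_form n (cov_inv B) (vadd n y (\<lambda>i. - vadd n u (s y) i)) / 2)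
    = exp (- quad_form n (cov_inv (A + B)) y / 2)
      * (exp (- quad_form n (cov_inv A) u / 2) * exp (- quad_form n (cov_inv B) u / 2))"
    unfolding exp_add[symmetric] e1 e2 e3 by (simp add: field_simps)
  moreover have "a / x * (b / z) = c / r * (p / x * (q / z) * r)"
    if "a * b = c * (p * q)" "0 < r" for a b c p q x z r :: real
    using that by simp
  ultimately show ?thesis
    unfolding k_def gaussian_density_quad_form[OF A(2)] gaussian_density_quad_form[OF B(2)] gaussian_density_quad_form[OF ABc]
    using pos by (metis real_sqrt_gt_zero)
qed

text \<open>
  By the splitting of the joint density, the density of the convolution is a constant multiple \<open>K\<close> of the
  Gaussian density of covariance \<open>A + B\<close>. Both sides are probability measures, so \<open>K = 1\<close>.
\<close>

theorem conv_gaussian: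
  assumes A: "pos_def_mat A" "A \<in> carrier_mat n n" and B: "pos_def_mat B" "B \<in> carrier_mat n n"
  shows "conv n (cgauss n A) (cgauss n B)
    = cgauss n (A + B)" (is "conv n ?GA ?GB = ?GS")
proof -
  note AB = pos_def_mat_add[OF A B]
  have ABc: "A + B \<in> carrier_mat n n" using A B by simp
  have z: "0\<^sub>v n \<in> carrier_vec n" by simp
  note lA = law_gaussian[OF A z] and lB = law_gaussian[OF B z] and lS = law_gaussian[OF AB ABc z]
  interpret GA: prob_space ?GA using lA by (simp add: law_def)
  interpret GB: prob_space ?GB using lB by (simp add: law_def)
  interpret L: pair_sigma_finite "Ln n" "Ln n"
    using sigma_finite_Ln by (simp add: pair_sigma_finite_def)
  let ?a = "\<lambda>x. ennreal (cdens n A x)"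
  let ?b = "\<lambda>x. ennreal (cdens n B x)"
  let ?s = "\<lambda>x. ennreal (cdens n (A + B) x)"
  have [measurable]: "?a \<in> borel_measurable (Rn n)" "?b \<in> borel_measurable (Rn n)" "?s \<in> borel_measurable (Rn n)"
    using gaussian_density_measurable[OF A z] gaussian_density_measurable[OF B z]
      gaussian_density_measurable[OF AB ABc z] by measurable
  have am: "?a \<in> borel_measurable (Rn n)" and bm: "?b \<in> borel_measurable (Rn n)"
    and sm: "?s \<in> borel_measurable (Rn n)" by measurable
  define k where "k = (\<lambda>u. cdens n A u * cdens n B u
      * sqrt ((2 * pi) ^ n * Determinant.det (A + B)))"
  have km: "k \<in> borel_measurable (Rn n)"
    unfolding k_def using gaussian_density_measurable[OF A z] gaussian_density_measurable[OF B z]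
    by measurable
  define K where "K = (\<integral>\<^sup>+u. ennreal (k u) \<partial>Ln n)"
  have mshift: "(\<lambda>x. vadd n y (\<lambda>i. - x i)) \<in> Rn n \<rightarrow>\<^sub>M Rn n" for y
    unfolding vadd_def by (rule measurable_restrict) measurable
  have inner: "(\<integral>\<^sup>+x. ?a x * ?b (vadd n y (\<lambda>i. - x i)) \<partial>Ln n) = ?s y * K" for y
  proof -
    let ?t = "\<lambda>i. (A *\<^sub>v (cov_inv (A + B) *\<^sub>v Matrix.vec n y)) $ i"
    have "(\<integral>\<^sup>+x. ?a x * ?b (vadd n y (\<lambda>i. - x i)) \<partial>Ln n)
        = (\<integral>\<^sup>+u. ?a (vadd n u ?t) * ?b (vadd n y (\<lambda>i. - vadd n u ?t i)) \<partial>Ln n)"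
      by (intro nn_integral_Ln_translate[symmetric] borel_measurable_times_ennreal am
          measurable_compose[OF mshift bm])
    also have "\<dots> = (\<integral>\<^sup>+u. ?s y * ennreal (k u) \<partial>Ln n)"
    proof (rule nn_integral_cong)
      fix u
      show "?a (vadd n u ?t) * ?b (vadd n y (\<lambda>i. - vadd n u ?t i)) = ?s y * ennreal (k u)"
        using gaussian_density_product[OF A B, of u y] gaussian_density_pos[OF A z] gaussian_density_pos[OF B z]
          gaussian_density_pos[OF AB ABc z]
        by (simp add: k_def less_imp_le flip: ennreal_mult')
    qed
    also have "\<dots> = ?s y * K"
      unfolding K_def using km by (intro nn_integral_cmult) (simp add: borel_PiM_lborel)
    finally show ?thesis .
  qed
  have main: "(\<integral>\<^sup>+x. f x \<partial>conv n ?GA ?GB) = K * (\<integral>\<^sup>+x. f x \<partial>?GS)"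
    if f: "f \<in> borel_measurable (Rn n)" for f :: "_ \<Rightarrow> ennreal"
  proof -
    note mp = measurable_vadd_laws[OF sets_law[OF lA] sets_law[OF lB]]
    have "(\<integral>\<^sup>+x. f x \<partial>conv n ?GA ?GB) = (\<integral>\<^sup>+p. f (vadd n (fst p) (snd p)) \<partial>(?GA \<Otimes>\<^sub>M ?GB))"
      unfolding conv_def by (rule nn_integral_distr[OF mp]) (use f in simp)
    also have "\<dots> = (\<integral>\<^sup>+x. (\<integral>\<^sup>+v. f (vadd n x v) \<partial>?GB) \<partial>?GA)"
      using GB.nn_integral_fst[OF measurable_compose[OF mp f]] by simp
    also have "\<dots> = (\<integral>\<^sup>+x. (\<integral>\<^sup>+y. ?b (vadd n y (\<lambda>i. - x i)) * f y \<partial>Ln n) \<partial>?GA)"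
    proof (rule nn_integral_cong)
      fix x assume "x \<in> space ?GA"
      then have x: "x \<in> space (Rn n)" using space_law[OF lA] by simp
      have mx: "(\<lambda>v. f (vadd n x v)) \<in> borel_measurable (Rn n)"
        using measurable_compose[OF measurable_vadd_const[OF x] f] by simp
      have "(\<integral>\<^sup>+v. f (vadd n x v) \<partial>?GB) = (\<integral>\<^sup>+v. ?b v * f (vadd n x v) \<partial>Ln n)"
        by (rule nn_integral_gaussian[OF B z mx])
      also have "\<dots> = (\<integral>\<^sup>+y. ?b (vadd n y (\<lambda>i. - x i)) * f (vadd n x (vadd n y (\<lambda>i. - x i))) \<partial>Ln n)"
        by (intro nn_integral_Ln_translate[symmetric] borel_measurable_times_ennreal bm mx)
      also have "\<dots> = (\<integral>\<^sup>+y. ?b (vadd n y (\<lambda>i. - x i)) * f y \<partial>Ln n)"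
      proof (rule nn_integral_cong)
        fix y assume "y \<in> space (Ln n)"
        then have "vadd n x (vadd n y (\<lambda>i. - x i)) = y"
          by (auto simp: vadd_def space_PiM PiE_def extensional_def fun_eq_iff)
        then show "?b (vadd n y (\<lambda>i. - x i)) * f (vadd n x (vadd n y (\<lambda>i. - x i)))
            = ?b (vadd n y (\<lambda>i. - x i)) * f y" by simp
      qed
      finally show "(\<integral>\<^sup>+v. f (vadd n x v) \<partial>?GB) = (\<integral>\<^sup>+y. ?b (vadd n y (\<lambda>i. - x i)) * f y \<partial>Ln n)" .
    qed
    also have "\<dots> = (\<integral>\<^sup>+x. ?a x * (\<integral>\<^sup>+y. ?b (vadd n y (\<lambda>i. - x i)) * f y \<partial>Ln n) \<partial>Ln n)"
    proof (rule nn_integral_gaussian[OF A z])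
      have "(\<lambda>p. ?b (vadd n (snd p) (\<lambda>i. - fst p i)) * f (snd p)) \<in> borel_measurable (Rn n \<Otimes>\<^sub>M Rn n)"
        by (intro borel_measurable_times_ennreal measurable_compose[OF measurable_minus_pair bm]
            measurable_compose[OF measurable_snd f])
      then have "(\<lambda>(x, y). ?b (vadd n y (\<lambda>i. - x i)) * f y) \<in> borel_measurable (Rn n \<Otimes>\<^sub>M Ln n)"
        unfolding split_beta'
        using measurable_cong_sets[OF sets_pair_measure_cong[OF refl sets_PiM_lborel] refl] by blast
      then show "(\<lambda>x. \<integral>\<^sup>+y. ?b (vadd n y (\<lambda>i. - x i)) * f y \<partial>Ln n) \<in> borel_measurable (Rn n)"
        by (rule sigma_finite_measure.borel_measurable_nn_integral[OF sigma_finite_Ln])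
    qed
    also have "\<dots> = (\<integral>\<^sup>+x. (\<integral>\<^sup>+y. ?a x * ?b (vadd n y (\<lambda>i. - x i)) * f y \<partial>Ln n) \<partial>Ln n)"
    proof (rule nn_integral_cong)
      fix x
      have "(\<lambda>y. ?b (vadd n y (\<lambda>i. - x i)) * f y) \<in> borel_measurable (Ln n)"
        unfolding borel_PiM_lborel
        by (intro borel_measurable_times_ennreal measurable_compose[OF measurable_vadd_any bm] f)
      then show "?a x * (\<integral>\<^sup>+y. ?b (vadd n y (\<lambda>i. - x i)) * f y \<partial>Ln n)
          = (\<integral>\<^sup>+y. ?a x * ?b (vadd n y (\<lambda>i. - x i)) * f y \<partial>Ln n)"
        unfolding mult.assoc by (rule nn_integral_cmult[symmetric])
    qed
    also have "\<dots> = (\<integral>\<^sup>+y. (\<integral>\<^sup>+x. ?a x * ?b (vadd n y (\<lambda>i. - x i)) * f y \<partial>Ln n) \<partial>Ln n)"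
    proof (rule L.Fubini'[symmetric])
      have "(\<lambda>p. ?a (fst p) * ?b (vadd n (snd p) (\<lambda>i. - fst p i)) * f (snd p)) \<in> borel_measurable (Rn n \<Otimes>\<^sub>M Rn n)"
        by (intro borel_measurable_times_ennreal measurable_compose[OF measurable_minus_pair bm]
            measurable_compose[OF measurable_snd f] measurable_compose[OF measurable_fst am])
      then show "(\<lambda>(x, y). ?a x * ?b (vadd n y (\<lambda>i. - x i)) * f y) \<in> borel_measurable (Ln n \<Otimes>\<^sub>M Ln n)"
        unfolding split_beta'
        using measurable_cong_sets[OF sets_pair_measure_cong[OF sets_PiM_lborel sets_PiM_lborel] refl]
        by blast
    qed
    also have "\<dots> = (\<integral>\<^sup>+y. ?s y * K * f y \<partial>Ln n)"
    proof (rule nn_integral_cong)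
      fix y
      have "(\<integral>\<^sup>+x. ?a x * ?b (vadd n y (\<lambda>i. - x i)) * f y \<partial>Ln n)
        = (\<integral>\<^sup>+x. ?a x * ?b (vadd n y (\<lambda>i. - x i)) \<partial>Ln n) * f y"
        by (intro nn_integral_multc)
          (unfold borel_PiM_lborel, intro borel_measurable_times_ennreal am
            measurable_compose[OF mshift bm])
      then show "(\<integral>\<^sup>+x. ?a x * ?b (vadd n y (\<lambda>i. - x i)) * f y \<partial>Ln n) = ?s y * K * f y"
        by (simp add: inner)
    qed
    also have "\<dots> = K * (\<integral>\<^sup>+y. ?s y * f y \<partial>Ln n)"
    proof -
      have "(\<lambda>y. ?s y * f y) \<in> borel_measurable (Ln n)"
        unfolding borel_PiM_lborel by (intro borel_measurable_times_ennreal sm f)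
      from nn_integral_cmult[OF this, of K] show ?thesis by (simp add: ac_simps)
    qed
    also have "(\<integral>\<^sup>+y. ?s y * f y \<partial>Ln n) = (\<integral>\<^sup>+x. f x \<partial>?GS)"
      by (rule nn_integral_gaussian[OF AB ABc z f, symmetric])
    finally show ?thesis .
  qed
  have lC: "law n (conv n ?GA ?GB)" by (rule law_conv[OF lA lB])
  have "(\<integral>\<^sup>+x. 1 \<partial>\<nu>) = 1" if "law n \<nu>" for \<nu>
    using that prob_space.emeasure_space_1 by (auto simp: law_def)
  then have "K = 1" using main[of "\<lambda>_. 1"] lC lS by simp
  then show ?thesis using main by (intro law_eqI[OF lC lS]) simp
qed

section \<open>Isotropic Gaussians as products\<close>

definition axis_normal :: "nat \<Rightarrow> real \<Rightarrow> nat \<Rightarrow> (nat \<Rightarrow> real) measure" where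
  "axis_normal n \<sigma> i = distr (density lborel (\<lambda>t. ennreal (normal_density 0 \<sigma> t))) (Rn n)
     (\<lambda>t. \<lambda>j\<in>{..<n}. if j = i then t else 0)"

lemma measurable_axis: "(\<lambda>t. \<lambda>j\<in>{..<n}. if j = i then t else 0) \<in> borel \<rightarrow>\<^sub>M Rn n"
  by (rule measurable_restrict) auto

lemma law_axis_normal:
  assumes "0 < \<sigma>"
  shows "law n (axis_normal n \<sigma> i)"
proof -
  interpret N: prob_space "density lborel (\<lambda>t. ennreal (normal_density 0 \<sigma> t))"
    by (rule prob_space_normal_density[OF assms])
  show ?thesis
    unfolding law_def axis_normal_def using measurable_axis by (auto intro!: N.prob_space_distr)
qed

lemma nn_integral_axis_normal:
  assumes f: "f \<in> borel_measurable (Rn n)"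
  shows "(\<integral>\<^sup>+x. f x \<partial>axis_normal n \<sigma> i)
    = (\<integral>\<^sup>+t. ennreal (normal_density 0 \<sigma> t) * f (\<lambda>j\<in>{..<n}. if j = i then t else 0) \<partial>lborel)"
proof -
  note m = measurable_compose[OF measurable_axis f]
  have "(\<integral>\<^sup>+x. f x \<partial>axis_normal n \<sigma> i) = (\<integral>\<^sup>+t. f (\<lambda>j\<in>{..<n}. if j = i then t else 0)
      \<partial>density lborel (\<lambda>t. ennreal (normal_density 0 \<sigma> t)))"
    unfolding axis_normal_def using measurable_axis f by (intro nn_integral_distr) auto
  also have "\<dots> = (\<integral>\<^sup>+t. ennreal (normal_density 0 \<sigma> t) * f (\<lambda>j\<in>{..<n}. if j = i then t else 0) \<partial>lborel)"
    using m by (intro nn_integral_density) auto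
  finally show ?thesis .
qed

lemma measurable_pad_from:
  "(\<lambda>z. \<lambda>j\<in>{..<n}. if k \<le> j then z j else 0) \<in> Pi\<^sub>M {k..<n} (\<lambda>_. borel) \<rightarrow>\<^sub>M Rn n"
proof (rule measurable_restrict)
  fix j assume "j \<in> {..<n}"
  then show "(\<lambda>z. if k \<le> j then z j else 0) \<in> borel_measurable (Pi\<^sub>M {k..<n} (\<lambda>_. borel))"
    by (cases "k \<le> j") auto
qed

text \<open>
  Convolving normal laws on the axes \<open>k, \<dots>, n - 1\<close> builds up the product density of these coordinates. The
  induction goes downwards in \<open>k\<close>, because the first list element is the axis \<open>k\<close>.
\<close>

lemma nn_integral_axis_normals:
  assumes \<sigma>: "0 < \<sigma>" and "k \<le> n" "f \<in> borel_measurable (Rn n)"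
  shows "(\<integral>\<^sup>+x. f x \<partial>convs n (map (axis_normal n \<sigma>) [k..<n]))
    = (\<integral>\<^sup>+z. (\<Prod>j\<in>{k..<n}. ennreal (normal_density 0 \<sigma> (z j))) * f (\<lambda>j\<in>{..<n}. if k \<le> j then z j else 0)
        \<partial>Pi\<^sub>M {k..<n} (\<lambda>_. lborel))"
  using assms(2,3)
proof (induction k arbitrary: f rule: inc_induct)
  case base
  have "(\<lambda>j\<in>{..<n}. 0) \<in> space (Rn n)" by (simp add: space_PiM)
  moreover have "(\<lambda>j\<in>{..<n}. if n \<le> j then undefined else 0) = (\<lambda>j\<in>{..<n}. 0 :: real)"
    by (auto simp: fun_eq_iff)
  ultimately show ?case
    using base
    by (simp add: nn_integral_return PiM_empty nn_integral_count_space_finite del: restrict_apply)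
next
  case (step k)
  let ?N = "\<lambda>t. ennreal (normal_density 0 \<sigma> t)"
  let ?e = "\<lambda>t. \<lambda>j\<in>{..<n}. if j = k then t else 0"
  let ?C = "convs n (map (axis_normal n \<sigma>) [Suc k..<n])"
  have lC: "law n ?C" by (rule law_convs) (auto intro: law_axis_normal \<sigma>)
  interpret C: prob_space ?C using lC by (simp add: law_def)
  let ?P = "\<lambda>z. \<Prod>j\<in>{Suc k..<n}. ?N (z j)"
  let ?E = "\<lambda>z. \<lambda>j\<in>{..<n}. if Suc k \<le> j then z j else 0"
  note mp = measurable_vadd_laws[OF sets_law[OF law_axis_normal[OF \<sigma>, of n k]] sets_law[OF lC]]
  note f = step.prems
  have ins: "{k..<n} = insert k {Suc k..<n}" using step.hyps by auto
  have "(\<integral>\<^sup>+x. f x \<partial>convs n (map (axis_normal n \<sigma>) [k..<n]))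
      = (\<integral>\<^sup>+x. f x \<partial>conv n (axis_normal n \<sigma> k) ?C)"
    using step.hyps by (simp add: upt_conv_Cons)
  also have "\<dots> = (\<integral>\<^sup>+p. f (vadd n (fst p) (snd p)) \<partial>(axis_normal n \<sigma> k \<Otimes>\<^sub>M ?C))"
    unfolding conv_def by (rule nn_integral_distr[OF mp]) (use f in simp)
  also have "\<dots> = (\<integral>\<^sup>+x. (\<integral>\<^sup>+v. f (vadd n x v) \<partial>?C) \<partial>axis_normal n \<sigma> k)"
    using C.nn_integral_fst[OF measurable_compose[OF mp f]] by simp
  also have "\<dots> = (\<integral>\<^sup>+t. ?N t * (\<integral>\<^sup>+v. f (vadd n (?e t) v) \<partial>?C) \<partial>lborel)"
  proof (rule nn_integral_axis_normal)
    have "(\<lambda>(x, v). f (vadd n x v)) \<in> borel_measurable (Rn n \<Otimes>\<^sub>M ?C)"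
      using measurable_compose[OF measurable_vadd_laws[OF refl sets_law[OF lC]] f]
      by (simp add: split_beta')
    then show "(\<lambda>x. \<integral>\<^sup>+v. f (vadd n x v) \<partial>?C) \<in> borel_measurable (Rn n)"
      by (rule C.borel_measurable_nn_integral)
  qed
  also have "\<dots> = (\<integral>\<^sup>+t. ?N t * (\<integral>\<^sup>+z. ?P z * f (vadd n (?e t) (?E z)) \<partial>Pi\<^sub>M {Suc k..<n} (\<lambda>_. lborel)) \<partial>lborel)"
  proof (rule nn_integral_cong)
    fix t :: real
    have et: "?e t \<in> space (Rn n)" by (simp add: space_PiM)
    show "?N t * (\<integral>\<^sup>+v. f (vadd n (?e t) v) \<partial>?C)
      = ?N t * (\<integral>\<^sup>+z. ?P z * f (vadd n (?e t) (?E z)) \<partial>Pi\<^sub>M {Suc k..<n} (\<lambda>_. lborel))"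
      by (intro arg_cong[where f = "(*) (?N t)"] step.IH
          measurable_compose[OF measurable_vadd_const[OF et] f])
  qed
  also have "\<dots> = (\<integral>\<^sup>+t. (\<integral>\<^sup>+z. (\<Prod>j\<in>{k..<n}. ?N ((z(k := t)) j))
        * f (\<lambda>j\<in>{..<n}. if k \<le> j then (z(k := t)) j else 0) \<partial>Pi\<^sub>M {Suc k..<n} (\<lambda>_. lborel)) \<partial>lborel)"
  proof (rule nn_integral_cong)
    fix t :: real
    have et: "?e t \<in> space (Rn n)" by (simp add: space_PiM)
    have "?N t * (\<integral>\<^sup>+z. ?P z * f (vadd n (?e t) (?E z)) \<partial>Pi\<^sub>M {Suc k..<n} (\<lambda>_. lborel))
      = (\<integral>\<^sup>+z. ?N t * (?P z * f (vadd n (?e t) (?E z))) \<partial>Pi\<^sub>M {Suc k..<n} (\<lambda>_. lborel))"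
    proof (rule nn_integral_cmult[symmetric])
      have "?P \<in> borel_measurable (Pi\<^sub>M {Suc k..<n} (\<lambda>_. borel))" by measurable
      then show "(\<lambda>z. ?P z * f (vadd n (?e t) (?E z))) \<in> borel_measurable (Pi\<^sub>M {Suc k..<n} (\<lambda>_. lborel))"
        unfolding borel_PiM_lborel
        by (intro borel_measurable_times_ennreal measurable_compose[OF measurable_pad_from]
            measurable_compose[OF measurable_vadd_const[OF et] f])
    qed
    also have "\<dots> = (\<integral>\<^sup>+z. (\<Prod>j\<in>{k..<n}. ?N ((z(k := t)) j))
        * f (\<lambda>j\<in>{..<n}. if k \<le> j then (z(k := t)) j else 0) \<partial>Pi\<^sub>M {Suc k..<n} (\<lambda>_. lborel))"
    proof (rule nn_integral_cong)
      fix z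
      have "(\<Prod>j\<in>{k..<n}. ?N ((z(k := t)) j)) = ?N t * ?P z"
      proof -
        have "?P (z(k := t)) = ?P z" by (intro prod.cong) auto
        then show ?thesis unfolding ins by (simp del: fun_upd_apply add: fun_upd_same)
      qed
      moreover have "vadd n (?e t) (?E z) = (\<lambda>j\<in>{..<n}. if k \<le> j then (z(k := t)) j else 0)"
        by (auto simp: vadd_def fun_eq_iff restrict_def)
      ultimately show "?N t * (?P z * f (vadd n (?e t) (?E z))) = (\<Prod>j\<in>{k..<n}. ?N ((z(k := t)) j))
        * f (\<lambda>j\<in>{..<n}. if k \<le> j then (z(k := t)) j else 0)" by (simp add: mult.assoc)
    qed
    finally show "?N t * (\<integral>\<^sup>+z. ?P z * f (vadd n (?e t) (?E z)) \<partial>Pi\<^sub>M {Suc k..<n} (\<lambda>_. lborel))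
      = (\<integral>\<^sup>+z. (\<Prod>j\<in>{k..<n}. ?N ((z(k := t)) j))
        * f (\<lambda>j\<in>{..<n}. if k \<le> j then (z(k := t)) j else 0) \<partial>Pi\<^sub>M {Suc k..<n} (\<lambda>_. lborel))" .
  qed
  also have "\<dots> = (\<integral>\<^sup>+z. (\<Prod>j\<in>{k..<n}. ?N (z j)) * f (\<lambda>j\<in>{..<n}. if k \<le> j then z j else 0)
        \<partial>Pi\<^sub>M {k..<n} (\<lambda>_. lborel))"
  proof -
    have "(\<lambda>z. \<Prod>j\<in>{k..<n}. ?N (z j)) \<in> borel_measurable (Pi\<^sub>M {k..<n} (\<lambda>_. borel))" by measurable
    then have "(\<lambda>z. (\<Prod>j\<in>{k..<n}. ?N (z j)) * f (\<lambda>j\<in>{..<n}. if k \<le> j then z j else 0))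
        \<in> borel_measurable (Pi\<^sub>M {k..<n} (\<lambda>_. borel))"
      by (intro borel_measurable_times_ennreal measurable_compose[OF measurable_pad_from f])
    then show ?thesis
      unfolding ins by (intro lborels.product_nn_integral_insert_rev[symmetric])
        (auto simp: borel_PiM_lborel)
  qed
  finally show ?case .
qed

lemma smult_one_form:
  assumes "v \<in> carrier_vec n"
  shows "bform (c \<cdot>\<^sub>m 1\<^sub>m n) v v = c * scalar_prod v v"
  using assms by (simp add: bform_mat_smult[of _ n] bform_one)

lemma pos_def_smult_one:
  assumes "0 < c"
  shows "pos_def_mat (c \<cdot>\<^sub>m 1\<^sub>m n)"
proof (rule pos_def_matI)
  show "sym_mat n (c \<cdot>\<^sub>m 1\<^sub>m n)" by (auto simp: sym_mat_def intro!: eq_matI)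
  fix v :: "real vec" assume "v \<in> carrier_vec n" "v \<noteq> 0\<^sub>v n"
  then show "0 < bform (c \<cdot>\<^sub>m 1\<^sub>m n) v v"
    using assms scalar_prod_self_pos by (simp add: smult_one_form)
qed

lemma gaussian_density_isotropic:
  assumes "0 < \<sigma>"
  shows "cdens n (\<sigma>\<^sup>2 \<cdot>\<^sub>m 1\<^sub>m n) x = (\<Prod>j<n. normal_density 0 \<sigma> (x j))"
proof -
  let ?A = "\<sigma>\<^sup>2 \<cdot>\<^sub>m 1\<^sub>m n"
  have c: "0 < \<sigma>\<^sup>2" using assms by simp
  have A: "pos_def_mat ?A" "?A \<in> carrier_mat n n" using pos_def_smult_one[OF c] by auto
  note Q = pos_def_inverse[OF A]
  have "\<sigma>\<^sup>2 \<cdot>\<^sub>m cov_inv ?A = 1\<^sub>m n"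
    using Q(2) mult_smult_assoc_mat[of "1\<^sub>m n" n n "cov_inv ?A" n "\<sigma>\<^sup>2"] Q(1) by simp
  then have "\<sigma>\<^sup>2 * quad_form n (cov_inv ?A) x = scalar_prod (Matrix.vec n x) (Matrix.vec n x)"
    unfolding quad_form_def using Q(1) bform_one[of "Matrix.vec n x" n "Matrix.vec n x"]
    by (subst bform_mat_smult[symmetric, of _ n]) auto
  then have q: "quad_form n (cov_inv ?A) x = (\<Sum>j<n. (x j)\<^sup>2) / \<sigma>\<^sup>2"
    using c by (simp add: eq_divide_eq mult.commute scalar_prod_def power2_eq_square[of "x _"] atLeast0LessThan)
  have "Determinant.det ?A = (\<sigma>\<^sup>2) ^ n" by simp
  moreover have "(\<Prod>j<n. normal_density 0 \<sigma> (x j))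
      = (\<Prod>j<n. exp (- (x j)\<^sup>2 / (2 * \<sigma>\<^sup>2))) / sqrt (2 * pi * \<sigma>\<^sup>2) ^ n"
    by (simp add: normal_density_def prod_dividef)
  moreover have "(\<Prod>j<n. exp (- (x j)\<^sup>2 / (2 * \<sigma>\<^sup>2))) = exp (- ((\<Sum>j<n. (x j)\<^sup>2) / \<sigma>\<^sup>2) / 2)"
    by (simp add: exp_sum[symmetric] sum_divide_distrib sum_negf flip: divide_divide_eq_left)
      (simp add: field_simps)
  ultimately show ?thesis
    unfolding gaussian_density_quad_form[OF A(2)] q
    by (simp add: real_sqrt_power[symmetric] power_mult_distrib)
qed

theorem convs_axis_normals:
  assumes "0 < \<sigma>"
  shows "convs n (map (axis_normal n \<sigma>) [0..<n]) = cgauss n (\<sigma>\<^sup>2 \<cdot>\<^sub>m 1\<^sub>m n)"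
    (is "?C = ?G")
proof -
  have A: "pos_def_mat (\<sigma>\<^sup>2 \<cdot>\<^sub>m 1\<^sub>m n)" "\<sigma>\<^sup>2 \<cdot>\<^sub>m 1\<^sub>m n \<in> carrier_mat n n"
    using pos_def_smult_one[of "\<sigma>\<^sup>2" n] assms by auto
  have z: "0\<^sub>v n \<in> carrier_vec n" by simp
  note lG = law_gaussian[OF A z]
  have lC: "law n ?C" by (rule law_convs) (auto intro: law_axis_normal assms)
  show ?thesis
  proof (rule law_eqI[OF lC lG])
    fix f :: "_ \<Rightarrow> ennreal" assume f: "f \<in> borel_measurable (Rn n)"
    have "(\<integral>\<^sup>+x. f x \<partial>?C) = (\<integral>\<^sup>+z. (\<Prod>j\<in>{0..<n}. ennreal (normal_density 0 \<sigma> (z j)))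
        * f (\<lambda>j\<in>{..<n}. if 0 \<le> j then z j else 0) \<partial>Pi\<^sub>M {0..<n} (\<lambda>_. lborel))"
      by (rule nn_integral_axis_normals[OF assms _ f]) simp
    also have "\<dots> = (\<integral>\<^sup>+z. ennreal (cdens n (\<sigma>\<^sup>2 \<cdot>\<^sub>m 1\<^sub>m n) z) * f z \<partial>Ln n)"
      unfolding atLeast0LessThan
    proof (rule nn_integral_cong)
      fix z assume "z \<in> space (Ln n)"
      then have "(\<lambda>j\<in>{..<n}. if 0 \<le> j then z j else 0) = z"
        by (auto simp: space_PiM PiE_def extensional_def fun_eq_iff)
      then show "(\<Prod>j<n. ennreal (normal_density 0 \<sigma> (z j))) * f (\<lambda>j\<in>{..<n}. if 0 \<le> j then z j else 0)
        = ennreal (cdens n (\<sigma>\<^sup>2 \<cdot>\<^sub>m 1\<^sub>m n) z) * f z"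
        by (simp add: gaussian_density_isotropic[OF assms] prod_ennreal)
    qed
    also have "\<dots> = (\<integral>\<^sup>+x. f x \<partial>?G)" by (rule nn_integral_gaussian[OF A z f, symmetric])
    finally show "integral\<^sup>N ?C f = integral\<^sup>N ?G f" .
  qed
qed

section \<open>The inequality for functions bounded away from zero and infinity\<close>

lemma avg_cgauss_add:
  assumes "pos_def_mat A" "A \<in> carrier_mat n n" "pos_def_mat B" "B \<in> carrier_mat n n"
    and "bmeas n f" "x \<in> space (Rn n)"
  shows "avg n (cgauss n (A + B)) f x = avg n (cgauss n A) (avg n (cgauss n B) f) x"
  using avg_conv[OF law_cgauss[OF assms(1,2)] law_cgauss[OF assms(3,4)] assms(5,6)]
  by (simp add: conv_gaussian[OF assms(1-4)])

lemma pos_def_mat_smult: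
  assumes "pos_def_mat A" "A \<in> carrier_mat n n" "0 < c"
  shows "pos_def_mat (c \<cdot>\<^sub>m A)"
proof (rule pos_def_matI)
  note P = pos_def_matD[OF assms(1,2)]
  show "sym_mat n (c \<cdot>\<^sub>m A)"
    using assms(2) sym_mat_index[OF P(1)] by (auto simp: sym_mat_def intro!: eq_matI)
  fix v :: "real vec" assume v: "v \<in> carrier_vec n" "v \<noteq> 0\<^sub>v n"
  show "0 < bform (c \<cdot>\<^sub>m A) v v"
    using P(2)[OF v] assms(3) by (simp add: bform_mat_smult[OF assms(2) v(1) v(1)])
qed

lemma avg_cgauss_replicate:
  assumes A: "pos_def_mat A" "A \<in> carrier_mat n n" and k: "0 < k"
    and f: "bmeas n f" and x: "x \<in> space (Rn n)"
  shows "avg n (convs n (replicate k (cgauss n A))) f x = avg n (cgauss n (real k \<cdot>\<^sub>m A)) f x"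
  using k x
proof (induction k arbitrary: x rule: nat_induct_non_zero)
  case 1
  have "1 \<cdot>\<^sub>m A = A" using A(2) by (intro eq_matI) auto
  moreover have "avg n (convs n [cgauss n A]) f x = avg n (cgauss n A) (avg n (convs n []) f) x"
    using law_cgauss[OF A] f 1 by (intro avg_convs_Cons) auto
  moreover have "\<dots> = avg n (cgauss n A) f x"
    using f by (intro avg_cong avg_convs_Nil) (auto simp: bmeas_def)
  ultimately show ?case by simp
next
  case (Suc k)
  have kA: "pos_def_mat (real k \<cdot>\<^sub>m A)" "real k \<cdot>\<^sub>m A \<in> carrier_mat n n"
    using pos_def_mat_smult[OF A, of "real k"] Suc(1) A(2) by auto
  have eq: "real (Suc k) \<cdot>\<^sub>m A = A + real k \<cdot>\<^sub>m A"
    using A(2) by (intro eq_matI) (auto simp: algebra_simps)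
  have "avg n (convs n (replicate (Suc k) (cgauss n A))) f x
      = avg n (cgauss n A) (avg n (convs n (replicate k (cgauss n A))) f) x"
    unfolding replicate_Suc using law_cgauss[OF A] f Suc.prems by (intro avg_convs_Cons) auto
  also have "\<dots> = avg n (cgauss n A) (avg n (cgauss n (real k \<cdot>\<^sub>m A)) f) x"
    by (intro avg_cong Suc.IH)
  also have "\<dots> = avg n (cgauss n (real (Suc k) \<cdot>\<^sub>m A)) f x"
    unfolding eq by (rule avg_cgauss_add[OF A kA f Suc.prems, symmetric])
  finally show ?case .
qed

lemma remove_nth_replicate: "i < k \<Longrightarrow> remove_nth i (replicate k a) = replicate (k - 1) a"
  by (simp add: remove_nth_def min_def flip: replicate_add)

text \<open>
  Tensorization for \<open>N\<close> identically distributed increments. Removing any one of them leaves the same law,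
  so the sum has \<open>N\<close> equal terms.
\<close>

lemma entropy_gaussian_increment:
  assumes A: "pos_def_mat A" "A \<in> carrier_mat n n" and N: "2 \<le> N"
    and f: "bpos n f" and x: "x \<in> space (Rn n)"
  shows "avg n (cgauss n (real N \<cdot>\<^sub>m A)) (\<lambda>y. xlnx (f y)) x - xlnx (avg n (cgauss n (real N \<cdot>\<^sub>m A)) f x)
    \<le> real N * (avg n (cgauss n (real N \<cdot>\<^sub>m A)) (\<lambda>y. xlnx (f y)) x
        - avg n (cgauss n (real (N - 1) \<cdot>\<^sub>m A)) (\<lambda>y. xlnx (avg n (cgauss n A) f y)) x)"
proof -
  let ?xs = "replicate N (cgauss n A)"
  have T: "avg n (convs n ?xs) g x = avg n (cgauss n (real N \<cdot>\<^sub>m A)) g x" if "bmeas n g" for g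
    using N that x by (intro avg_cgauss_replicate[OF A]) auto
  have T': "avg n (convs n (remove_nth i ?xs)) g x = avg n (cgauss n (real (N - 1) \<cdot>\<^sub>m A)) g x"
    if "bmeas n g" "i < N" for g i
    using N that x avg_cgauss_replicate[OF A, of "N - 1" g x] by (simp add: remove_nth_replicate)
  note l = law_cgauss[OF A]
  have "avg n (convs n ?xs) (\<lambda>y. xlnx (f y)) x - xlnx (avg n (convs n ?xs) f x)
    \<le> (\<Sum>i<length ?xs. avg n (convs n ?xs) (\<lambda>y. xlnx (f y)) x
         - avg n (convs n (remove_nth i ?xs)) (\<lambda>y. xlnx (avg n (?xs ! i) f y)) x)"
    by (rule entropy_tensorization) (use l f x in auto)
  also have "\<dots> = (\<Sum>i<N. avg n (cgauss n (real N \<cdot>\<^sub>m A)) (\<lambda>y. xlnx (f y)) x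
        - avg n (cgauss n (real (N - 1) \<cdot>\<^sub>m A)) (\<lambda>y. xlnx (avg n (cgauss n A) f y)) x)"
    using bmeas_xlnx[OF f] bmeas_avg_xlnx[OF l f] by (intro sum.cong) (auto simp: T T')
  finally show ?thesis
    by (simp only: T[OF bmeas_xlnx[OF f]] T[OF bpos_bmeas[OF f]] sum_constant card_lessThan)
qed

lemma axis_shift:
  assumes "x \<in> space (Rn n)" "i < n"
  shows "vadd n x (\<lambda>j\<in>{..<n}. if j = i then t else 0) = x(i := x i + t)"
  using assms by (auto simp: vadd_def space_PiM PiE_def extensional_def fun_eq_iff)

lemma avg_axis_mult:
  assumes \<sigma>: "0 < \<sigma>" and i: "i < n" and f: "bmeas n f" and w: "bmeas n w" and x: "x \<in> space (Rn n)"
    and inv: "\<And>x t. x \<in> space (Rn n) \<Longrightarrow> w (x(i := t)) = w x"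
  shows "avg n (axis_normal n \<sigma> i) (\<lambda>y. f y * w y) x = avg n (axis_normal n \<sigma> i) f x * w x"
proof -
  let ?N = "density lborel (\<lambda>t. ennreal (normal_density 0 \<sigma> t))"
  let ?e = "\<lambda>t. \<lambda>j\<in>{..<n}. if j = i then t else 0"
  have e: "?e \<in> ?N \<rightarrow>\<^sub>M Rn n" using measurable_axis by simp
  have eq: "avg n (axis_normal n \<sigma> i) g x = (\<integral>t. g (x(i := x i + t)) \<partial>?N)" if "bmeas n g" for g
  proof -
    have g: "g \<in> borel_measurable (Rn n)" using that by (simp add: bmeas_def)
    have "avg n (axis_normal n \<sigma> i) g x = (\<integral>t. g (vadd n x (?e t)) \<partial>?N)"
      unfolding avg_def axis_normal_def
      by (rule integral_distr[OF e]) (rule measurable_compose[OF measurable_vadd_const[OF x] g])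
    then show ?thesis by (simp only: axis_shift[OF x i])
  qed
  show ?thesis by (simp add: eq bmeas_mult f w inv[OF x])
qed

lemma bmeas_one: "bmeas n (\<lambda>_. 1)"
  by (auto simp: bmeas_def)

text \<open>
  The function \<open>c\<close> stands for the conditional expectation of \<open>f\<close> under \<open>\<kappa>\<close> given all coordinates but the \<open>i\<close>-th, and
  \<open>\<kappa>\<close> arises from \<open>\<rho>\<close> by adding an independent normal variable to the \<open>i\<close>-th coordinate. Take the tangent
  inequality at \<open>c\<close> for the average of \<open>f\<close> along the axis: as \<open>c\<close> is constant along the axis, \<open>ln c\<close> can be moved
  under the average, and the mean of \<open>f ln c\<close> is that of \<open>c ln c\<close>.
\<close>

lemma entropy_coordinate_le:
  assumes \<sigma>: "0 < \<sigma>" and i: "i < n" and f: "bpos n f" and c: "bpos n c" and x: "x \<in> space (Rn n)"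
    and inv: "\<And>x t. x \<in> space (Rn n) \<Longrightarrow> c (x(i := t)) = c x"
    and l: "law n \<rho>" "law n \<kappa>"
    and comp: "\<And>h. bmeas n h \<Longrightarrow> avg n \<rho> (avg n (axis_normal n \<sigma> i) h) x = avg n \<kappa> h x"
    and cond: "\<And>w. bmeas n w \<Longrightarrow> (\<And>x t. x \<in> space (Rn n) \<Longrightarrow> w (x(i := t)) = w x) \<Longrightarrow>
      avg n \<kappa> (\<lambda>y. f y * w y) x = avg n \<kappa> (\<lambda>y. c y * w y) x"
  shows "avg n \<kappa> (\<lambda>y. xlnx (c y)) x \<le> avg n \<rho> (\<lambda>y. xlnx (avg n (axis_normal n \<sigma> i) f y)) x"
proof -
  let ?S = "avg n (axis_normal n \<sigma> i)"
  note lS = law_axis_normal[OF \<sigma>, of n i]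
  note bf = bpos_bmeas[OF f] and bc = bpos_bmeas[OF c] and blc = bmeas_ln[OF c]
  have ilc: "\<And>x t. x \<in> space (Rn n) \<Longrightarrow> ln (c (x(i := t))) = ln (c x)" using inv by simp
  obtain e K where K: "e > 0" "\<forall>x \<in> space (Rn n). e \<le> c x" using c by (auto simp: bpos_def)
  obtain e' K' where K': "e' > 0" "\<forall>x \<in> space (Rn n). e' \<le> ?S f x"
    using bpos_avg[OF lS f] by (auto simp: bpos_def)
  have bm: "bmeas n (\<lambda>y. f y * ln (c y))" by (rule bmeas_mult[OF bf blc])
  have b1: "bmeas n (?S (\<lambda>y. f y * ln (c y)))" and b2: "bmeas n (?S f)" and b3: "bmeas n (?S c)"
    by (intro bmeas_avg[OF lS] bm bf bc)+
  have "avg n \<kappa> (\<lambda>y. xlnx (c y)) x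
      = avg n \<kappa> (\<lambda>y. f y * ln (c y)) x - (avg n \<kappa> c x - avg n \<kappa> f x)"
    using cond[OF blc ilc] cond[OF bmeas_one] by (simp add: xlnx_def)
  also have "\<dots> = avg n \<rho> (?S (\<lambda>y. f y * ln (c y))) x - (avg n \<rho> (?S c) x - avg n \<rho> (?S f) x)"
    by (simp add: comp bm bf bc)
  also have "\<dots> = avg n \<rho> (\<lambda>y. ?S (\<lambda>y. f y * ln (c y)) y - (?S c y - ?S f y)) x"
    by (simp add: avg_diff[OF l(1) _ _ x] b1 b2 b3 bmeas_diff)
  also have "\<dots> \<le> avg n \<rho> (\<lambda>y. xlnx (?S f y)) x"
  proof (rule avg_mono[OF l(1) _ _ x])
    fix y assume y: "y \<in> space (Rn n)"
    have "?S (\<lambda>y. f y * ln (c y)) y = ?S f y * ln (c y)"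
      by (rule avg_axis_mult[OF \<sigma> i bf blc y ilc])
    moreover have "?S c y = c y"
    proof -
      have "?S (\<lambda>y. 1) y = 1"
        using lS by (simp add: avg_def law_def prob_space.prob_space)
      then show ?thesis using avg_axis_mult[OF \<sigma> i bmeas_one bc y inv] by simp
    qed
    moreover have "?S f y * ln (c y) + ?S f y - c y \<le> xlnx (?S f y)"
      using K K' y by (intro xlnx_tangent) (force intro: less_imp_le less_le_trans)+
    ultimately show "?S (\<lambda>y. f y * ln (c y)) y - (?S c y - ?S f y) \<le> xlnx (?S f y)" by simp
  qed (intro bmeas_diff b1 b2 b3 bmeas_avg_xlnx lS f)+
  finally show ?thesis .
qed

lemma bmeas_measurable: "bmeas n f \<Longrightarrow> f \<in> borel_measurable (Rn n)"
  by (simp add: bmeas_def)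

text \<open>
  This combines the two uses of tensorization; the functions \<open>c i\<close> are the conditional expectations of \<open>f\<close>
  given the coordinates other than \<open>i\<close>. In the proof, \<open>I\<close>, \<open>D\<close>, \<open>V\<close>, \<open>W\<close> denote the covariances \<open>\<theta>I\<close>, \<open>\<Sigma>/N\<close>,
  \<open>\<Sigma> - \<theta>I\<close>, \<open>\<theta>I - \<Sigma>/N\<close>, and \<open>?T A\<close> is the average over a centred Gaussian increment of covariance \<open>A\<close>.
\<close>

theorem gaussian_tensorization_bounded:
  assumes S: "pos_def_mat \<Sigma>" "\<Sigma> \<in> carrier_mat n n" and n: "0 < n" and \<mu>: "\<mu> \<in> carrier_vec n"
    and f: "bpos n f"
    and c: "\<And>i. i < n \<Longrightarrow> bpos n (c i)"
    and inv: "\<And>i x t. i < n \<Longrightarrow> x \<in> space (Rn n) \<Longrightarrow> c i (x(i := t)) = c i x"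
    and cond: "\<And>i w. i < n \<Longrightarrow> bmeas n w \<Longrightarrow> (\<And>x t. x \<in> space (Rn n) \<Longrightarrow> w (x(i := t)) = w x) \<Longrightarrow>
      (\<integral>y. f y * w y \<partial>gaussian_measure n \<mu> \<Sigma>) = (\<integral>y. c i y * w y \<partial>gaussian_measure n \<mu> \<Sigma>)"
  shows "(\<integral>y. xlnx (f y) \<partial>gaussian_measure n \<mu> \<Sigma>) - xlnx (\<integral>y. f y \<partial>gaussian_measure n \<mu> \<Sigma>)
    \<le> 2 * condition_number \<Sigma> * (\<Sum>i<n. (\<integral>y. xlnx (f y) \<partial>gaussian_measure n \<mu> \<Sigma>)
        - (\<integral>y. xlnx (c i y) \<partial>gaussian_measure n \<mu> \<Sigma>))"
proof -
  define lo where "lo = Min (spectrum \<Sigma>)"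
  define hi where "hi = Max (spectrum \<Sigma>)"
  define \<kappa> where "\<kappa> = hi / lo"
  note sp = spectrum_bounds[OF S n, folded lo_def hi_def]
  have lo: "0 < lo" and lohi: "lo \<le> hi" using sp(1,2) .
  have \<kappa>1: "1 \<le> \<kappa>" using lo lohi by (simp add: \<kappa>_def)
  \<comment> \<open>The least integer above \<open>\<kappa>\<close>; it is at most \<open>\<kappa> + 1 \<le> 2\<kappa>\<close>, because \<open>\<kappa> \<ge> 1\<close>.\<close>
  define N where "N = Suc (nat \<lfloor>\<kappa>\<rfloor>)"
  have N: "2 \<le> N" "\<kappa> < real N" "real N \<le> 2 * \<kappa>"
    using \<kappa>1 unfolding N_def by linarith+
  have N0: "0 < real N" using N(1) by simp
  have hiN: "hi / real N < lo" using N(2) lo N0 by (simp add: \<kappa>_def field_simps)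
  \<comment> \<open>Any number strictly between \<open>hi / N\<close> and \<open>lo\<close> would do: both \<open>V\<close> and \<open>W\<close> have to be positive definite.\<close>
  define \<theta> where "\<theta> = (hi / real N + lo) / 2"
  have \<theta>: "hi / real N < \<theta>" "\<theta> < lo"
  proof -
    have "a < (a + b) / 2" "(a + b) / 2 < b" if "a < b" for a b :: real using that by simp_all
    from this[OF hiN] show "hi / real N < \<theta>" "\<theta> < lo" unfolding \<theta>_def .
  qed
  have \<theta>0: "0 < \<theta>" using \<theta>(1) lo lohi N0 by (smt (verit) divide_pos_pos)
  define \<sigma> where "\<sigma> = sqrt \<theta>"
  have \<sigma>: "0 < \<sigma>" "\<sigma>\<^sup>2 = \<theta>" using \<theta>0 by (simp_all add: \<sigma>_def)
  define I where "I = \<theta> \<cdot>\<^sub>m 1\<^sub>m n"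
  define D where "D = (1 / real N) \<cdot>\<^sub>m \<Sigma>"
  define V where "V = \<Sigma> + (- \<theta>) \<cdot>\<^sub>m 1\<^sub>m n"
  define W where "W = ((- 1 / real N) \<cdot>\<^sub>m \<Sigma>) + \<theta> \<cdot>\<^sub>m 1\<^sub>m n"
  note P = pos_def_matD[OF S]
  have Ic: "pos_def_mat I" "I \<in> carrier_mat n n" using pos_def_smult_one[OF \<theta>0] by (auto simp: I_def)
  have Dc: "pos_def_mat D" "D \<in> carrier_mat n n"
    using pos_def_mat_smult[OF S] N0 S(2) by (auto simp: D_def)
  have Vc: "pos_def_mat V" "V \<in> carrier_mat n n"
  proof -
    show "V \<in> carrier_mat n n" using S(2) by (simp add: V_def)
    show "pos_def_mat V"
    proof (rule pos_def_matI)
      show "sym_mat n V" unfolding V_def by (rule sym_mat_shift[OF P(1)])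
      fix v :: "real vec" assume v: "v \<in> carrier_vec n" "v \<noteq> 0\<^sub>v n"
      have "bform V v v = bform \<Sigma> v v - \<theta> * scalar_prod v v"
        using bform_mat_add[OF S(2) _ v(1) v(1), of "(- \<theta>) \<cdot>\<^sub>m 1\<^sub>m n"]
          smult_one_form[OF v(1), of "- \<theta>"] by (simp add: V_def)
      moreover have "\<theta> * scalar_prod v v < lo * scalar_prod v v"
        using \<theta>(2) scalar_prod_self_pos[OF v] by simp
      ultimately show "0 < bform V v v" using sp(3)[OF v(1)] by linarith
    qed
  qed
  have Wc: "pos_def_mat W" "W \<in> carrier_mat n n"
  proof -
    show "W \<in> carrier_mat n n" using S(2) by (simp add: W_def)
    show "pos_def_mat W"
    proof (rule pos_def_matI)
      have "sym_mat n ((- 1 / real N) \<cdot>\<^sub>m \<Sigma>)"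
        using S(2) sym_mat_index[OF P(1)] by (auto simp: sym_mat_def intro!: eq_matI)
      then show "sym_mat n W" unfolding W_def by (rule sym_mat_shift)
      fix v :: "real vec" assume v: "v \<in> carrier_vec n" "v \<noteq> 0\<^sub>v n"
      have "bform W v v = \<theta> * scalar_prod v v - bform \<Sigma> v v / real N"
        using bform_mat_add[of "(- 1 / real N) \<cdot>\<^sub>m \<Sigma>" n "\<theta> \<cdot>\<^sub>m 1\<^sub>m n" v v] v(1) S(2)
          smult_one_form[OF v(1), of \<theta>] bform_mat_smult[OF S(2) v(1) v(1), of "- 1 / real N"]
        by (simp add: W_def)
      moreover have "bform \<Sigma> v v / real N \<le> hi * scalar_prod v v / real N"
        using sp(4)[OF v(1)] N0 by (intro divide_right_mono) auto
      moreover have "(hi / real N) * scalar_prod v v < \<theta> * scalar_prod v v"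
        using \<theta>(1) scalar_prod_self_pos[OF v] by (intro mult_strict_right_mono)
      ultimately show "0 < bform W v v" by simp
    qed
  qed
  have VI: "V + I = \<Sigma>" using S(2) by (intro eq_matI) (auto simp: V_def I_def)
  have WD: "W + D = I" using S(2) by (intro eq_matI) (auto simp: W_def I_def D_def)
  have ND: "real N \<cdot>\<^sub>m D = \<Sigma>" using S(2) N0 by (intro eq_matI) (auto simp: D_def)
  have ND1: "real (N - 1) \<cdot>\<^sub>m D = V + W"
  proof -
    have r: "real (N - 1) = real N - 1" using N(1) by simp
    have "real (N - 1) * (s / real N) = s - s / real N" for s
      unfolding r using N0 by (simp add: field_simps)
    then show ?thesis
      using S(2) by (intro eq_matI) (auto simp: V_def W_def D_def)
  qed
  note lD = law_cgauss[OF Dc] and lV = law_cgauss[OF Vc] and lW = law_cgauss[OF Wc]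
    and lI = law_cgauss[OF Ic] and lS = law_cgauss[OF S]
  let ?T = "\<lambda>A. avg n (cgauss n A)"
  define m where "m = (\<lambda>i\<in>{..<n}. \<mu> $ i)"
  have m: "m \<in> space (Rn n)" by (simp add: m_def space_PiM)
  have E: "(\<integral>y. g y \<partial>gaussian_measure n \<mu> \<Sigma>) = ?T \<Sigma> g m" if "bmeas n g" for g
    unfolding m_def using that by (intro integral_gaussian[OF S \<mu>]) (rule bmeas_measurable)
  let ?F = "\<lambda>y. xlnx (f y)"
  note bF = bmeas_xlnx[OF f] and bf = bpos_bmeas[OF f]
  have bc: "bmeas n (c i)" "bmeas n (\<lambda>y. xlnx (c i y))" if "i < n" for i
    using c[OF that] bpos_bmeas bmeas_xlnx by auto
  let ?EF = "?T \<Sigma> ?F m"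
  let ?xs = "map (axis_normal n \<sigma>) [0..<n]"
  have lxs: "\<And>\<nu>. \<nu> \<in> set ?xs \<Longrightarrow> law n \<nu>" using law_axis_normal[OF \<sigma>(1)] by auto
  have lrem: "law n (convs n (remove_nth i ?xs))" for i
    using lxs set_remove_nth[of i ?xs] by (intro law_convs) (auto dest: subsetD)
  have convI: "convs n ?xs = cgauss n I"
    using convs_axis_normals[OF \<sigma>(1), of n] \<sigma>(2) by (simp add: I_def)
  \<comment> \<open>Conditioning on the sum of all increments but one.\<close>
  have step1: "?EF - xlnx (?T \<Sigma> f m)
    \<le> real N * (?EF - ?T (V + W) (\<lambda>y. xlnx (?T D f y)) m)"
    using entropy_gaussian_increment[OF Dc N(1) f m] by (simp only: ND ND1)
  have bTI: "bmeas n (?T I ?F)" "bmeas n (\<lambda>y. xlnx (?T I f y))"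
    using bmeas_avg[OF lI bF] bmeas_avg_xlnx[OF lI f] .
  \<comment> \<open>Forgetting \<open>W\<close>.\<close>
  have step2: "?T V (\<lambda>y. xlnx (?T I f y)) m
    \<le> ?T (V + W) (\<lambda>y. xlnx (?T D f y)) m"
  proof -
    let ?h = "\<lambda>y. xlnx (?T D f y)"
    have "?T V (\<lambda>y. xlnx (?T I f y)) m
        \<le> ?T V (?T W ?h) m"
    proof (rule avg_mono[OF lV bTI(2) _ m])
      fix y assume y: "y \<in> space (Rn n)"
      have "?T I f y = ?T W (?T D f) y"
        using avg_cgauss_add[OF Wc Dc bf y] by (simp add: WD)
      then show "xlnx (?T I f y) \<le> ?T W ?h y"
        using xlnx_avg_le[OF lW bpos_avg[OF lD f] y] by simp
    qed (intro bmeas_avg lW bmeas_avg_xlnx lD f)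
    also have "\<dots> = ?T (V + W) ?h m"
      by (rule avg_cgauss_add[OF Vc Wc bmeas_avg_xlnx[OF lD f] m, symmetric])
    finally show ?thesis .
  qed
  let ?R = "\<lambda>i y. avg n (convs n (remove_nth i ?xs)) (\<lambda>y. xlnx (avg n (axis_normal n \<sigma> i) f y)) y"
  have bR: "bmeas n (?R i)" for i
    by (intro bmeas_avg lrem bmeas_avg_xlnx law_axis_normal \<sigma> f)
  have EFV: "?EF = ?T V (?T I ?F) m"
    using avg_cgauss_add[OF Vc Ic bF m] by (simp add: VI)
  \<comment> \<open>Given the part of covariance \<open>V\<close>, the remaining part \<open>N(0, \<theta>I)\<close> splits into its coordinates.\<close>
  have step3: "?EF - ?T V (\<lambda>y. xlnx (?T I f y)) m
    \<le> (\<Sum>i<n. ?EF - ?T V (?R i) m)"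
  proof -
    have bd: "bmeas n (\<lambda>y. ?T I ?F y - ?R i y)" for i
      by (intro bmeas_diff bTI bR)
    have bs: "bmeas n (\<lambda>y. \<Sum>i<n. ?T I ?F y - ?R i y)" by (intro bmeas_sum bd)
    have "?EF - ?T V (\<lambda>y. xlnx (?T I f y)) m
        = ?T V (\<lambda>y. ?T I ?F y - xlnx (?T I f y)) m"
      unfolding EFV by (rule avg_diff[OF lV bTI m, symmetric])
    also have "\<dots> \<le> ?T V (\<lambda>y. \<Sum>i<n. ?T I ?F y - ?R i y) m"
    proof (rule avg_mono[OF lV _ bs m])
      fix y assume y: "y \<in> space (Rn n)"
      show "?T I ?F y - xlnx (?T I f y)
          \<le> (\<Sum>i<n. ?T I ?F y - ?R i y)"
      proof -
        have "avg n (convs n ?xs) ?F y - xlnx (avg n (convs n ?xs) f y)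
          \<le> (\<Sum>i<length ?xs. avg n (convs n ?xs) ?F y
             - avg n (convs n (remove_nth i ?xs)) (\<lambda>y. xlnx (avg n (?xs ! i) f y)) y)"
          by (rule entropy_tensorization[OF _ f y]) (rule lxs)
        then show ?thesis unfolding convI by simp
      qed
    qed (intro bmeas_diff bTI)
    also have "\<dots> = (\<Sum>i<n. ?T V (\<lambda>y. ?T I ?F y - ?R i y) m)"
      by (rule avg_sum[OF lV bd m])
    also have "\<dots> = (\<Sum>i<n. ?EF - ?T V (?R i) m)"
      unfolding EFV by (intro sum.cong refl avg_diff[OF lV bTI(1) bR m])
    finally show ?thesis .
  qed
  \<comment> \<open>Replacing the information by the coordinates of \<open>X\<close> other than \<open>i\<close>.\<close>
  have step4: "?T \<Sigma> (\<lambda>y. xlnx (c i y)) m \<le> ?T V (?R i) m" if i: "i < n" for i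
  proof -
    let ?\<rho> = "conv n (cgauss n V) (convs n (remove_nth i ?xs))"
    have l\<rho>: "law n ?\<rho>" by (rule law_conv[OF lV lrem])
    have comp: "avg n ?\<rho> (avg n (axis_normal n \<sigma> i) h) m = ?T \<Sigma> h m" if h: "bmeas n h" for h
    proof -
      have "avg n ?\<rho> (avg n (axis_normal n \<sigma> i) h) m
          = ?T V (avg n (convs n (remove_nth i ?xs)) (avg n (axis_normal n \<sigma> i) h)) m"
        by (intro avg_conv lV lrem bmeas_avg law_axis_normal \<sigma> h m)
      also have "\<dots> = ?T V (?T I h) m"
      proof (rule avg_cong)
        fix y assume y: "y \<in> space (Rn n)"
        have "avg n (convs n (remove_nth i ?xs)) (avg n (?xs ! i) h) y = avg n (convs n ?xs) h y"
          by (rule avg_convs_remove[OF _ h y]) (use lxs i in auto)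
        then show "avg n (convs n (remove_nth i ?xs)) (avg n (axis_normal n \<sigma> i) h) y = ?T I h y"
          using i by (simp add: convI)
      qed
      also have "\<dots> = ?T \<Sigma> h m"
        using avg_cgauss_add[OF Vc Ic h m] by (simp add: VI)
      finally show ?thesis .
    qed
    have "?T \<Sigma> (\<lambda>y. xlnx (c i y)) m
        \<le> avg n ?\<rho> (\<lambda>y. xlnx (avg n (axis_normal n \<sigma> i) f y)) m"
    proof (rule entropy_coordinate_le[OF \<sigma>(1) i f c[OF i] m inv[OF i] l\<rho> lS comp])
      fix w assume w: "bmeas n w" "\<And>x t. x \<in> space (Rn n) \<Longrightarrow> w (x(i := t)) = w x"
      show "?T \<Sigma> (\<lambda>y. f y * w y) m = ?T \<Sigma> (\<lambda>y. c i y * w y) m"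
        using cond[OF i w] E[OF bmeas_mult[OF bf w(1)]] E[OF bmeas_mult[OF bc(1)[OF i] w(1)]] by simp
    qed
    also have "\<dots> = ?T V (?R i) m"
      by (intro avg_conv lV lrem bmeas_avg_xlnx law_axis_normal \<sigma> f m)
    finally show ?thesis .
  qed
  let ?Sum = "\<Sum>i<n. ?EF - ?T \<Sigma> (\<lambda>y. xlnx (c i y)) m"
  have "?EF - ?T (V + W) (\<lambda>y. xlnx (?T D f y)) m
      \<le> (\<Sum>i<n. ?EF - ?T V (?R i) m)"
    using step2 step3 by linarith
  also have "\<dots> \<le> ?Sum" by (intro sum_mono diff_left_mono step4) simp
  finally have s5: "?EF - ?T (V + W) (\<lambda>y. xlnx (?T D f y)) m \<le> ?Sum" .
  then have le: "?EF - xlnx (?T \<Sigma> f m) \<le> real N * ?Sum"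
    using step1 mult_left_mono[OF s5, of "real N"] N0 by linarith
  have "0 \<le> ?EF - xlnx (?T \<Sigma> f m)"
    using xlnx_avg_le[OF lS f m] by simp
  then have "0 \<le> ?Sum" using le N0 by (meson order_trans zero_le_mult_iff not_less)
  then have "real N * ?Sum \<le> 2 * \<kappa> * ?Sum" using N(3) by (intro mult_right_mono)
  moreover have "condition_number \<Sigma> = \<kappa>" by (simp add: condition_number_def \<kappa>_def hi_def lo_def)
  moreover have "(\<Sum>i<n. (\<integral>y. xlnx (f y) \<partial>gaussian_measure n \<mu> \<Sigma>)
        - (\<integral>y. xlnx (c i y) \<partial>gaussian_measure n \<mu> \<Sigma>)) = ?Sum"
    by (intro sum.cong refl) (simp add: E bF bc)
  ultimately show ?thesis using le by (simp add: E bF bf)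
qed

section \<open>Conditional laws along a coordinate\<close>

text \<open>
  Since the inverse covariance is coercive, the density restricted to any line parallel to an axis is at
  most a one-dimensional Gaussian function. Thus the conditional laws are probability measures for every
  point and not only for almost every one.
\<close>

lemma gaussian_density_fun_upd_integrable:
  assumes S: "pos_def_mat \<Sigma>" "\<Sigma> \<in> carrier_mat n n" and \<mu>: "\<mu> \<in> carrier_vec n"
    and i: "i < n" and x: "x \<in> space (Rn n)"
  shows "integrable lborel (\<lambda>s. gaussian_density n \<mu> \<Sigma> (x(i := s)))"
    "0 < (\<integral>s. gaussian_density n \<mu> \<Sigma> (x(i := s)) \<partial>lborel)"
proof -
  let ?\<rho> = "\<lambda>s. gaussian_density n \<mu> \<Sigma> (x(i := s))"
  let ?c = "sqrt ((2 * pi) ^ n * Determinant.det \<Sigma>)"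
  note Q = pos_def_inverse[OF S]
  note PQ = pos_def_matD[OF Q(4,1)]
  have c: "0 < ?c" using Q(5) by simp
  have Qpsd: "0 \<le> bform (cov_inv \<Sigma>) v v" if "v \<in> carrier_vec n" for v
  proof (cases "v = 0\<^sub>v n")
    case True
    then show ?thesis using Q(1) by (simp add: bform_def)
  qed (use PQ(2) that in \<open>simp add: less_imp_le\<close>)
  obtain d where d: "d > 0" "\<forall>v \<in> carrier_vec n. d * scalar_prod v v \<le> bform (cov_inv \<Sigma>) v v"
    using psd_invertible_coercive[OF PQ(1) Qpsd S(2) Q(3)] by blast
  have mx: "(\<lambda>s. x(i := s)) \<in> borel \<rightarrow>\<^sub>M Rn n"
    by (rule measurable_PiM_single') (use x i in \<open>auto simp: space_PiM PiE_def extensional_def\<close>)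
  have m: "?\<rho> \<in> borel_measurable borel"
    by (rule measurable_compose[OF mx gaussian_density_measurable[OF S \<mu>]])
  have bound: "?\<rho> s \<le> exp (- (d * (s + (- \<mu> $ i))\<^sup>2) / 2) / ?c" for s
  proof -
    let ?v = "Matrix.vec n (vadd n (x(i := s)) (\<lambda>i. - \<mu> $ i))"
    have "d * (s + (- \<mu> $ i))\<^sup>2 = d * (\<Sum>k\<in>{i}. ?v $ k * ?v $ k)"
      using i by (simp add: vadd_def power2_eq_square)
    also have "\<dots> \<le> d * scalar_prod ?v ?v"
      unfolding scalar_prod_def using i d(1) by (intro mult_left_mono sum_mono2) auto
    also have "\<dots> \<le> quad_form n (cov_inv \<Sigma>) (vadd n (x(i := s)) (\<lambda>i. - \<mu> $ i))"
      unfolding quad_form_def using d(2) by simp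
    finally show ?thesis
      unfolding gaussian_density_shift[OF \<mu>] gaussian_density_quad_form[OF S(2)]
      using c by (intro divide_right_mono) auto
  qed
  have int: "integrable lborel (\<lambda>s. exp (- (d * (s + (- \<mu> $ i))\<^sup>2) / 2))"
  proof (rule integrableI_nonneg)
    show "(\<integral>\<^sup>+s. ennreal (exp (- (d * (s + (- \<mu> $ i))\<^sup>2) / 2)) \<partial>lborel) < \<infinity>"
      unfolding nn_integral_gaussian_1d[OF d(1)] by simp
  qed simp_all
  show I: "integrable lborel ?\<rho>"
  proof (rule Bochner_Integration.integrable_bound[OF integrable_divide_zero[OF int, of ?c]])
    show "AE s in lborel. norm (?\<rho> s) \<le> norm (exp (- (d * (s + (- \<mu> $ i))\<^sup>2) / 2) / ?c)"
      using bound gaussian_density_pos[OF S \<mu>] c by (intro AE_I2) (auto simp: less_imp_le)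
  qed (use m in simp_all)
  show "0 < (\<integral>s. ?\<rho> s \<partial>lborel)"
  proof -
    have "(\<integral>s. ?\<rho> s \<partial>lborel) \<noteq> 0"
    proof
      assume "(\<integral>s. ?\<rho> s \<partial>lborel) = 0"
      then have "AE s in lborel. ?\<rho> s = 0"
        using integral_nonneg_eq_0_iff_AE[OF I] gaussian_density_pos[OF S \<mu>] by (simp add: less_imp_le)
      then have "AE s in (lborel :: real measure). False"
        using gaussian_density_pos[OF S \<mu>] by (auto elim!: eventually_mono simp: less_le)
      then show False using AE_iff_measurable[of UNIV lborel "\<lambda>_ :: real. False"] by simp
    qed
    moreover have "0 \<le> (\<integral>s. ?\<rho> s \<partial>lborel)"
      using gaussian_density_pos[OF S \<mu>] by (intro Bochner_Integration.integral_nonneg) (simp add: less_imp_le)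
    ultimately show ?thesis by simp
  qed
qed

text \<open>
  The conditional laws live on the lines parallel to the \<open>i\<close>-th axis, here called fibres.
\<close>

locale gaussian_fibre =
  fixes n :: nat and \<mu> :: "real vec" and \<Sigma> :: "real mat" and i :: nat
  assumes pd: "pos_def_mat \<Sigma>" "\<Sigma> \<in> carrier_mat n n" and mu: "\<mu> \<in> carrier_vec n" and i: "i < n"
begin

abbreviation "\<rho> \<equiv> gaussian_density n \<mu> \<Sigma>"
abbreviation "\<gamma> \<equiv> gaussian_measure n \<mu> \<Sigma>"
abbreviation "fibre_mass x \<equiv> \<integral>s. \<rho> (x(i := s)) \<partial>lborel"
abbreviation "fibre x \<equiv> gaussian_cond n \<mu> \<Sigma> i x"

text \<open>
  The conditional expectation of \<open>h\<close> given the coordinates other than \<open>i\<close>, as a function of all coordinates.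
\<close>

definition cexp :: "((nat \<Rightarrow> real) \<Rightarrow> real) \<Rightarrow> (nat \<Rightarrow> real) \<Rightarrow> real" where
  "cexp h x = (\<integral>t. h (x(i := t)) \<partial>fibre x)"

lemma upd_space: "x \<in> space (Rn n) \<Longrightarrow> x(i := t) \<in> space (Rn n)"
  using i by (auto simp: space_PiM PiE_def extensional_def)

lemma measurable_upd: "(\<lambda>p. (fst p)(i := snd p)) \<in> Rn n \<Otimes>\<^sub>M borel \<rightarrow>\<^sub>M Rn n"
proof (rule measurable_PiM_single')
  fix j assume j: "j \<in> {..<n}"
  show "(\<lambda>p. ((fst p)(i := snd p)) j) \<in> borel_measurable (Rn n \<Otimes>\<^sub>M borel)"
    by (cases "j = i") (use j in auto)
qed (use i in \<open>auto simp: space_pair_measure space_PiM PiE_def extensional_def Pi_def\<close>)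

lemma measurable_upd_snd: "x \<in> space (Rn n) \<Longrightarrow> (\<lambda>t. x(i := t)) \<in> borel \<rightarrow>\<^sub>M Rn n"
  using measurable_compose[OF measurable_Pair1'[of x "Rn n" "borel :: real measure"] measurable_upd] by simp

lemma \<rho>_measurable: "\<rho> \<in> borel_measurable (Rn n)"
  by (rule gaussian_density_measurable[OF pd mu])

lemma \<rho>_pos: "0 < \<rho> x"
  by (rule gaussian_density_pos[OF pd mu])

lemma fibre_mass_pos: "x \<in> space (Rn n) \<Longrightarrow> 0 < fibre_mass x"
  by (rule gaussian_density_fun_upd_integrable[OF pd mu i])

lemma nn_fibre_mass:
  assumes "x \<in> space (Rn n)"
  shows "(\<integral>\<^sup>+s. ennreal (\<rho> (x(i := s))) \<partial>lborel) = ennreal (fibre_mass x)"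
  using gaussian_density_fun_upd_integrable(1)[OF pd mu i assms] \<rho>_pos
  by (intro nn_integral_eq_integral) (auto simp: less_imp_le)

lemma fibre_mass_measurable: "fibre_mass \<in> borel_measurable (Rn n)"
proof -
  have "(\<lambda>p. \<rho> ((fst p)(i := snd p))) \<in> borel_measurable (Rn n \<Otimes>\<^sub>M lborel)"
    using measurable_compose[OF measurable_upd \<rho>_measurable]
      borel_measurable_pair_lborel by blast
  then show ?thesis
    by (intro lborel.borel_measurable_lebesgue_integral) (simp add: split_beta')
qed

lemma fibre_weight_measurable:
  "(\<lambda>p. \<rho> ((fst p)(i := snd p)) / fibre_mass (fst p)) \<in> borel_measurable (Rn n \<Otimes>\<^sub>M borel)"
  by (intro borel_measurable_divide measurable_compose[OF measurable_upd \<rho>_measurable]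
      measurable_compose[OF measurable_fst fibre_mass_measurable])

lemma fibre_density_measurable:
  "x \<in> space (Rn n) \<Longrightarrow> (\<lambda>t. \<rho> (x(i := t)) / fibre_mass x) \<in> borel_measurable borel"
  using measurable_compose[OF measurable_upd_snd \<rho>_measurable] by measurable

lemma fibre_upd: "fibre (x(i := t)) = fibre x"
  by (simp add: gaussian_cond_def)

lemma sets_fibre: "sets (fibre x) = sets borel"
  by (simp add: gaussian_cond_def)

lemma measurable_fibre:
  assumes "x \<in> space (Rn n)" "h \<in> borel_measurable (Rn n)"
  shows "(\<lambda>t. h (x(i := t))) \<in> borel_measurable (fibre x)"
  using measurable_compose[OF measurable_upd_snd[OF assms(1)] assms(2)]
    measurable_cong_sets[OF sets_fibre refl] by blast

lemma nn_integral_fibre: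
  assumes x: "x \<in> space (Rn n)" and h: "h \<in> borel_measurable (Rn n)"
  shows "(\<integral>\<^sup>+t. h (x(i := t)) \<partial>fibre x)
    = (\<integral>\<^sup>+t. ennreal (\<rho> (x(i := t)) / fibre_mass x) * h (x(i := t)) \<partial>lborel)"
  unfolding gaussian_cond_def
  using fibre_density_measurable[OF x] measurable_compose[OF measurable_upd_snd[OF x] h]
  by (intro nn_integral_density) auto

lemma prob_space_fibre:
  assumes x: "x \<in> space (Rn n)"
  shows "prob_space (fibre x)"
proof (rule prob_spaceI)
  let ?m = "fibre_mass x"
  have "(\<lambda>t. \<rho> (x(i := t))) \<in> borel_measurable borel"
    by (rule measurable_compose[OF measurable_upd_snd[OF x] \<rho>_measurable])
  then have "(\<integral>\<^sup>+t. ennreal (\<rho> (x(i := t)) / ?m) \<partial>lborel) = ennreal ?m * ennreal (1 / ?m)"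
    using nn_fibre_mass[OF x] fibre_mass_pos[OF x] \<rho>_pos
    by (subst nn_fibre_mass[OF x, symmetric], subst nn_integral_multc[symmetric])
      (auto simp: ennreal_mult[symmetric] less_imp_le)
  also have "\<dots> = 1" using fibre_mass_pos[OF x] by (simp flip: ennreal_mult)
  finally show "emeasure (fibre x) (space (fibre x)) = 1"
    using fibre_density_measurable[OF x] by (simp add: gaussian_cond_def emeasure_density)
qed

lemma nn_integral_fibrewise:
  assumes "g \<in> borel_measurable (Rn n)"
  shows "(\<integral>\<^sup>+x. g x \<partial>Ln n) = (\<integral>\<^sup>+x. (\<integral>\<^sup>+t. g (x(i := t)) \<partial>lborel) \<partial>Pi\<^sub>M ({..<n} - {i}) (\<lambda>_. lborel))"
proof -
  have "insert i ({..<n} - {i}) = {..<n}" using i by auto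
  then show ?thesis
    using lborels.product_nn_integral_insert[of "{..<n} - {i}" i g] assms
    by (simp add: borel_PiM_lborel)
qed

lemma nn_integral_fibre_measurable:
  assumes h: "h \<in> borel_measurable (Rn n)"
  shows "(\<lambda>x. \<integral>\<^sup>+t. ennreal (\<rho> (x(i := t)) / fibre_mass x) * h (x(i := t)) \<partial>lborel)
    \<in> borel_measurable (Rn n)"
proof -
  have "(\<lambda>p. ennreal (\<rho> ((fst p)(i := snd p)) / fibre_mass (fst p)) * h ((fst p)(i := snd p)))
      \<in> borel_measurable (Rn n \<Otimes>\<^sub>M lborel)"
    unfolding borel_measurable_pair_lborel
    by (intro borel_measurable_times_ennreal measurable_compose[OF measurable_upd h]
        measurable_compose[OF fibre_weight_measurable measurable_ennreal])
  then show ?thesis by (intro lborel.borel_measurable_nn_integral) (simp add: split_beta')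
qed

text \<open>
  The law of total expectation. Along a fibre the conditional density is the joint density divided by
  the mass of the fibre, and that mass is recovered when the joint density is integrated over the fibre.
\<close>

lemma nn_tower:
  assumes h: "h \<in> borel_measurable (Rn n)"
  shows "(\<integral>\<^sup>+x. (\<integral>\<^sup>+t. ennreal (\<rho> (x(i := t)) / fibre_mass x) * h (x(i := t)) \<partial>lborel) \<partial>\<gamma>) = (\<integral>\<^sup>+x. h x \<partial>\<gamma>)"
proof -
  let ?H = "\<lambda>x. \<integral>\<^sup>+t. ennreal (\<rho> (x(i := t)) / fibre_mass x) * h (x(i := t)) \<partial>lborel"
  let ?J = "Pi\<^sub>M ({..<n} - {i}) (\<lambda>_. lborel)"
  note mH = nn_integral_fibre_measurable[OF h]
  note mr = measurable_compose[OF \<rho>_measurable measurable_ennreal]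
  have "(\<integral>\<^sup>+x. ?H x \<partial>\<gamma>) = (\<integral>\<^sup>+x. ennreal (\<rho> x) * ?H x \<partial>Ln n)"
    by (rule nn_integral_gaussian[OF pd mu mH])
  also have "\<dots> = (\<integral>\<^sup>+x. (\<integral>\<^sup>+s. ennreal (\<rho> (x(i := s))) * ?H (x(i := s)) \<partial>lborel) \<partial>?J)"
    by (rule nn_integral_fibrewise) (intro borel_measurable_times_ennreal mr mH)
  also have "\<dots> = (\<integral>\<^sup>+x. (\<integral>\<^sup>+t. ennreal (\<rho> (x(i := t))) * h (x(i := t)) \<partial>lborel) \<partial>?J)"
  proof (rule nn_integral_cong)
    fix x :: "nat \<Rightarrow> real" assume "x \<in> space ?J"
    then have x0: "x(i := 0) \<in> space (Rn n)" using i by (auto simp: space_PiM PiE_def extensional_def Pi_def)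
    have up: "x(i := t) = (x(i := 0))(i := t)" for t by simp
    let ?m = "fibre_mass x"
    have m: "0 < ?m" using fibre_mass_pos[OF x0] by simp
    have mrx: "(\<lambda>s. ennreal (\<rho> (x(i := s)))) \<in> borel_measurable borel"
      using measurable_compose[OF measurable_upd_snd[OF x0] mr] by simp
    have mhx: "(\<lambda>s. h (x(i := s))) \<in> borel_measurable borel"
      using measurable_compose[OF measurable_upd_snd[OF x0] h] by simp
    have "(\<integral>\<^sup>+s. ennreal (\<rho> (x(i := s))) * ?H (x(i := s)) \<partial>lborel)
        = (\<integral>\<^sup>+s. ennreal (\<rho> (x(i := s))) \<partial>lborel) * ?H x"
      using mrx by (simp add: nn_integral_multc)
    also have "(\<integral>\<^sup>+s. ennreal (\<rho> (x(i := s))) \<partial>lborel) = ennreal ?m"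
      using nn_fibre_mass[OF x0] by simp
    also have "?H x = (\<integral>\<^sup>+t. ennreal (1 / ?m) * (ennreal (\<rho> (x(i := t))) * h (x(i := t))) \<partial>lborel)"
    proof (rule nn_integral_cong)
      fix t
      have "ennreal (\<rho> (x(i := t)) / ?m) = ennreal (1 / ?m) * ennreal (\<rho> (x(i := t)))"
        using m \<rho>_pos by (simp add: less_imp_le flip: ennreal_mult)
      then show "ennreal (\<rho> (x(i := t)) / ?m) * h (x(i := t))
        = ennreal (1 / ?m) * (ennreal (\<rho> (x(i := t))) * h (x(i := t)))" by (simp add: mult.assoc)
    qed
    also have "\<dots> = ennreal (1 / ?m) * (\<integral>\<^sup>+t. ennreal (\<rho> (x(i := t))) * h (x(i := t)) \<partial>lborel)"
      using mrx mhx by (intro nn_integral_cmult) simp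
    also have "ennreal ?m * \<dots> = (\<integral>\<^sup>+t. ennreal (\<rho> (x(i := t))) * h (x(i := t)) \<partial>lborel)"
      unfolding mult.assoc[symmetric] using m by (subst ennreal_mult[symmetric]) auto
    finally show "(\<integral>\<^sup>+s. ennreal (\<rho> (x(i := s))) * ?H (x(i := s)) \<partial>lborel)
        = (\<integral>\<^sup>+t. ennreal (\<rho> (x(i := t))) * h (x(i := t)) \<partial>lborel)" .
  qed
  also have "\<dots> = (\<integral>\<^sup>+x. ennreal (\<rho> x) * h x \<partial>Ln n)"
    by (rule nn_integral_fibrewise[symmetric]) (intro borel_measurable_times_ennreal mr h)
  also have "\<dots> = (\<integral>\<^sup>+x. h x \<partial>\<gamma>)"
    by (rule nn_integral_gaussian[OF pd mu h, symmetric])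
  finally show ?thesis .
qed

lemma law_\<gamma>: "law n \<gamma>"
  by (rule law_gaussian[OF pd mu])

lemma space_\<gamma>: "space \<gamma> = space (Rn n)"
  by (rule space_law[OF law_\<gamma>])

lemma measurable_\<gamma>: "borel_measurable \<gamma> = borel_measurable (Rn n)"
  by (rule measurable_cong_sets[OF sets_law[OF law_\<gamma>] refl])

lemma cexp_measurable:
  assumes h: "h \<in> borel_measurable (Rn n)"
  shows "cexp h \<in> borel_measurable (Rn n)"
proof -
  have "(\<lambda>p. \<rho> ((fst p)(i := snd p)) / fibre_mass (fst p) * h ((fst p)(i := snd p)))
      \<in> borel_measurable (Rn n \<Otimes>\<^sub>M lborel)"
    unfolding borel_measurable_pair_lborel
    by (intro borel_measurable_times fibre_weight_measurable measurable_compose[OF measurable_upd h])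
  then have "(\<lambda>x. \<integral>t. \<rho> (x(i := t)) / fibre_mass x * h (x(i := t)) \<partial>lborel) \<in> borel_measurable (Rn n)"
    by (intro lborel.borel_measurable_lebesgue_integral) (simp add: split_beta')
  moreover have "cexp h x = (\<integral>t. \<rho> (x(i := t)) / fibre_mass x * h (x(i := t)) \<partial>lborel)"
    if x: "x \<in> space (Rn n)" for x
    unfolding cexp_def gaussian_cond_def
    using fibre_density_measurable[OF x] measurable_compose[OF measurable_upd_snd[OF x] h]
      fibre_mass_pos[OF x] \<rho>_pos
    by (subst integral_real_density) (auto simp: less_imp_le)
  ultimately show ?thesis by (simp cong: measurable_cong)
qed

lemma tower_nonneg:
  assumes h: "h \<in> borel_measurable (Rn n)" and nonneg: "\<And>x. x \<in> space (Rn n) \<Longrightarrow> 0 \<le> h x"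
    and int: "integrable \<gamma> h"
  shows "AE x in \<gamma>. integrable (fibre x) (\<lambda>t. h (x(i := t)))"
    "integrable \<gamma> (cexp h)" "(\<integral>x. cexp h x \<partial>\<gamma>) = (\<integral>x. h x \<partial>\<gamma>)"
proof -
  let ?h = "\<lambda>x. ennreal (h x)"
  let ?H = "\<lambda>x. \<integral>\<^sup>+t. ennreal (\<rho> (x(i := t)) / fibre_mass x) * ?h (x(i := t)) \<partial>lborel"
  have mh: "?h \<in> borel_measurable (Rn n)" by (rule measurable_compose[OF h measurable_ennreal])
  have HE: "?H x = (\<integral>\<^sup>+t. ?h (x(i := t)) \<partial>fibre x)" if "x \<in> space (Rn n)" for x
    by (rule nn_integral_fibre[OF that mh, symmetric])
  have tot: "(\<integral>\<^sup>+x. ?H x \<partial>\<gamma>) = ennreal (\<integral>x. h x \<partial>\<gamma>)"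
    unfolding nn_tower[OF mh] using int nonneg
    by (intro nn_integral_eq_integral) (auto simp: space_\<gamma> intro!: AE_I2)
  have "AE x in \<gamma>. ?H x \<noteq> \<infinity>"
    using nn_integral_fibre_measurable[OF mh] tot
    by (intro nn_integral_noteq_infinite) (simp_all add: measurable_\<gamma>)
  then show ae: "AE x in \<gamma>. integrable (fibre x) (\<lambda>t. h (x(i := t)))"
  proof (rule AE_mp, intro AE_I2 impI)
    fix x assume "x \<in> space \<gamma>" and fin: "?H x \<noteq> \<infinity>"
    then have x: "x \<in> space (Rn n)" by (simp add: space_\<gamma>)
    show "integrable (fibre x) (\<lambda>t. h (x(i := t)))"
      using measurable_fibre[OF x h] nonneg upd_space[OF x] fin HE[OF x]
      by (intro integrableI_nonneg) (auto simp: less_top)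
  qed
  have nn: "0 \<le> cexp h x" if "x \<in> space (Rn n)" for x
    unfolding cexp_def using nonneg upd_space[OF that] by (intro Bochner_Integration.integral_nonneg) auto
  have "AE x in \<gamma>. ?H x = ennreal (cexp h x)"
    using ae
  proof (rule AE_mp, intro AE_I2 impI)
    fix x assume "x \<in> space \<gamma>" and int: "integrable (fibre x) (\<lambda>t. h (x(i := t)))"
    then have x: "x \<in> space (Rn n)" by (simp add: space_\<gamma>)
    show "?H x = ennreal (cexp h x)"
      unfolding HE[OF x] cexp_def using int nonneg upd_space[OF x]
      by (intro nn_integral_eq_integral) auto
  qed
  then have eq: "(\<integral>\<^sup>+x. ennreal (cexp h x) \<partial>\<gamma>) = ennreal (\<integral>x. h x \<partial>\<gamma>)"
    unfolding tot[symmetric] by (intro nn_integral_cong_AE) auto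
  show i: "integrable \<gamma> (cexp h)"
    using cexp_measurable[OF h] nn eq
    by (intro integrableI_nonneg) (auto simp: measurable_\<gamma> space_\<gamma> intro!: AE_I2)
  have "0 \<le> (\<integral>x. h x \<partial>\<gamma>)" using nonneg by (intro Bochner_Integration.integral_nonneg) (auto simp: space_\<gamma>)
  moreover have "0 \<le> (\<integral>x. cexp h x \<partial>\<gamma>)" using nn by (intro Bochner_Integration.integral_nonneg) (auto simp: space_\<gamma>)
  moreover have "ennreal (\<integral>x. cexp h x \<partial>\<gamma>) = ennreal (\<integral>x. h x \<partial>\<gamma>)"
  proof -
    have "(\<integral>\<^sup>+x. ennreal (cexp h x) \<partial>\<gamma>) = ennreal (\<integral>x. cexp h x \<partial>\<gamma>)"
      using nn by (intro nn_integral_eq_integral[OF i] AE_I2) (simp add: space_\<gamma>)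
    then show ?thesis using eq by simp
  qed
  ultimately show "(\<integral>x. cexp h x \<partial>\<gamma>) = (\<integral>x. h x \<partial>\<gamma>)" by simp
qed

lemma cexp_upd: "cexp h (x(i := t)) = cexp h x"
  by (simp add: cexp_def fibre_upd)

lemma bpos_cexp:
  assumes "bpos n f"
  shows "bpos n (cexp f)"
proof -
  obtain e K where K: "e > 0" "\<forall>x \<in> space (Rn n). e \<le> f x \<and> f x \<le> K"
      and f: "f \<in> borel_measurable (Rn n)"
    using assms by (auto simp: bpos_def)
  have "e \<le> cexp f x \<and> cexp f x \<le> K" if x: "x \<in> space (Rn n)" for x
    using prob_space.expectation_between(1,2)[OF prob_space_fibre[OF x] measurable_fibre[OF x f], of e K]
      K upd_space[OF x] by (auto simp: cexp_def)
  then show ?thesis using K(1) cexp_measurable[OF f] by (auto simp: bpos_def)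
qed

lemma bmeas_integrable_\<gamma>: "bmeas n f \<Longrightarrow> integrable \<gamma> f"
proof -
  assume f: "bmeas n f"
  interpret prob_space \<gamma> using law_\<gamma> by (simp add: law_def)
  obtain K where "\<forall>x \<in> space (Rn n). \<bar>f x\<bar> \<le> K" "f \<in> borel_measurable (Rn n)"
    using f by (auto simp: bmeas_def)
  then show ?thesis
    by (intro integrable_const_bound[of _ K]) (auto simp: measurable_\<gamma> space_\<gamma> intro!: AE_I2)
qed

text \<open>
  The defining property of conditional expectation. The law of total expectation is available for
  nonnegative functions, therefore the bounded factor \<open>w\<close> is first shifted by its bound \<open>B\<close>.
\<close>

lemma integral_cexp_mult:
  assumes f: "bpos n f" and w: "bmeas n w" and inv: "\<And>x t. x \<in> space (Rn n) \<Longrightarrow> w (x(i := t)) = w x"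
  shows "(\<integral>y. f y * w y \<partial>\<gamma>) = (\<integral>y. cexp f y * w y \<partial>\<gamma>)"
proof -
  obtain B where B: "\<forall>x \<in> space (Rn n). \<bar>w x\<bar> \<le> B" using w by (auto simp: bmeas_def)
  obtain e where e: "e > 0" "\<forall>x \<in> space (Rn n). e \<le> f x" using f by (auto simp: bpos_def)
  have fn: "0 \<le> f x" if "x \<in> space (Rn n)" for x using e that by force
  note bf = bpos_bmeas[OF f] and bc = bpos_bmeas[OF bpos_cexp[OF f]]
  have t1: "(\<integral>x. cexp f x \<partial>\<gamma>) = (\<integral>x. f x \<partial>\<gamma>)"
    by (rule tower_nonneg(3)[OF bmeas_measurable[OF bf] fn bmeas_integrable_\<gamma>[OF bf]])
  have bB: "bmeas n (\<lambda>x. w x - (- B))" by (rule bmeas_diff[OF w]) (auto simp: bmeas_def)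
  have bh: "bmeas n (\<lambda>x. f x * (w x - (- B)))" by (rule bmeas_mult[OF bf bB])
  have "(\<integral>x. cexp (\<lambda>x. f x * (w x - (- B))) x \<partial>\<gamma>) = (\<integral>x. f x * (w x - (- B)) \<partial>\<gamma>)"
    using B by (intro tower_nonneg(3)[OF bmeas_measurable[OF bh] _ bmeas_integrable_\<gamma>[OF bh]])
      (force intro!: mult_nonneg_nonneg fn simp: abs_le_iff)
  moreover have "(\<integral>x. cexp (\<lambda>x. f x * (w x - (- B))) x \<partial>\<gamma>) = (\<integral>x. cexp f x * (w x - (- B)) \<partial>\<gamma>)"
    by (intro Bochner_Integration.integral_cong refl) (simp add: space_\<gamma> cexp_def inv)
  ultimately have "(\<integral>x. cexp f x * w x + cexp f x * B \<partial>\<gamma>) = (\<integral>x. f x * w x + f x * B \<partial>\<gamma>)"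
    by (simp add: distrib_left)
  then show ?thesis
    using bmeas_integrable_\<gamma>[OF bf] bmeas_integrable_\<gamma>[OF bc] t1
      bmeas_integrable_\<gamma>[OF bmeas_mult[OF bf w]] bmeas_integrable_\<gamma>[OF bmeas_mult[OF bc w]]
    by simp
qed

end

section \<open>Truncation\<close>

lemma xlnx_ge: "0 \<le> a \<Longrightarrow> - 1 \<le> xlnx a"
  using xlnx_tangent[of a 1] by simp

text \<open>
  Continuity of \<open>x ln x\<close> on \<open>[0,\<infinity>)\<close>. At \<open>0\<close> it follows from \<open>- ln y = 2 ln (1 / sqrt y) \<le> 2 / sqrt y\<close>.
\<close>

lemma xlnx_tendsto:
  assumes a: "\<And>k. 0 \<le> a k" and lim: "a \<longlonglongrightarrow> l"
  shows "(\<lambda>k. xlnx (a k)) \<longlonglongrightarrow> xlnx l"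
proof (cases "l = 0")
  case False
  then show ?thesis unfolding xlnx_def by (intro tendsto_intros lim)
next
  case True
  have bound: "\<bar>xlnx y\<bar> \<le> 2 * sqrt y" if y: "0 \<le> y" "y \<le> 1" for y :: real
  proof (cases "y = 0")
    case False
    then have y0: "0 < y" using y by simp
    have "ln (1 / sqrt y) \<le> 1 / sqrt y - 1" using y0 by (intro ln_le_minus_one) simp
    moreover have "ln (1 / sqrt y) = - ln y / 2" using y0 by (simp add: ln_div ln_sqrt)
    ultimately have "- ln y \<le> 2 * (1 / sqrt y)" by linarith
    then have "y * (- ln y) \<le> y * (2 * (1 / sqrt y))" using y0 by (intro mult_left_mono) auto
    also have "\<dots> = 2 * (y / sqrt y)" by simp
    also have "\<dots> = 2 * sqrt y" using y0 by (simp only: real_div_sqrt less_imp_le)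
    finally show ?thesis using y0 y(2) by (simp add: xlnx_def abs_mult)
  qed (simp add: xlnx_def)
  have "\<forall>\<^sub>F k in sequentially. a k < 1" using order_tendstoD(2)[OF lim, of 1] True by simp
  then have "\<forall>\<^sub>F k in sequentially. norm (xlnx (a k)) \<le> 2 * sqrt (a k)"
    by (rule eventually_mono) (use bound a in auto)
  moreover have "(\<lambda>k. 2 * sqrt (a k)) \<longlonglongrightarrow> 2 * sqrt l" by (intro tendsto_intros lim)
  ultimately have "(\<lambda>k. xlnx (a k)) \<longlonglongrightarrow> 0"
    using True by (intro Lim_null_comparison[of "\<lambda>k. xlnx (a k)" "\<lambda>k. 2 * sqrt (a k)"]) auto
  then show ?thesis using True by (simp add: xlnx_def)
qed

definition clamp_at :: "nat \<Rightarrow> real \<Rightarrow> real" where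
  "clamp_at k y = max (1 / real (Suc k)) (min y (real (Suc k)))"

lemma clamp_at_bounds: "1 / real (Suc k) \<le> clamp_at k y" "clamp_at k y \<le> real (Suc k)"
  by (auto simp: clamp_at_def field_simps)

lemma clamp_at_pos: "0 < clamp_at k y"
  using clamp_at_bounds(1)[of k y] by (smt (verit) of_nat_0_less_iff zero_less_divide_1_iff zero_less_Suc)

lemma clamp_at_le: "0 \<le> y \<Longrightarrow> clamp_at k y \<le> y + 1"
  by (auto simp: clamp_at_def field_simps)

lemma clamp_at_tendsto:
  assumes "0 \<le> y" shows "(\<lambda>k. clamp_at k y) \<longlonglongrightarrow> y"
proof -
  have l: "(\<lambda>k. 1 / real (Suc k)) \<longlonglongrightarrow> 0"
    using LIMSEQ_inverse_real_of_nat by (simp add: inverse_eq_divide)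
  obtain K where K: "y < real K" using reals_Archimedean2 by blast
  have "\<forall>\<^sub>F k in sequentially. min y (real (Suc k)) = y"
    using eventually_ge_at_top[of K] by eventually_elim (use K in auto)
  then have "(\<lambda>k. min y (real (Suc k))) \<longlonglongrightarrow> y" by (rule tendsto_eventually)
  from tendsto_max[OF l this] show ?thesis using assms by (simp add: clamp_at_def max_def)
qed

lemma xlnx_clamp_at:
  assumes "0 \<le> y" shows "\<bar>xlnx (clamp_at k y)\<bar> \<le> \<bar>xlnx y\<bar> + 1"
proof (cases "1 \<le> y")
  case True
  then have g: "1 \<le> clamp_at k y" "clamp_at k y \<le> y"
  proof -
    have "1 / real (Suc k) \<le> 1" "1 \<le> real (Suc k)" by auto
    then show "1 \<le> clamp_at k y" "clamp_at k y \<le> y" using True unfolding clamp_at_def by linarith+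
  qed
  then have "0 \<le> ln (clamp_at k y)" "ln (clamp_at k y) \<le> ln y" by auto
  then have "0 \<le> xlnx (clamp_at k y)" "xlnx (clamp_at k y) \<le> xlnx y"
    unfolding xlnx_def using g by (auto intro!: mult_mono)
  then show ?thesis by linarith
next
  case False
  then have "clamp_at k y \<le> 1" by (auto simp: clamp_at_def)
  then have "xlnx (clamp_at k y) \<le> 0"
    using clamp_at_pos[of k y] by (auto simp: xlnx_def mult_nonneg_nonpos)
  moreover have "- 1 \<le> xlnx (clamp_at k y)" using clamp_at_pos[of k y] by (intro xlnx_ge) simp
  ultimately show ?thesis by linarith
qed

lemma clamp_at_measurable [measurable]: "clamp_at k \<in> borel_measurable borel"
  unfolding clamp_at_def[abs_def] by measurable

lemma bpos_clamp:
  assumes "f \<in> borel_measurable (Rn n)"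
  shows "bpos n (\<lambda>x. clamp_at k (f x))"
  unfolding bpos_def
  using clamp_at_bounds[of k] measurable_compose[OF assms clamp_at_measurable]
  by (intro conjI exI[of _ "1 / real (Suc k)"] exI[of _ "real (Suc k)"]) auto

text \<open>
  Fatou's lemma for functions that are at least \<open>-1\<close>, such as \<open>x ln x\<close> of a nonnegative function.
\<close>

lemma (in prob_space) fatou_bounded_below:
  fixes u :: "nat \<Rightarrow> 'a \<Rightarrow> real"
  assumes int: "\<And>k. integrable M (u k)" and lower: "\<And>k x. x \<in> space M \<Longrightarrow> - 1 \<le> u k x"
    and v: "v \<in> borel_measurable M" "\<And>x. x \<in> space M \<Longrightarrow> - 1 \<le> v x"
    and lim: "AE x in M. (\<lambda>k. u k x) \<longlonglongrightarrow> v x"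
    and bound: "\<And>k. expectation (u k) \<le> B"
  shows "integrable M v" "0 < d \<Longrightarrow> \<forall>\<^sub>F k in sequentially. expectation v - d < expectation (u k)"
proof -
  have iu: "integrable M (\<lambda>x. u k x + 1)" for k using int by simp
  have eu: "expectation (\<lambda>x. u k x + 1) = expectation (u k) + 1" for k
    using int by (simp add: prob_space)
  have nu: "(\<integral>\<^sup>+x. ennreal (u k x + 1) \<partial>M) = ennreal (expectation (u k) + 1)" for k
    unfolding eu[symmetric]
  proof (intro nn_integral_eq_integral iu AE_I2)
    show "0 \<le> u k x + 1" if "x \<in> space M" for x using lower[OF that, of k] by linarith
  qed
  have low: "- 1 \<le> expectation (u k)" for k
    using integral_ge_const[OF int AE_I2[OF lower]] by blast
  have "(\<integral>\<^sup>+x. ennreal (v x + 1) \<partial>M) = (\<integral>\<^sup>+x. liminf (\<lambda>k. ennreal (u k x + 1)) \<partial>M)"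
  proof (rule nn_integral_cong_AE)
    show "AE x in M. ennreal (v x + 1) = liminf (\<lambda>k. ennreal (u k x + 1))"
      using lim
    proof (rule AE_mp, intro AE_I2 impI)
      fix x assume "(\<lambda>k. u k x) \<longlonglongrightarrow> v x"
      then have "(\<lambda>k. ennreal (u k x + 1)) \<longlonglongrightarrow> ennreal (v x + 1)"
        by (intro tendsto_ennrealI tendsto_intros)
      then show "ennreal (v x + 1) = liminf (\<lambda>k. ennreal (u k x + 1))"
        by (intro lim_imp_Liminf[symmetric]) auto
    qed
  qed
  also have "\<dots> \<le> liminf (\<lambda>k. \<integral>\<^sup>+x. ennreal (u k x + 1) \<partial>M)"
    using iu by (intro nn_integral_liminf measurable_compose[OF borel_measurable_integrable measurable_ennreal])
  finally have F: "(\<integral>\<^sup>+x. ennreal (v x + 1) \<partial>M) \<le> liminf (\<lambda>k. ennreal (expectation (u k) + 1))"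
    by (simp add: nu)
  also have "\<dots> \<le> ennreal (B + 1)"
    using bound by (intro Liminf_le) (auto intro!: always_eventually ennreal_leI)
  finally have fin: "(\<integral>\<^sup>+x. ennreal (v x + 1) \<partial>M) < \<infinity>"
    by (metis ennreal_less_top infinity_ennreal_def order_le_less_trans)
  have v1: "0 \<le> v x + 1" if "x \<in> space M" for x using v(2)[OF that] by linarith
  have iv1: "integrable M (\<lambda>x. v x + 1)"
    using v(1) fin by (intro integrableI_nonneg AE_I2 v1) simp_all
  then have "integrable M (\<lambda>x. (v x + 1) - 1)" by (intro Bochner_Integration.integrable_diff) auto
  then show iv: "integrable M v" by simp
  have "(\<integral>\<^sup>+x. ennreal (v x + 1) \<partial>M) = ennreal (expectation (\<lambda>x. v x + 1))"
    by (intro nn_integral_eq_integral iv1 AE_I2 v1)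
  then have F': "ennreal (expectation v + 1) \<le> liminf (\<lambda>k. ennreal (expectation (u k) + 1))"
    using F iv by (simp add: prob_space)
  assume d: "0 < d"
  show "\<forall>\<^sub>F k in sequentially. expectation v - d < expectation (u k)"
  proof (cases "expectation v + 1 - d < 0")
    case True
    then have "expectation v - d < expectation (u k)" for k using low[of k] by linarith
    then show ?thesis by simp
  next
    case False
    then have "ennreal (expectation v + 1 - d) < ennreal (expectation v + 1)"
      using d by (intro ennreal_lessI) auto
    then have "ennreal (expectation v + 1 - d) < liminf (\<lambda>k. ennreal (expectation (u k) + 1))"
      using F' by (rule less_le_trans)
    then have "\<forall>\<^sub>F k in sequentially. ennreal (expectation v + 1 - d) < ennreal (expectation (u k) + 1)"
      by (rule less_LiminfD)
    then show ?thesis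
    proof (rule eventually_mono)
      fix k assume "ennreal (expectation v + 1 - d) < ennreal (expectation (u k) + 1)"
      then show "expectation v - d < expectation (u k)"
        using False low[of k] by (simp add: ennreal_less_iff)
    qed
  qed
qed

context gaussian_fibre
begin

text \<open>
  Tangent inequality at the conditional expectation.
\<close>

lemma xlnx_cexp_le:
  assumes f: "bpos n f"
  shows "(\<integral>x. xlnx (cexp f x) \<partial>\<gamma>) \<le> (\<integral>x. xlnx (f x) \<partial>\<gamma>)"
proof -
  let ?c = "cexp f"
  note c = bpos_cexp[OF f]
  note bf = bpos_bmeas[OF f] and bc = bpos_bmeas[OF c] and bl = bmeas_ln[OF c]
  have e1: "(\<integral>y. f y * ln (?c y) \<partial>\<gamma>) = (\<integral>y. xlnx (?c y) \<partial>\<gamma>)"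
    unfolding xlnx_def by (rule integral_cexp_mult[OF f bl]) (simp add: cexp_upd)
  have e2: "(\<integral>y. f y \<partial>\<gamma>) = (\<integral>y. ?c y \<partial>\<gamma>)"
    using integral_cexp_mult[OF f bmeas_one] by simp
  obtain e K where K: "e > 0" "\<forall>x \<in> space (Rn n). e \<le> ?c x" using c by (auto simp: bpos_def)
  obtain e' K' where K': "e' > 0" "\<forall>x \<in> space (Rn n). e' \<le> f x" using f by (auto simp: bpos_def)
  note i1 = bmeas_integrable_\<gamma>[OF bmeas_mult[OF bf bl]] and i2 = bmeas_integrable_\<gamma>[OF bf]
    and i3 = bmeas_integrable_\<gamma>[OF bc]
  have "(\<integral>y. f y * ln (?c y) + f y - ?c y \<partial>\<gamma>) \<le> (\<integral>x. xlnx (f x) \<partial>\<gamma>)"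
  proof (rule integral_mono)
    show "integrable \<gamma> (\<lambda>x. xlnx (f x))" by (rule bmeas_integrable_\<gamma>[OF bmeas_xlnx[OF f]])
    fix y assume "y \<in> space \<gamma>"
    then have y: "y \<in> space (Rn n)" by (simp add: space_\<gamma>)
    show "f y * ln (?c y) + f y - ?c y \<le> xlnx (f y)"
      using K K' y by (intro xlnx_tangent) (force intro: less_imp_le less_le_trans)+
  qed (use i1 i2 i3 in simp)
  then show ?thesis using i1 i2 i3 e1 e2 by simp
qed

lemma tower_bounded_below:
  assumes h: "h \<in> borel_measurable (Rn n)" and low: "\<And>x. x \<in> space (Rn n) \<Longrightarrow> - 1 \<le> h x"
    and int: "integrable \<gamma> h"
  shows "integrable \<gamma> (cexp h)" "(\<integral>x. cexp h x \<partial>\<gamma>) = (\<integral>x. h x \<partial>\<gamma>)"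
proof -
  interpret G: prob_space \<gamma> using law_\<gamma> by (simp add: law_def)
  let ?h = "\<lambda>x. h x + 1"
  have mh: "?h \<in> borel_measurable (Rn n)" using h by measurable
  have nn: "\<And>x. x \<in> space (Rn n) \<Longrightarrow> 0 \<le> ?h x" using low by force
  have ih: "integrable \<gamma> ?h" using int by simp
  have t: "AE x in \<gamma>. integrable (fibre x) (\<lambda>t. ?h (x(i := t)))"
    "integrable \<gamma> (cexp ?h)" "(\<integral>x. cexp ?h x \<partial>\<gamma>) = (\<integral>x. ?h x \<partial>\<gamma>)"
    by (rule tower_nonneg[OF mh _ ih], rule nn, assumption)+
  have "AE x in \<gamma>. cexp h x = cexp ?h x - 1"
    using t(1)
  proof (rule AE_mp, intro AE_I2 impI)
    fix x assume x: "x \<in> space \<gamma>" and i1: "integrable (fibre x) (\<lambda>t. ?h (x(i := t)))"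
    interpret P: prob_space "fibre x" using prob_space_fibre x by (simp add: space_\<gamma>)
    have "integrable (fibre x) (\<lambda>t. ?h (x(i := t)) - 1)" using i1 by (intro Bochner_Integration.integrable_diff) auto
    then show "cexp h x = cexp ?h x - 1" by (simp add: cexp_def P.prob_space)
  qed
  moreover have "cexp h \<in> borel_measurable \<gamma>" "cexp ?h \<in> borel_measurable \<gamma>"
    using cexp_measurable[OF h] cexp_measurable[OF mh] by (simp_all add: measurable_\<gamma>)
  moreover have "integrable \<gamma> (\<lambda>x. cexp ?h x - 1)" using t(2) by simp
  ultimately show "integrable \<gamma> (cexp h)" "(\<integral>x. cexp h x \<partial>\<gamma>) = (\<integral>x. h x \<partial>\<gamma>)"
    using t(2,3) int integrable_cong_AE[of "cexp h" \<gamma> "\<lambda>x. cexp ?h x - 1"]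
      integral_cong_AE[of "cexp h" \<gamma> "\<lambda>x. cexp ?h x - 1"]
    by (simp_all add: G.prob_space)
qed

lemma cexp_nonneg:
  assumes "\<And>x. x \<in> space (Rn n) \<Longrightarrow> 0 \<le> h x" "x \<in> space (Rn n)"
  shows "0 \<le> cexp h x"
  unfolding cexp_def using assms upd_space by (intro Bochner_Integration.integral_nonneg) auto

text \<open>
  The function \<open>x ln x\<close> is bounded below on \<open>[0,\<infinity>)\<close>, so Fatou's lemma applies to the conditional expectations
  of the truncations and yields this one-sided convergence. It is the direction needed, as the mean of
  \<open>x ln x\<close> of the conditional expectation enters the right-hand side of the theorem with a minus sign.
\<close>

lemma xlnx_cexp_clamp:
  assumes f: "f \<in> borel_measurable (Rn n)" and nonneg: "\<And>x. x \<in> space (Rn n) \<Longrightarrow> 0 \<le> f x"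
    and int: "integrable \<gamma> f" and intF: "integrable \<gamma> (\<lambda>x. xlnx (f x))"
  shows "integrable \<gamma> (\<lambda>x. xlnx (cexp f x))"
    "0 < d \<Longrightarrow> \<forall>\<^sub>F k in sequentially.
      (\<integral>x. xlnx (cexp f x) \<partial>\<gamma>) - d < (\<integral>x. xlnx (cexp (\<lambda>x. clamp_at k (f x)) x) \<partial>\<gamma>)"
proof -
  interpret G: prob_space \<gamma> using law_\<gamma> by (simp add: law_def)
  let ?g = "\<lambda>k x. clamp_at k (f x)"
  have g: "bpos n (?g k)" for k by (rule bpos_clamp[OF f])
  have mc: "(\<lambda>x. xlnx (cexp f x)) \<in> borel_measurable \<gamma>"
    unfolding measurable_\<gamma> by (rule measurable_compose[OF cexp_measurable[OF f] xlnx_measurable])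
  have cg: "0 \<le> cexp (?g k) x" if "x \<in> space (Rn n)" for k x
    using that by (intro cexp_nonneg less_imp_le[OF clamp_at_pos])
  have "AE x in \<gamma>. integrable (fibre x) (\<lambda>t. f (x(i := t)))"
    by (rule tower_nonneg(1)[OF f nonneg int])
  then have lim: "AE x in \<gamma>. (\<lambda>k. xlnx (cexp (?g k) x)) \<longlonglongrightarrow> xlnx (cexp f x)"
  proof (rule AE_mp, intro AE_I2 impI)
    fix x assume "x \<in> space \<gamma>" and i: "integrable (fibre x) (\<lambda>t. f (x(i := t)))"
    then have x: "x \<in> space (Rn n)" by (simp add: space_\<gamma>)
    interpret P: prob_space "fibre x" by (rule prob_space_fibre[OF x])
    have "(\<lambda>k. cexp (?g k) x) \<longlonglongrightarrow> cexp f x"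
      unfolding cexp_def
    proof (rule integral_dominated_convergence)
      show "integrable (fibre x) (\<lambda>t. f (x(i := t)) + 1)" using i by simp
      show "AE t in fibre x. (\<lambda>k. ?g k (x(i := t))) \<longlonglongrightarrow> f (x(i := t))"
        using nonneg upd_space[OF x] by (intro AE_I2 clamp_at_tendsto) auto
      show "AE t in fibre x. norm (?g k (x(i := t))) \<le> f (x(i := t)) + 1" for k
        using nonneg upd_space[OF x] clamp_at_pos[of k] clamp_at_le[of _ k]
        by (intro AE_I2) (auto simp: abs_of_pos)
      show "(\<lambda>t. f (x(i := t))) \<in> borel_measurable (fibre x)" by (rule measurable_fibre[OF x f])
      show "(\<lambda>t. ?g k (x(i := t))) \<in> borel_measurable (fibre x)" for k
        by (rule measurable_fibre[OF x]) (rule measurable_compose[OF f clamp_at_measurable])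
    qed
    then show "(\<lambda>k. xlnx (cexp (?g k) x)) \<longlonglongrightarrow> xlnx (cexp f x)"
      using cg[OF x] by (intro xlnx_tendsto)
  qed
  have iu: "integrable \<gamma> (\<lambda>x. xlnx (cexp (?g k) x))" for k
    by (rule bmeas_integrable_\<gamma>[OF bmeas_xlnx[OF bpos_cexp[OF g]]])
  have B: "(\<integral>x. xlnx (cexp (?g k) x) \<partial>\<gamma>) \<le> (\<integral>x. \<bar>xlnx (f x)\<bar> + 1 \<partial>\<gamma>)" for k
  proof -
    have "(\<integral>x. xlnx (?g k x) \<partial>\<gamma>) \<le> (\<integral>x. \<bar>xlnx (f x)\<bar> + 1 \<partial>\<gamma>)"
      using intF bmeas_integrable_\<gamma>[OF bmeas_xlnx[OF g]] xlnx_clamp_at nonneg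
      by (intro integral_mono) (auto simp: space_\<gamma> abs_le_iff)
    then show ?thesis using xlnx_cexp_le[OF g] by (rule order_trans[rotated])
  qed
  have l1: "- 1 \<le> xlnx (cexp (?g k) x)" if "x \<in> space \<gamma>" for k x
    using cg that by (intro xlnx_ge) (simp add: space_\<gamma>)
  have l2: "- 1 \<le> xlnx (cexp f x)" if "x \<in> space \<gamma>" for x
    using cexp_nonneg[OF nonneg] that by (intro xlnx_ge) (simp add: space_\<gamma>)
  show "integrable \<gamma> (\<lambda>x. xlnx (cexp f x))" by (rule G.fatou_bounded_below(1)[OF iu l1 mc l2 lim B])
  show "\<forall>\<^sub>F k in sequentially.
      (\<integral>x. xlnx (cexp f x) \<partial>\<gamma>) - d < (\<integral>x. xlnx (cexp (\<lambda>x. clamp_at k (f x)) x) \<partial>\<gamma>)" if "0 < d"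
    by (rule G.fatou_bounded_below(2)[OF iu l1 mc l2 lim B that])
qed

lemma integral_ent_fibre:
  assumes f: "f \<in> borel_measurable (Rn n)" and nonneg: "\<And>x. x \<in> space (Rn n) \<Longrightarrow> 0 \<le> f x"
    and int: "integrable \<gamma> f" and intF: "integrable \<gamma> (\<lambda>x. xlnx (f x))"
  shows "(\<integral>x. ent (fibre x) (\<lambda>t. f (x(i := t))) \<partial>\<gamma>)
    = (\<integral>x. xlnx (f x) \<partial>\<gamma>) - (\<integral>x. xlnx (cexp f x) \<partial>\<gamma>)"
proof -
  have F: "(\<lambda>x. xlnx (f x)) \<in> borel_measurable (Rn n)" using f by measurable
  have t: "integrable \<gamma> (cexp (\<lambda>x. xlnx (f x)))"
    "(\<integral>x. cexp (\<lambda>x. xlnx (f x)) x \<partial>\<gamma>) = (\<integral>x. xlnx (f x) \<partial>\<gamma>)"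
    by (rule tower_bounded_below[OF F xlnx_ge[OF nonneg] intF], assumption)+
  have c: "integrable \<gamma> (\<lambda>x. xlnx (cexp f x))"
    by (rule xlnx_cexp_clamp(1)[OF f nonneg int intF])
  have "(\<integral>x. ent (fibre x) (\<lambda>t. f (x(i := t))) \<partial>\<gamma>)
      = (\<integral>x. cexp (\<lambda>x. xlnx (f x)) x - xlnx (cexp f x) \<partial>\<gamma>)"
    by (simp add: ent_def cexp_def xlnx_def)
  then show ?thesis using t c by simp
qed

end

section \<open>Approximate tensorization of entropy\<close>

text \<open>
  Limit of the inequality for the truncations of \<open>f\<close>. The terms without conditional expectations converge
  by dominated convergence, the others are controlled up to \<open>d\<close> for large \<open>k\<close>.
\<close>

lemma gaussian_tensorization:
  assumes S: "pos_def_mat \<Sigma>" "\<Sigma> \<in> carrier_mat n n" and n: "0 < n" and \<mu>: "\<mu> \<in> carrier_vec n"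
    and f: "f \<in> borel_measurable (Rn n)" and nonneg: "\<And>x. x \<in> space (Rn n) \<Longrightarrow> 0 \<le> f x"
    and int: "integrable (gaussian_measure n \<mu> \<Sigma>) f"
    and intF: "integrable (gaussian_measure n \<mu> \<Sigma>) (\<lambda>x. xlnx (f x))"
  shows "ent (gaussian_measure n \<mu> \<Sigma>) f \<le> 2 * condition_number \<Sigma> *
    (\<Sum>i<n. \<integral>x. ent (gaussian_cond n \<mu> \<Sigma> i x) (\<lambda>t. f (x(i := t))) \<partial>gaussian_measure n \<mu> \<Sigma>)"
proof -
  let ?\<gamma> = "gaussian_measure n \<mu> \<Sigma>"
  let ?C = "2 * condition_number \<Sigma>"
  let ?g = "\<lambda>k x. clamp_at k (f x)"
  let ?c = "\<lambda>i. gaussian_fibre.cexp n \<mu> \<Sigma> i"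
  let ?Eg = "\<lambda>k. \<integral>y. xlnx (?g k y) \<partial>?\<gamma>" and ?mg = "\<lambda>k. xlnx (\<integral>y. ?g k y \<partial>?\<gamma>)"
  let ?bg = "\<lambda>k i. \<integral>y. xlnx (?c i (?g k) y) \<partial>?\<gamma>" and ?m = "xlnx (\<integral>y. f y \<partial>?\<gamma>)"
  have fib: "gaussian_fibre n \<mu> \<Sigma> i" if "i < n" for i
    using S \<mu> that by unfold_locales
  interpret G: prob_space ?\<gamma> using law_gaussian[OF S \<mu>] by (simp add: law_def)
  have sp: "space ?\<gamma> = space (Rn n)" by (rule space_law[OF law_gaussian[OF S \<mu>]])
  have ms: "borel_measurable ?\<gamma> = borel_measurable (Rn n)"
    by (rule measurable_cong_sets[OF sets_law[OF law_gaussian[OF S \<mu>]] refl])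
  have C: "0 \<le> ?C"
    using spectrum_bounds(1,2)[OF S n] by (simp add: condition_number_def)
  have bounded: "?Eg k - ?mg k
    \<le> ?C * (\<Sum>i<n. ?Eg k - ?bg k i)" for k
  proof (rule gaussian_tensorization_bounded[OF S n \<mu> bpos_clamp[OF f]])
    fix i assume i: "i < n"
    show "bpos n (?c i (?g k))" by (rule gaussian_fibre.bpos_cexp[OF fib[OF i] bpos_clamp[OF f]])
    show "?c i (?g k) (x(i := t)) = ?c i (?g k) x" for x t
      by (rule gaussian_fibre.cexp_upd[OF fib[OF i]])
    fix w assume w: "bmeas n w" "\<And>x t. x \<in> space (Rn n) \<Longrightarrow> w (x(i := t)) = w x"
    show "(\<integral>y. ?g k y * w y \<partial>?\<gamma>) = (\<integral>y. ?c i (?g k) y * w y \<partial>?\<gamma>)"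
      by (rule gaussian_fibre.integral_cexp_mult[OF fib[OF i] bpos_clamp[OF f] w(1)]) (rule w(2))
  qed
  have EF: "?Eg \<longlonglongrightarrow> (\<integral>y. xlnx (f y) \<partial>?\<gamma>)"
  proof (rule integral_dominated_convergence)
    show "integrable ?\<gamma> (\<lambda>x. \<bar>xlnx (f x)\<bar> + 1)" using intF by simp
    show "AE x in ?\<gamma>. (\<lambda>k. xlnx (?g k x)) \<longlonglongrightarrow> xlnx (f x)"
      using nonneg
      by (intro AE_I2 xlnx_tendsto clamp_at_tendsto less_imp_le[OF clamp_at_pos]) (simp add: sp)
    show "AE x in ?\<gamma>. norm (xlnx (?g k x)) \<le> \<bar>xlnx (f x)\<bar> + 1" for k
      using nonneg xlnx_clamp_at by (intro AE_I2) (simp add: sp)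
    show "(\<lambda>x. xlnx (f x)) \<in> borel_measurable ?\<gamma>" using intF by simp
    show "(\<lambda>x. xlnx (?g k x)) \<in> borel_measurable ?\<gamma>" for k unfolding ms using f by measurable
  qed
  have E: "(\<lambda>k. \<integral>y. ?g k y \<partial>?\<gamma>) \<longlonglongrightarrow> (\<integral>y. f y \<partial>?\<gamma>)"
  proof (rule integral_dominated_convergence)
    show "integrable ?\<gamma> (\<lambda>x. f x + 1)" using int by simp
    show "AE x in ?\<gamma>. (\<lambda>k. ?g k x) \<longlonglongrightarrow> f x"
      using nonneg by (intro AE_I2 clamp_at_tendsto) (simp add: sp)
    show "AE x in ?\<gamma>. norm (?g k x) \<le> f x + 1" for k
      using nonneg clamp_at_pos[of k] clamp_at_le[of _ k] by (intro AE_I2) (auto simp: sp abs_of_pos)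
    show "f \<in> borel_measurable ?\<gamma>" using int by simp
    show "?g k \<in> borel_measurable ?\<gamma>" for k unfolding ms using f by measurable
  qed
  have xE: "?mg \<longlonglongrightarrow> ?m"
    using E by (intro xlnx_tendsto) (auto intro!: Bochner_Integration.integral_nonneg less_imp_le[OF clamp_at_pos])
  let ?EF = "\<integral>y. xlnx (f y) \<partial>?\<gamma>" and ?b = "\<lambda>i. \<integral>y. xlnx (?c i f y) \<partial>?\<gamma>"
  let ?S = "\<Sum>i<n. ?EF - ?b i"
  have eps: "?EF - ?m \<le> ?C * ?S + ?C * real n * d" if d: "0 < d" for d
  proof -
    have "\<forall>\<^sub>F k in sequentially. \<forall>i\<in>{..<n}. ?b i - d < ?bg k i"
    proof (intro eventually_ball_finite ballI finite_lessThan)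
      fix i assume "i \<in> {..<n}"
      then have i: "i < n" by simp
      show "\<forall>\<^sub>F k in sequentially. ?b i - d < ?bg k i"
        by (rule gaussian_fibre.xlnx_cexp_clamp(2)[OF fib[OF i] f nonneg int intF d])
    qed
    then have "\<forall>\<^sub>F k in sequentially. ?Eg k - ?mg k
      \<le> ?C * (\<Sum>i<n. ?Eg k - (?b i - d))"
    proof (rule eventually_mono)
      fix k assume "\<forall>i\<in>{..<n}. ?b i - d < ?bg k i"
      then have "?C * (\<Sum>i<n. ?Eg k - ?bg k i)
        \<le> ?C * (\<Sum>i<n. ?Eg k - (?b i - d))"
        using C by (intro mult_left_mono sum_mono diff_left_mono) (auto simp: less_imp_le)
      then show "?Eg k - ?mg k
        \<le> ?C * (\<Sum>i<n. ?Eg k - (?b i - d))" using bounded[of k] by linarith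
    qed
    moreover have "(\<lambda>k. ?C * (\<Sum>i<n. ?Eg k - (?b i - d)))
      \<longlonglongrightarrow> ?C * (\<Sum>i<n. ?EF - (?b i - d))"
      by (intro tendsto_intros EF)
    ultimately have "?EF - ?m \<le> ?C * (\<Sum>i<n. ?EF - (?b i - d))"
      by (intro tendsto_le[OF sequentially_bot _ tendsto_diff[OF EF xE]])
    also have "(\<Sum>i<n. ?EF - (?b i - d)) = ?S + real n * d"
      by (simp add: sum_subtractf sum.distrib algebra_simps)
    finally show ?thesis by (simp add: algebra_simps)
  qed
  have "?EF - ?m \<le> ?C * ?S"
  proof (rule field_le_epsilon)
    fix e :: real assume e: "0 < e"
    \<comment> \<open>The summand \<open>1\<close> only keeps the denominator positive.\<close>
    let ?d = "e / (?C * real n + 1)"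
    have Cn: "0 \<le> ?C * real n" using C by simp
    then have "0 < ?d" using e by (intro divide_pos_pos) auto
    moreover have "?C * real n * ?d \<le> e"
    proof -
      have "?C * real n * ?d = e * ((?C * real n) / (?C * real n + 1))" by simp
      also have "\<dots> \<le> e * 1" using Cn e by (intro mult_left_mono) auto
      finally show ?thesis by simp
    qed
    ultimately show "?EF - ?m \<le> ?C * ?S + e" using eps[of ?d] by linarith
  qed
  moreover have "(\<Sum>i<n. \<integral>x. ent (gaussian_cond n \<mu> \<Sigma> i x) (\<lambda>t. f (x(i := t))) \<partial>?\<gamma>) = ?S"
  proof (intro sum.cong refl)
    fix i assume "i \<in> {..<n}"
    then have i: "i < n" by simp
    show "(\<integral>x. ent (gaussian_cond n \<mu> \<Sigma> i x) (\<lambda>t. f (x(i := t))) \<partial>?\<gamma>) = ?EF - ?b i"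
      by (rule gaussian_fibre.integral_ent_fibre[OF fib[OF i] f nonneg int intF])
  qed
  ultimately show ?thesis by (simp add: ent_def xlnx_def)
qed

theorem theorem3p9:
  shows "\<exists>C::real. C > 0 \<and>
    (\<forall>(n::nat) (\<mu>::real vec) (\<Sigma>::real mat) (f::(nat \<Rightarrow> real) \<Rightarrow> real).
       \<mu> \<in> carrier_vec n \<longrightarrow> \<Sigma> \<in> carrier_mat n n \<longrightarrow> pos_def_mat \<Sigma> \<longrightarrow>
       ent_exists (gaussian_measure n \<mu> \<Sigma>) f \<longrightarrow>
       ent (gaussian_measure n \<mu> \<Sigma>) f
         \<le> C * condition_number \<Sigma> *
           (\<Sum>i<n. \<integral>x. ent (gaussian_cond n \<mu> \<Sigma> i x) (\<lambda>t. f (x(i := t))) \<partial>gaussian_measure n \<mu> \<Sigma>))"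
proof (intro exI[of _ "2 :: real"] conjI allI impI)
  fix n \<mu> \<Sigma> and f :: "(nat \<Rightarrow> real) \<Rightarrow> real"
  assume \<mu>: "\<mu> \<in> carrier_vec n" and S: "\<Sigma> \<in> carrier_mat n n" "pos_def_mat \<Sigma>"
    and ex: "ent_exists (gaussian_measure n \<mu> \<Sigma>) f"
  let ?\<gamma> = "gaussian_measure n \<mu> \<Sigma>"
  note l = law_gaussian[OF S(2,1) \<mu>]
  interpret G: prob_space ?\<gamma> using l by (simp add: law_def)
  show "ent ?\<gamma> f \<le> 2 * condition_number \<Sigma> *
    (\<Sum>i<n. \<integral>x. ent (gaussian_cond n \<mu> \<Sigma> i x) (\<lambda>t. f (x(i := t))) \<partial>?\<gamma>)"
  proof (cases "n = 0")
    case True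
    \<comment> \<open>The space has a single point, so every function on it is constant and has entropy \<open>0\<close>.\<close>
    have "(\<integral>x. h (f x) \<partial>?\<gamma>) = h (f (\<lambda>_. undefined))" for h :: "real \<Rightarrow> real"
    proof -
      have "(\<integral>x. h (f x) \<partial>?\<gamma>) = (\<integral>x. h (f (\<lambda>_. undefined)) \<partial>?\<gamma>)"
        using space_law[OF l] True
        by (intro Bochner_Integration.integral_cong refl) (simp add: space_PiM)
      then show ?thesis by (simp add: G.prob_space)
    qed
    from this[of "\<lambda>y. y * ln y"] this[of "\<lambda>y. y"] have "ent ?\<gamma> f = 0" by (simp add: ent_def)
    then show ?thesis using True by simp
  next
    case False
    have f: "f \<in> borel_measurable ?\<gamma>" and int: "integrable ?\<gamma> f"
      and absint: "integrable ?\<gamma> (\<lambda>x. f x * \<bar>ln (f x)\<bar>)"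
      and nonneg: "\<And>x. x \<in> space ?\<gamma> \<Longrightarrow> 0 \<le> f x"
      using ex by (auto simp: ent_exists_def)
    have "integrable ?\<gamma> (\<lambda>x. xlnx (f x))"
      using f nonneg
      by (intro Bochner_Integration.integrable_bound[OF absint] AE_I2) (auto simp: xlnx_def abs_mult)
    moreover have "f \<in> borel_measurable (Rn n)"
      using f measurable_cong_sets[OF sets_law[OF l] refl] by blast
    ultimately show ?thesis
      using False nonneg int space_law[OF l] by (intro gaussian_tensorization S \<mu>) auto
  qed
qed simp

end
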